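(* Let $\Omega\subset\mathbb{R}^n$ ($n\ge2$) be a bounded domain, $1<p\le q<\infty$, $0\le a(\cdot)\in C^{0,\alpha}(\Omega)$ with $\alpha\in(0,1]$, and $\frac{q}{p}\le 1+\frac{\alpha}{n}$. Assume moreover that $a\in C^1(\Omega)$. Then every $\mathcal{A}_{H(\cdot)}$-superharmonic function in $\Omega$ is a viscosity supersolution to $-\operatorname{div}(|Du|^{p-2}Du+a(x)|Du|^{q-2}Du)=0$ in $\Omega$.
   Context: Notation: $H(x,\xi)=|\xi|^p+a(x)|\xi|^q$ and $A(x,\xi)=|\xi|^{p-2}\xi+a(x)|\xi|^{q-2}\xi$ (with $A(x,0)=0$). For an open set $D$, $L^{H(\cdot)}(D)$ is the set of measurable $u$ with $\int_D H(x,u)\,dx<\infty$, with norm $\inf\{\lambda>0:\int_D H(x,u/\lambda)\,dx\le 1\}$; $W^{1,H(\cdot)}(D)$ is the set of $u\in L^{H(\cdot)}(D)$ with distributional gradient $Du\in L^{H(\cdot)}(D)$, with norm $\|u\|_{L^{H(\cdot)}}+\|Du\|_{L^{H(\cdot)}}$; $W^{1,H(\cdot)}_{\rm loc}(D)$ is the set of functions in $W^{1,H(\cdot)}(D')$ for every $D'\subset\subset D$; $W^{1,H(\cdot)}_0(D)$ is the closure of $C_0^\infty(D)$ in $W^{1,H(\cdot)}(D)$. Distributional solution in $D$: $h\in W^{1,H(\cdot)}_{\rm loc}(D)$ with $\int_D\langle A(x,Dh),D\eta\rangle\,dx=0$ for every $\eta\in W^{1,H(\cdot)}_0(D)$ with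 compact support in $D$. $u:\Omega\to(-\infty,\infty]$ is $\mathcal{A}_{H(\cdot)}$-superharmonic in $\Omega$ if (1) $u$ is lower semicontinuous in $\Omega$; (2) $u$ is finite a.e. in $\Omega$; (3) for any subdomain $D\subset\subset\Omega$, whenever $h\in C(\overline D)$ is a distributional solution in $D$ of $-\operatorname{div}A(x,Dh)=0$ and $u\ge h$ on $\partial D$, then $u\ge h$ in $D$. Viscosity supersolution: a lower semicontinuous $u:\Omega\to(-\infty,\infty]$, finite a.e. in $\Omega$, such that whenever $x_0\in\Omega$ and $\varphi\in C^2(\Omega)$ satisfy $\varphi(x_0)=u(x_0)$, $\varphi(x)<u(x)$ for $x\ne x_0$, and $D\varphi(x_0)\ne 0$, one has $-\operatorname{div}A(x_0,D\varphi(x_0))\ge 0$. Here $\operatorname{div}A(x_0,D\varphi(x_0))$ is the pointwise value at $x_0$ of the divergence of the vector field $x\mapsto A(x,D\varphi(x))$. *)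

theory Defs
  imports "HOL-Analysis.Analysis"
begin

definition domain :: "'a::euclidean_space set \<Rightarrow> bool" where
  "domain D \<longleftrightarrow> open D \<and> connected D \<and> D \<noteq> {}"

definition compactly_inside :: "'a::euclidean_space set \<Rightarrow> 'a set \<Rightarrow> bool" where
  "compactly_inside D' D \<longleftrightarrow> open D' \<and> compact (closure D') \<and> closure D' \<subseteq> D"


subsection \<open>Classical derivatives\<close>

definition gradient :: "('a::euclidean_space \<Rightarrow> real) \<Rightarrow> 'a \<Rightarrow> 'a" where
  "gradient f x = (\<Sum>b\<in>Basis. frechet_derivative f (at x) b *\<^sub>R b)"

definition divergence :: "('a::euclidean_space \<Rightarrow> 'a) \<Rightarrow> 'a \<Rightarrow> real" where
  "divergence F x = (\<Sum>b\<in>Basis. frechet_derivative F (at x) b \<bullet> b)"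

text \<open>\<open>Ck k S f\<close> is meant for open \<open>S\<close>.\<close>

primrec Ck :: "nat \<Rightarrow> 'a::euclidean_space set \<Rightarrow> ('a \<Rightarrow> real) \<Rightarrow> bool" where
  "Ck 0 S f \<longleftrightarrow> continuous_on S f"
| "Ck (Suc k) S f \<longleftrightarrow> (\<forall>x\<in>S. f differentiable (at x)) \<and>
     (\<forall>b\<in>Basis. Ck k S (\<lambda>x. frechet_derivative f (at x) b))"

definition hoelder_on :: "real \<Rightarrow> 'a::euclidean_space set \<Rightarrow> ('a \<Rightarrow> real) \<Rightarrow> bool" where
  "hoelder_on \<alpha> S f \<longleftrightarrow> (\<exists>L. \<forall>x\<in>S. \<forall>y\<in>S. \<bar>f x - f y\<bar> \<le> L * dist x y powr \<alpha>)"

text \<open>Elements of \<open>C\<^sub>0\<^sup>\<infinity>(D)\<close> are represented by their extension by zero to the whole space.\<close>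

definition test_functions :: "'a::euclidean_space set \<Rightarrow> ('a \<Rightarrow> real) set" where
  "test_functions D = {\<eta>. (\<forall>k. Ck k UNIV \<eta>) \<and>
     compact (closure {x. \<eta> x \<noteq> 0}) \<and> closure {x. \<eta> x \<noteq> 0} \<subseteq> D}"


subsection \<open>Distributional gradients\<close>

definition locally_integrable ::
    "'a::euclidean_space set \<Rightarrow> ('a \<Rightarrow> 'b::euclidean_space) \<Rightarrow> bool" where
  "locally_integrable D f \<longleftrightarrow> (\<forall>K. compact K \<longrightarrow> K \<subseteq> D \<longrightarrow> integrable (lebesgue_on K) f)"

definition has_weak_gradient ::
    "'a::euclidean_space set \<Rightarrow> ('a \<Rightarrow> real) \<Rightarrow> ('a \<Rightarrow> 'a) \<Rightarrow> bool" where
  "has_weak_gradient D u G \<longleftrightarrow> locally_integrable D u \<and> locally_integrable D G \<and>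
     (\<forall>\<eta>\<in>test_functions D.
        (LINT x|lebesgue_on D. u x *\<^sub>R gradient \<eta> x) = - (LINT x|lebesgue_on D. \<eta> x *\<^sub>R G x))"

text \<open>A chosen representative; it is determined up to a null subset of \<open>D\<close> whenever a
  distributional gradient exists, and everything below depends on its a.e.-class only.\<close>

definition weak_gradient :: "'a::euclidean_space set \<Rightarrow> ('a \<Rightarrow> real) \<Rightarrow> 'a \<Rightarrow> 'a" where
  "weak_gradient D u = (SOME G. has_weak_gradient D u G)"


subsection \<open>The double phase operator and its function spaces\<close>

definition H_dp :: "real \<Rightarrow> real \<Rightarrow> ('a \<Rightarrow> real) \<Rightarrow> 'a \<Rightarrow> 'b::euclidean_space \<Rightarrow> real" where
  "H_dp p q a x \<xi> = norm \<xi> powr p + a x * norm \<xi> powr q"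

definition A_dp :: "real \<Rightarrow> real \<Rightarrow> ('a \<Rightarrow> real) \<Rightarrow> 'a \<Rightarrow> 'b::euclidean_space \<Rightarrow> 'b" where
  "A_dp p q a x \<xi> = (norm \<xi> powr (p - 2)) *\<^sub>R \<xi> + (a x * norm \<xi> powr (q - 2)) *\<^sub>R \<xi>"

definition LH :: "real \<Rightarrow> real \<Rightarrow> ('a::euclidean_space \<Rightarrow> real) \<Rightarrow> 'a set
    \<Rightarrow> ('a \<Rightarrow> 'b::euclidean_space) set" where
  "LH p q a D = {u. u \<in> borel_measurable (lebesgue_on D) \<and>
     (\<integral>\<^sup>+x. ennreal (H_dp p q a x (u x)) \<partial>lebesgue_on D) < \<infinity>}"

definition LH_norm :: "real \<Rightarrow> real \<Rightarrow> ('a::euclidean_space \<Rightarrow> real) \<Rightarrow> 'a set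
    \<Rightarrow> ('a \<Rightarrow> 'b::euclidean_space) \<Rightarrow> real" where
  "LH_norm p q a D u =
     Inf {l. l > 0 \<and> (\<integral>\<^sup>+x. ennreal (H_dp p q a x (u x /\<^sub>R l)) \<partial>lebesgue_on D) \<le> 1}"

definition W1H :: "real \<Rightarrow> real \<Rightarrow> ('a::euclidean_space \<Rightarrow> real) \<Rightarrow> 'a set \<Rightarrow> ('a \<Rightarrow> real) set" where
  "W1H p q a D = {u \<in> LH p q a D. \<exists>G \<in> LH p q a D. has_weak_gradient D u G}"

definition W1H_norm :: "real \<Rightarrow> real \<Rightarrow> ('a::euclidean_space \<Rightarrow> real) \<Rightarrow> 'a set \<Rightarrow> ('a \<Rightarrow> real) \<Rightarrow> real"
  where "W1H_norm p q a D u = LH_norm p q a D u + LH_norm p q a D (weak_gradient D u)"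

definition W1H_loc :: "real \<Rightarrow> real \<Rightarrow> ('a::euclidean_space \<Rightarrow> real) \<Rightarrow> 'a set \<Rightarrow> ('a \<Rightarrow> real) set" where
  "W1H_loc p q a D = {u. \<forall>D'. compactly_inside D' D \<longrightarrow> u \<in> W1H p q a D'}"

definition W1H_0 :: "real \<Rightarrow> real \<Rightarrow> ('a::euclidean_space \<Rightarrow> real) \<Rightarrow> 'a set \<Rightarrow> ('a \<Rightarrow> real) set" where
  "W1H_0 p q a D = {u \<in> W1H p q a D.
     \<forall>e>0. \<exists>\<psi>\<in>test_functions D. W1H_norm p q a D (\<lambda>x. u x - \<psi> x) < e}"

text \<open>Support in the a.e. sense, for functions on \<open>D\<close>.\<close>

definition compact_support_in :: "'a::euclidean_space set \<Rightarrow> ('a \<Rightarrow> real) \<Rightarrow> bool" where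
  "compact_support_in D \<eta> \<longleftrightarrow>
     (\<exists>K. compact K \<and> K \<subseteq> D \<and> (AE x in lebesgue_on D. x \<notin> K \<longrightarrow> \<eta> x = 0))"


subsection \<open>Notions of solution\<close>

text \<open>By Young's inequality and the compact support of \<open>\<eta>\<close> the integrand is always integrable, so
  the convention that the integral of a non-integrable function is zero plays no role.\<close>

definition distributional_solution ::
    "real \<Rightarrow> real \<Rightarrow> ('a::euclidean_space \<Rightarrow> real) \<Rightarrow> 'a set \<Rightarrow> ('a \<Rightarrow> real) \<Rightarrow> bool" where
  "distributional_solution p q a D h \<longleftrightarrow> h \<in> W1H_loc p q a D \<and>
     (\<forall>\<eta>\<in>W1H_0 p q a D. compact_support_in D \<eta> \<longrightarrow>
        (LINT x|lebesgue_on D. A_dp p q a x (weak_gradient D h x) \<bullet> weak_gradient D \<eta> x) = 0)"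

definition lsc_on :: "'a::euclidean_space set \<Rightarrow> ('a \<Rightarrow> ereal) \<Rightarrow> bool" where
  "lsc_on S u \<longleftrightarrow> (\<forall>x\<in>S. u x \<le> Liminf (at x within S) u)"

definition superharmonic ::
    "real \<Rightarrow> real \<Rightarrow> ('a::euclidean_space \<Rightarrow> real) \<Rightarrow> 'a set \<Rightarrow> ('a \<Rightarrow> ereal) \<Rightarrow> bool" where
  "superharmonic p q a \<Omega> u \<longleftrightarrow>
     (\<forall>x\<in>\<Omega>. u x \<noteq> -\<infinity>) \<and>
     lsc_on \<Omega> u \<and>
     (AE x in lebesgue_on \<Omega>. \<bar>u x\<bar> \<noteq> \<infinity>) \<and>
     (\<forall>D h. domain D \<longrightarrow> compactly_inside D \<Omega> \<longrightarrow>
        continuous_on (closure D) h \<longrightarrow> distributional_solution p q a D h \<longrightarrow>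
        (\<forall>x\<in>frontier D. ereal (h x) \<le> u x) \<longrightarrow>
        (\<forall>x\<in>D. ereal (h x) \<le> u x))"

definition viscosity_supersolution ::
    "real \<Rightarrow> real \<Rightarrow> ('a::euclidean_space \<Rightarrow> real) \<Rightarrow> 'a set \<Rightarrow> ('a \<Rightarrow> ereal) \<Rightarrow> bool" where
  "viscosity_supersolution p q a \<Omega> u \<longleftrightarrow>
     (\<forall>x\<in>\<Omega>. u x \<noteq> -\<infinity>) \<and>
     lsc_on \<Omega> u \<and>
     (AE x in lebesgue_on \<Omega>. \<bar>u x\<bar> \<noteq> \<infinity>) \<and>
     (\<forall>x0\<in>\<Omega>. \<forall>\<phi>. Ck 2 \<Omega> \<phi> \<longrightarrow>
        ereal (\<phi> x0) = u x0 \<longrightarrow>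
        (\<forall>x\<in>\<Omega>. x \<noteq> x0 \<longrightarrow> ereal (\<phi> x) < u x) \<longrightarrow>
        gradient \<phi> x0 \<noteq> 0 \<longrightarrow>
        - divergence (\<lambda>x. A_dp p q a x (gradient \<phi> x)) x0 \<ge> 0)"

end

theory Submission
  imports Defs
begin

text \<open>Suppose that \<open>\<phi>\<close> touches \<open>u\<close> from below at \<open>x\<^sub>0\<close> and violates the inequality there. Subtracting a
  small multiple of \<open>|x - x\<^sub>0|\<^sup>2\<close> from the second-order Taylor polynomial of \<open>\<phi>\<close> gives a quadratic
  polynomial \<open>P\<close> that satisfies the equation at \<open>x\<^sub>0\<close>. On a ball of small radius \<open>r\<close> a genuine \<open>C\<^sup>1\<close> weak
  solution \<open>h\<close> exists with \<open>|h - P| \<le> \<delta> r\<^sup>2\<close>, for any prescribed \<open>\<delta>\<close>; a vertical translate of \<open>h\<close> then lies below \<open>u\<close> on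
  the boundary of a concentric ball but above \<open>u\<close> at \<open>x\<^sub>0\<close>, contradicting superharmonicity. No solvability or
  regularity theory for the Dirichlet problem is needed.

  The solution \<open>h\<close> comes from a contraction argument in the Hoelder space with exponent \<open>1/2\<close>: since
  \<open>D\<phi>(x\<^sub>0) \<noteq> 0\<close>, after rescaling to the unit ball the operator is a small \<open>C\<^sup>1\<close> perturbation of its
  linearisation, which has constant coefficients. The latter is inverted by convolution with a
  second derivative of the Newton potential, summed over the scales \<open>4\<^sup>-\<^sup>j\<close>.\<close>

section \<open>Integration by parts\<close>

text \<open>The inverse of the linearised operator is a singular integral. In general such an
  operator does not preserve continuity, but it does preserve Hoelder continuity. With exponent 1/2,
  an increment at scale 4^-j carries the factor sqrt(4^-j) = 2^-j, so the series over the scales is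
  geometric. The unknown is a field \<open>W\<close> with \<open>N W = Dv\<close>, where
  \<open>N\<close> inverts the derivative of the operator in the gradient variable. A density
  \<open>F\<close> produces \<open>W = V F\<close> with \<open>div (V F) = mass * div F\<close> in
  the weak sense. The equation \<open>div (W + E W) = 0\<close> for a remainder \<open>E\<close>
  thus becomes the fixed point equation \<open>F = - E (V F) / mass\<close>. A cutoff keeps
  \<open>F\<close> Hoelder across the unit sphere; the equation then holds in the half ball, and the
  comparison is made there. The coefficient \<open>a\<close> is only C^1. What survives the blow-up
  is strict differentiability at one point: it makes the Lipschitz constant of the remainder in the
  space variable small. The polynomial lies below \<open>\<phi>\<close> by a multiple of r^2 on
  spheres of radius comparable to r, so closeness of \<open>h\<close> to it of order r^2 decides the
  comparison; second derivatives of \<open>h\<close> do not occur.\<close>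

lemma integrable_compact_support:
  fixes f :: "'a::euclidean_space \<Rightarrow> 'b::banach"
  assumes "continuous_on (cbox a b) f" and "\<And>x. x \<notin> cbox a b \<Longrightarrow> f x = 0"
  shows "(f has_integral integral (cbox a b) f) UNIV"
    and "f integrable_on UNIV"
    and "integral UNIV f = integral (cbox a b) f"
proof -
  show *: "(f has_integral integral (cbox a b) f) UNIV"
    using has_integral_on_superset[OF integrable_integral[OF integrable_continuous[OF assms(1)]]] assms(2)
    by blast
  then show "f integrable_on UNIV" "integral UNIV f = integral (cbox a b) f"
    by (auto simp: integrable_on_def integral_unique)
qed

lemma cball_subset_centered_cbox:
  fixes x :: "'a::euclidean_space"
  shows "cball x r \<subseteq> cbox (x - r *\<^sub>R One) (x + r *\<^sub>R One)"
proof
  fix y assume "y \<in> cball x r"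
  then have "norm (y - x) \<le> r" by (simp add: dist_norm norm_minus_commute)
  then have "\<bar>(y - x) \<bullet> i\<bar> \<le> r" if "i \<in> Basis" for i
    using Basis_le_norm[OF that, of "y - x"] by linarith
  then show "y \<in> cbox (x - r *\<^sub>R One) (x + r *\<^sub>R One)"
    by (force simp: mem_box inner_diff_left inner_add_left abs_le_iff)
qed

lemma content_centered_cbox:
  fixes x :: "'a::euclidean_space"
  assumes "0 \<le> r"
  shows "Henstock_Kurzweil_Integration.content (cbox (x - r *\<^sub>R One) (x + r *\<^sub>R One)) = (2 * r) ^ DIM('a)"
  using assms by (subst content_cbox) (auto simp: inner_diff_left inner_add_left)

lemma integral_translation_compact_support:
  fixes f :: "'a::euclidean_space \<Rightarrow> 'b::banach"
  assumes "continuous_on UNIV f" and "\<And>x. x \<notin> cbox a b \<Longrightarrow> f x = 0"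
  shows "integral UNIV (\<lambda>x. f (x + c)) = integral UNIV f"
proof -
  have "continuous_on (cbox a b) f"
    using assms(1) continuous_on_subset by blast
  from has_integral_affinity'[OF integrable_integral[OF integrable_continuous[OF this]], of 1 c]
  have "((\<lambda>x. f (x + c)) has_integral integral (cbox a b) f) (cbox (a - c) (b - c))"
    by simp
  moreover have "f (x + c) = 0" if "x \<notin> cbox (a - c) (b - c)" for x
  proof (rule assms(2))
    show "x + c \<notin> cbox a b"
      using that by (auto simp: mem_box inner_diff_left inner_add_left algebra_simps)
  qed
  ultimately have "((\<lambda>x. f (x + c)) has_integral integral (cbox a b) f) UNIV"
    using has_integral_on_superset by blast
  then show ?thesis
    using integrable_compact_support(3)[OF \<open>continuous_on (cbox a b) f\<close> assms(2)]
    by (simp add: integral_unique)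
qed

text \<open>The integral of the translate \<open>f (x + t *\<^sub>R e)\<close> over the whole space
  does not depend on \<open>t\<close>; differentiating under the integral sign at
  \<open>t = 0\<close> gives zero. All integrations by parts below rest on this identity.\<close>

lemma integral_derivative_compact_support:
  fixes f :: "'a::euclidean_space \<Rightarrow> real"
  assumes f: "\<And>x. (f has_derivative f' x) (at x)"
    and cont: "continuous_on UNIV (\<lambda>x. f' x e)"
    and supp: "\<And>x. norm x > R \<Longrightarrow> f x = 0"
  shows "integral UNIV (\<lambda>x. f' x e) = 0"
proof -
  \<comment> \<open>For \<open>\<bar>t\<bar> \<le> 1\<close> all translates are supported in the one
    box \<open>?B\<close>, so the parameter integral runs over a fixed compact set.\<close>
  define S where "S = \<bar>R\<bar> + norm e"
  let ?B = "cbox (0 - S *\<^sub>R One) (0 + S *\<^sub>R One) :: 'a set"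
  have sub: "cball 0 S \<subseteq> ?B" by (rule cball_subset_centered_cbox)
  have contf: "continuous_on UNIV f"
    using f by (meson continuous_on_eq_continuous_within has_derivative_continuous continuous_at_imp_continuous_at_within)
  have out: "f (x + t *\<^sub>R e) = 0" if "x \<notin> ?B" "t \<in> {-1..1}" for x t
  proof (rule supp)
    have "norm x > S" using that(1) sub by (metis mem_cball_0 not_le subsetD)
    moreover have "norm (t *\<^sub>R e) \<le> norm e"
      using that(2) mult_right_mono[of "\<bar>t\<bar>" 1 "norm e"] by auto
    moreover have "norm x \<le> norm (x + t *\<^sub>R e) + norm (t *\<^sub>R e)"
      by (metis add_diff_cancel norm_triangle_ineq4)
    ultimately show "norm (x + t *\<^sub>R e) > R" unfolding S_def by linarith
  qed
  have const: "integral ?B (\<lambda>x. f (x + t *\<^sub>R e)) = integral UNIV f" if "t \<in> {-1..1}" for t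
  proof -
    have "integral UNIV (\<lambda>x. f (x + t *\<^sub>R e)) = integral UNIV f"
      by (rule integral_translation_compact_support[OF contf, of "- S *\<^sub>R One" "S *\<^sub>R One"])
         (use out[of _ 0] in simp)
    moreover have "integral UNIV (\<lambda>x. f (x + t *\<^sub>R e)) = integral ?B (\<lambda>x. f (x + t *\<^sub>R e))"
      by (rule integrable_compact_support(3))
         (use out that in \<open>auto intro!: continuous_on_compose2[OF contf] continuous_intros\<close>)
    ultimately show ?thesis by simp
  qed
  have der: "((\<lambda>t. f (x + t *\<^sub>R e)) has_vector_derivative f' (x + t *\<^sub>R e) e) (at t within {-1..1})" for x t
  proof -
    have "((\<lambda>t. f (x + t *\<^sub>R e)) has_derivative (\<lambda>s. f' (x + t *\<^sub>R e) (s *\<^sub>R e))) (at t within {-1..1})"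
      by (rule has_derivative_compose[of "\<lambda>t. x + t *\<^sub>R e", OF _ f]) (auto intro!: derivative_eq_intros)
    moreover have "linear (f' (x + t *\<^sub>R e))"
      using f has_derivative_linear by blast
    ultimately show ?thesis
      by (simp add: has_vector_derivative_def linear_scale)
  qed
  have "((\<lambda>t. integral ?B (\<lambda>x. f (x + t *\<^sub>R e))) has_vector_derivative
      integral ?B (\<lambda>x. f' (x + 0 *\<^sub>R e) e)) (at 0 within {-1..1})"
    by (rule leibniz_rule_vector_derivative[where fx = "\<lambda>t x. f' (x + t *\<^sub>R e) e"])
       (auto intro!: der integrable_continuous continuous_on_compose2[OF contf]
          continuous_on_compose2[OF cont] continuous_intros simp: split_beta)
  moreover have "((\<lambda>t. integral ?B (\<lambda>x. f (x + t *\<^sub>R e))) has_vector_derivative 0) (at 0 within {-1..1})"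
    using const by (intro has_vector_derivative_transform[OF _ _ has_vector_derivative_const[of "integral UNIV f"]]) auto
  ultimately have *: "integral ?B (\<lambda>x. f' (x + 0 *\<^sub>R e) e) = 0"
    by (rule vector_derivative_unique_within[rotated]) (simp add: trivial_limit_within islimpt_Icc)
  have "f' x e = 0" if "x \<notin> ?B" for x
  proof -
    have "open (- ?B)" by (intro open_Compl closed_cbox)
    moreover have "f y = 0" if "y \<in> - ?B" for y using out[of y 0] that by simp
    ultimately have "(f has_derivative (\<lambda>h. 0)) (at x)"
      using that by (intro has_derivative_transform_within_open[of "\<lambda>x. 0" "\<lambda>h. 0" x UNIV "- ?B" f]) auto
    then show ?thesis using f has_derivative_unique by metis
  qed
  then have "integral UNIV (\<lambda>x. f' x e) = integral ?B (\<lambda>x. f' x e)"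
    by (rule integrable_compact_support(3)[OF continuous_on_subset[OF cont subset_UNIV]])
  with * show ?thesis by simp
qed

text \<open>Both sides are the limit of the second difference quotient of \<open>f\<close> at \<open>x\<close>.\<close>

lemma symmetric_second_derivative:
  fixes f :: "'a::euclidean_space \<Rightarrow> real"
  assumes S: "open S" "x \<in> S"
    and f: "\<And>y. y \<in> S \<Longrightarrow> (f has_derivative (\<lambda>h. g y \<bullet> h)) (at y)"
    and g: "(g has_derivative H) (at x)"
  shows "H s \<bullet> r = H r \<bullet> s"
proof -
  interpret H: bounded_linear H using g has_derivative_bounded_linear by blast
  have main: "((\<lambda>t. (f (x + t *\<^sub>R s + t *\<^sub>R r) - f (x + t *\<^sub>R s) - f (x + t *\<^sub>R r) + f x) / t\<^sup>2)
      \<longlongrightarrow> H s \<bullet> r) (at_right 0)" for s r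
  proof (rule tendstoI)
    fix e :: real assume "e > 0"
    \<comment> \<open>\<open>K\<close> collects the two first-order remainders of \<open>g\<close>,
      the length of the increments and the factor \<open>norm r\<close> of the inner product, so
      that the final error \<open>\<eta> * K\<close> is \<open>e / 2\<close>.\<close>
    define K where "K = 2 * (norm s + norm r + 1) * (norm r + 1)"
    have "K > 0" unfolding K_def by (simp add: add_nonneg_pos)
    define \<eta> where "\<eta> = e / (2 * K)"
    have "\<eta> > 0" using \<open>e > 0\<close> \<open>K > 0\<close> by (simp add: \<eta>_def)
    obtain d1 where d1: "d1 > 0" "\<And>y. norm (y - x) < d1 \<Longrightarrow> norm (g y - g x - H (y - x)) \<le> \<eta> * norm (y - x)"
      using g \<open>\<eta> > 0\<close> unfolding has_derivative_at_alt by blast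
    obtain d2 where d2: "d2 > 0" "ball x d2 \<subseteq> S" using S openE by blast
    define d where "d = min d1 d2 / (norm s + norm r + 1)"
    have pos: "norm s + norm r + 1 > 0" by (simp add: add_nonneg_pos)
    have "d > 0" using d1 d2 pos by (simp add: d_def)
    have "dist ((f (x + t *\<^sub>R s + t *\<^sub>R r) - f (x + t *\<^sub>R s) - f (x + t *\<^sub>R r) + f x) / t\<^sup>2) (H s \<bullet> r) < e"
      if t: "0 < t" "t < d" for t
    proof -
      have small: "norm (a *\<^sub>R s + b *\<^sub>R r) \<le> t * (norm s + norm r + 1)" if "0 \<le> a" "a \<le> t" "0 \<le> b" "b \<le> t" for a b
      proof -
        have "norm (a *\<^sub>R s + b *\<^sub>R r) \<le> a * norm s + b * norm r"
          using that norm_triangle_ineq[of "a *\<^sub>R s" "b *\<^sub>R r"] by simp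
        also have "\<dots> \<le> t * norm s + t * norm r"
          using that by (intro add_mono mult_right_mono) auto
        finally show ?thesis using t by (simp add: algebra_simps)
      qed
      have tm: "t * (norm s + norm r + 1) < min d1 d2"
        using t pos by (simp add: d_def pos_less_divide_eq)
      have inS: "x + a *\<^sub>R s + b *\<^sub>R r \<in> S" if "0 \<le> a" "a \<le> t" "0 \<le> b" "b \<le> t" for a b
      proof -
        have "dist (x + (a *\<^sub>R s + b *\<^sub>R r)) x < d2"
          using small[OF that] tm unfolding dist_norm by simp
        then have "x + (a *\<^sub>R s + b *\<^sub>R r) \<in> ball x d2" unfolding mem_ball by (subst dist_commute)
        with d2(2) have "x + (a *\<^sub>R s + b *\<^sub>R r) \<in> S" by (rule subsetD)
        then show ?thesis by (simp only: add.assoc)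
      qed
      \<comment> \<open>The increment in direction \<open>s\<close>, viewed along direction
        \<open>r\<close>: the mean value theorem in \<open>u\<close> leaves a difference of two
        values of \<open>g\<close>, and differentiability of \<open>g\<close> at the single point
        \<open>x\<close> estimates it.\<close>
      define F where "F u = f (x + t *\<^sub>R s + u *\<^sub>R r) - f (x + 0 *\<^sub>R s + u *\<^sub>R r)" for u
      have dF: "(F has_real_derivative (g (x + t *\<^sub>R s + u *\<^sub>R r) - g (x + 0 *\<^sub>R s + u *\<^sub>R r)) \<bullet> r) (at u)"
        if "0 \<le> u" "u \<le> t" for u
      proof -
        have D: "((\<lambda>u. f (x + a *\<^sub>R s + u *\<^sub>R r)) has_derivative (\<lambda>h. g (x + a *\<^sub>R s + u *\<^sub>R r) \<bullet> (h *\<^sub>R r))) (at u)"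
          if "0 \<le> a" "a \<le> t" for a
          by (rule has_derivative_compose[of "\<lambda>u. x + a *\<^sub>R s + u *\<^sub>R r", OF _ f])
             (use inS that \<open>0 \<le> u\<close> \<open>u \<le> t\<close> in \<open>auto intro!: derivative_eq_intros\<close>)
        have "(F has_derivative (\<lambda>h. g (x + t *\<^sub>R s + u *\<^sub>R r) \<bullet> h *\<^sub>R r - g (x + 0 *\<^sub>R s + u *\<^sub>R r) \<bullet> h *\<^sub>R r)) (at u)"
          unfolding F_def by (rule has_derivative_diff[OF D D]) (use t in simp_all)
        moreover have "(\<lambda>h. g (x + t *\<^sub>R s + u *\<^sub>R r) \<bullet> h *\<^sub>R r - g (x + 0 *\<^sub>R s + u *\<^sub>R r) \<bullet> h *\<^sub>R r)
            = (*) ((g (x + t *\<^sub>R s + u *\<^sub>R r) - g (x + 0 *\<^sub>R s + u *\<^sub>R r)) \<bullet> r)"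
          by (rule ext, unfold inner_scaleR_right inner_diff_left)
             (rule trans[OF right_diff_distrib[symmetric] mult.commute])
        ultimately show ?thesis by (simp only: has_field_derivative_def)
      qed
      obtain u where u: "0 < u" "u < t"
        "F t - F 0 = (t - 0) * ((g (x + t *\<^sub>R s + u *\<^sub>R r) - g (x + 0 *\<^sub>R s + u *\<^sub>R r)) \<bullet> r)"
        using MVT2[OF t(1) dF] by blast
      let ?y = "x + t *\<^sub>R s + u *\<^sub>R r" and ?z = "x + 0 *\<^sub>R s + u *\<^sub>R r"
      have est: "norm (g (x + a *\<^sub>R s + u *\<^sub>R r) - g x - H (a *\<^sub>R s + u *\<^sub>R r)) \<le> \<eta> * (t * (norm s + norm r + 1))"
        if "0 \<le> a" "a \<le> t" for a
      proof -
        have n: "norm (a *\<^sub>R s + u *\<^sub>R r) \<le> t * (norm s + norm r + 1)" using small that u by simp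
        have "norm (g (x + (a *\<^sub>R s + u *\<^sub>R r)) - g x - H (x + (a *\<^sub>R s + u *\<^sub>R r) - x)) \<le> \<eta> * norm (x + (a *\<^sub>R s + u *\<^sub>R r) - x)"
          by (rule d1) (use n tm in auto)
        also have "\<dots> \<le> \<eta> * (t * (norm s + norm r + 1))"
          using n \<open>\<eta> > 0\<close> by simp
        finally show ?thesis by (simp add: add.assoc)
      qed
      have eq: "g ?y - g ?z - t *\<^sub>R H s = (g ?y - g x - H (t *\<^sub>R s + u *\<^sub>R r)) - (g ?z - g x - H (0 *\<^sub>R s + u *\<^sub>R r))"
        by (simp add: H.add H.scaleR)
      have "norm (g ?y - g ?z - t *\<^sub>R H s) \<le> \<eta> * (t * (norm s + norm r + 1)) + \<eta> * (t * (norm s + norm r + 1))"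
        unfolding eq using est[of t] est[of 0] t norm_triangle_ineq4 by (smt (verit))
      then have n: "norm (g ?y - g ?z - t *\<^sub>R H s) \<le> 2 * \<eta> * t * (norm s + norm r + 1)" by simp
      have "\<bar>(g ?y - g ?z) \<bullet> r - t * (H s \<bullet> r)\<bar> = \<bar>(g ?y - g ?z - t *\<^sub>R H s) \<bullet> r\<bar>"
        by (simp add: inner_diff_left)
      also have "\<dots> \<le> norm (g ?y - g ?z - t *\<^sub>R H s) * norm r" by (rule Cauchy_Schwarz_ineq2)
      also have "\<dots> \<le> (2 * \<eta> * t * (norm s + norm r + 1)) * norm r" using n by (rule mult_right_mono) simp
      also have "\<dots> \<le> (2 * \<eta> * t * (norm s + norm r + 1)) * (norm r + 1)"
        using \<open>\<eta> > 0\<close> t pos by (intro mult_left_mono) auto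
      also have "\<dots> = t * (\<eta> * K)" by (simp add: K_def)
      also have "\<eta> * K = e / 2" using \<open>K > 0\<close> by (simp add: \<eta>_def)
      finally have fin: "\<bar>(g ?y - g ?z) \<bullet> r - t * (H s \<bullet> r)\<bar> \<le> t * (e/2)" .
      have "f (x + t *\<^sub>R s + t *\<^sub>R r) - f (x + t *\<^sub>R s) - f (x + t *\<^sub>R r) + f x = F t - F 0"
        by (simp add: F_def)
      also have "\<dots> = t * ((g ?y - g ?z) \<bullet> r)" using u by simp
      finally have "(f (x + t *\<^sub>R s + t *\<^sub>R r) - f (x + t *\<^sub>R s) - f (x + t *\<^sub>R r) + f x) / t\<^sup>2 - H s \<bullet> r
          = ((g ?y - g ?z) \<bullet> r - t * (H s \<bullet> r)) / t"
        using t by (simp add: power2_eq_square field_simps)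
      also have "\<bar>\<dots>\<bar> \<le> e/2" using fin t by (simp add: abs_divide pos_divide_le_eq mult.commute)
      finally show ?thesis using \<open>e > 0\<close> by (simp add: dist_real_def)
    qed
    then show "\<forall>\<^sub>F t in at_right 0. dist ((f (x + t *\<^sub>R s + t *\<^sub>R r) - f (x + t *\<^sub>R s) - f (x + t *\<^sub>R r) + f x) / t\<^sup>2) (H s \<bullet> r) < e"
      unfolding eventually_at_right_field using \<open>d > 0\<close> by blast
  qed
  \<comment> \<open>The second difference is unchanged when \<open>s\<close> and \<open>r\<close>
    are exchanged, so \<open>main[of r s]\<close> concerns the same quotient.\<close>
  have c: "x + t *\<^sub>R r + t *\<^sub>R s = x + t *\<^sub>R s + t *\<^sub>R r" for t
    by (simp only: add.assoc add.commute[of "t *\<^sub>R r"])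
  have d: "A - C - B + D = A - B - C + (D::real)" for A B C D by linarith
  have "((\<lambda>t. (f (x + t *\<^sub>R s + t *\<^sub>R r) - f (x + t *\<^sub>R s) - f (x + t *\<^sub>R r) + f x) / t\<^sup>2)
      \<longlongrightarrow> H r \<bullet> s) (at_right 0)"
    using main[of r s] unfolding c d[of _ "f (x + _ *\<^sub>R s)" "f (x + _ *\<^sub>R r)"] .
  from tendsto_unique[OF trivial_limit_at_right_real main[of s r] this] show ?thesis .
qed

section \<open>Bounded Lipschitz maps\<close>

text \<open>Boundedness is required together with the Lipschitz estimate because this makes the
  class stable under bilinear products; the derivatives of the kernel and of the double phase field
  are then treated factor by factor.\<close>

definition bounded_lipschitz_on :: "'a::metric_space set \<Rightarrow> ('a \<Rightarrow> 'b::real_normed_vector) \<Rightarrow> bool" where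
  "bounded_lipschitz_on S f \<longleftrightarrow>
     (\<exists>C\<ge>0. (\<forall>x\<in>S. norm (f x) \<le> C) \<and> (\<forall>x\<in>S. \<forall>y\<in>S. norm (f x - f y) \<le> C * dist x y))"

lemma bounded_lipschitz_onI:
  assumes "\<And>x. x \<in> S \<Longrightarrow> norm (f x) \<le> B" "\<And>x y. x \<in> S \<Longrightarrow> y \<in> S \<Longrightarrow> norm (f x - f y) \<le> C * dist x y"
  shows "bounded_lipschitz_on S f"
  unfolding bounded_lipschitz_on_def
proof (intro exI[of _ "max \<bar>B\<bar> \<bar>C\<bar>"] conjI ballI)
  fix x y assume "x \<in> S" "y \<in> S"
  then have "norm (f x - f y) \<le> C * dist x y" using assms by simp
  also have "\<dots> \<le> max \<bar>B\<bar> \<bar>C\<bar> * dist x y" by (intro mult_right_mono) auto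
  finally show "norm (f x - f y) \<le> max \<bar>B\<bar> \<bar>C\<bar> * dist x y" .
qed (use assms(1) in force)+

lemma bounded_lipschitz_on_add:
  assumes "bounded_lipschitz_on S f" "bounded_lipschitz_on S g"
  shows "bounded_lipschitz_on S (\<lambda>x. f x + g x)"
proof -
  from assms obtain C D where
    C: "\<And>x. x \<in> S \<Longrightarrow> norm (f x) \<le> C" "\<And>x y. x \<in> S \<Longrightarrow> y \<in> S \<Longrightarrow> norm (f x - f y) \<le> C * dist x y"
    and D: "\<And>x. x \<in> S \<Longrightarrow> norm (g x) \<le> D" "\<And>x y. x \<in> S \<Longrightarrow> y \<in> S \<Longrightarrow> norm (g x - g y) \<le> D * dist x y"
    unfolding bounded_lipschitz_on_def by blast
  show ?thesis
  proof (rule bounded_lipschitz_onI)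
    fix x assume "x \<in> S"
    then show "norm (f x + g x) \<le> C + D" using C(1) D(1) by (meson add_mono norm_triangle_ineq order_trans)
  next
    fix x y assume "x \<in> S" "y \<in> S"
    then have "norm ((f x - f y) + (g x - g y)) \<le> C * dist x y + D * dist x y"
      using C(2) D(2) by (meson add_mono norm_triangle_ineq order_trans)
    then show "norm (f x + g x - (f y + g y)) \<le> (C + D) * dist x y"
      by (simp add: algebra_simps)
  qed
qed

lemma (in bounded_bilinear) bounded_lipschitz_on:
  assumes "bounded_lipschitz_on S f" "bounded_lipschitz_on S g"
  shows "bounded_lipschitz_on S (\<lambda>x. prod (f x) (g x))"
proof -
  from assms obtain C D where
    C: "C \<ge> 0" "\<And>x. x \<in> S \<Longrightarrow> norm (f x) \<le> C" "\<And>x y. x \<in> S \<Longrightarrow> y \<in> S \<Longrightarrow> norm (f x - f y) \<le> C * dist x y"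
    and D: "D \<ge> 0" "\<And>x. x \<in> S \<Longrightarrow> norm (g x) \<le> D" "\<And>x y. x \<in> S \<Longrightarrow> y \<in> S \<Longrightarrow> norm (g x - g y) \<le> D * dist x y"
    unfolding bounded_lipschitz_on_def by blast
  obtain K where K: "K \<ge> 0" "\<And>a b. norm (prod a b) \<le> norm a * norm b * K"
    using nonneg_bounded by blast
  show ?thesis
  proof (rule bounded_lipschitz_onI)
    fix x assume "x \<in> S"
    then have "norm (f x) * norm (g x) * K \<le> C * D * K"
      using C D K by (intro mult_right_mono mult_mono) auto
    then show "norm (prod (f x) (g x)) \<le> C * D * K" using K order_trans by blast
  next
    fix x y assume xy: "x \<in> S" "y \<in> S"
    have "prod (f x) (g x) - prod (f y) (g y) = prod (f x - f y) (g x) + prod (f y) (g x - g y)"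
      by (simp add: diff_left diff_right)
    also have "norm \<dots> \<le> norm (f x - f y) * norm (g x) * K + norm (f y) * norm (g x - g y) * K"
      using K by (meson add_mono norm_triangle_ineq order_trans)
    also have "\<dots> \<le> (C * dist x y) * D * K + C * (D * dist x y) * K"
      using C D K xy by (intro add_mono mult_right_mono mult_mono) auto
    also have "\<dots> = (2 * C * D * K) * dist x y" by simp
    finally show "norm (prod (f x) (g x) - prod (f y) (g y)) \<le> 2 * C * D * K * dist x y" .
  qed
qed

lemmas bounded_lipschitz_on_mult = bounded_bilinear.bounded_lipschitz_on[OF bounded_bilinear_mult]
lemmas bounded_lipschitz_on_scaleR = bounded_bilinear.bounded_lipschitz_on[OF bounded_bilinear_scaleR]
lemmas bounded_lipschitz_on_inner = bounded_bilinear.bounded_lipschitz_on[OF bounded_bilinear_inner]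

lemma bounded_lipschitz_on_const: "bounded_lipschitz_on S (\<lambda>x. c)"
  by (rule bounded_lipschitz_onI[of _ _ "norm c" 0]) auto

lemma bounded_lipschitz_on_linear:
  fixes T :: "'a::real_normed_vector \<Rightarrow> 'b::real_normed_vector"
  assumes "bounded_linear T" "bounded S"
  shows "bounded_lipschitz_on S T"
proof -
  obtain R where R: "\<And>x. x \<in> S \<Longrightarrow> norm x \<le> R" using \<open>bounded S\<close> bounded_iff by metis
  interpret bounded_linear T by fact
  obtain K where K: "K \<ge> 0" "\<And>x. norm (T x) \<le> norm x * K" using nonneg_bounded by blast
  show ?thesis
  proof (rule bounded_lipschitz_onI)
    show "norm (T x) \<le> R * K" if "x \<in> S" for x
      using K R[OF that] by (meson mult_right_mono order_trans)
    show "norm (T x - T y) \<le> K * dist x y" if "x \<in> S" "y \<in> S" for x y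
      using K(2)[of "x - y"] by (simp add: diff dist_norm mult.commute)
  qed
qed

lemma bounded_lipschitz_on_compose:
  fixes r :: "'b::real_normed_vector \<Rightarrow> 'c::real_normed_vector"
  assumes "bounded_lipschitz_on S g" and "\<And>s t. s \<in> g ` S \<Longrightarrow> t \<in> g ` S \<Longrightarrow> norm (r s - r t) \<le> K * norm (s - t)"
  shows "bounded_lipschitz_on S (\<lambda>x. r (g x))"
proof (cases "S = {}")
  case False
  then obtain z where z: "z \<in> S" by blast
  from assms(1) obtain C where
    C: "C \<ge> 0" "\<And>x. x \<in> S \<Longrightarrow> norm (g x) \<le> C" "\<And>x y. x \<in> S \<Longrightarrow> y \<in> S \<Longrightarrow> norm (g x - g y) \<le> C * dist x y"
    unfolding bounded_lipschitz_on_def by blast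
  have K: "norm (r (g x) - r (g y)) \<le> \<bar>K\<bar> * norm (g x - g y)" if "x \<in> S" "y \<in> S" for x y
  proof -
    have "norm (r (g x) - r (g y)) \<le> K * norm (g x - g y)" using assms(2) that by blast
    also have "\<dots> \<le> \<bar>K\<bar> * norm (g x - g y)" by (intro mult_right_mono) auto
    finally show ?thesis .
  qed
  show ?thesis
  proof (rule bounded_lipschitz_onI)
    fix x assume x: "x \<in> S"
    have "norm (r (g x)) \<le> norm (r (g z)) + norm (r (g x) - r (g z))"
      by (metis add.commute diff_add_cancel norm_triangle_ineq)
    also have "\<dots> \<le> norm (r (g z)) + \<bar>K\<bar> * norm (g x - g z)" using K x z by simp
    also have "norm (g x - g z) \<le> 2 * C"
      using C(2) x z norm_triangle_ineq4[of "g x" "g z"] by (smt (verit))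
    finally show "norm (r (g x)) \<le> norm (r (g z)) + \<bar>K\<bar> * (2 * C)"
      by (simp add: mult_left_mono)
  next
    fix x y assume xy: "x \<in> S" "y \<in> S"
    have "\<bar>K\<bar> * norm (g x - g y) \<le> \<bar>K\<bar> * (C * dist x y)" using C(3) xy by (intro mult_left_mono) auto
    then show "norm (r (g x) - r (g y)) \<le> \<bar>K\<bar> * C * dist x y" using K[OF xy] by simp
  qed
qed (simp add: bounded_lipschitz_on_def exI[of _ 0])

text \<open>Expanding \<open>f\<close> in the basis reduces a bound uniform over all directions to
  finitely many; the constant is the sum of those for the basis vectors.\<close>

lemma linear_family_bounded_lipschitz:
  fixes T :: "'c::metric_space \<Rightarrow> 'a::euclidean_space \<Rightarrow> 'b::real_normed_vector"
  assumes lin: "\<And>x. x \<in> S \<Longrightarrow> linear (T x)"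
    and bl: "\<And>b. b \<in> Basis \<Longrightarrow> bounded_lipschitz_on S (\<lambda>x. T x b)"
  obtains C where "C \<ge> 0" "\<And>x f. x \<in> S \<Longrightarrow> norm (T x f) \<le> C * norm f"
    "\<And>x y f. x \<in> S \<Longrightarrow> y \<in> S \<Longrightarrow> norm (T x f - T y f) \<le> C * dist x y * norm f"
proof -
  have "\<exists>C. \<forall>b\<in>Basis. C b \<ge> 0 \<and> (\<forall>x\<in>S. norm (T x b) \<le> C b) \<and>
      (\<forall>x\<in>S. \<forall>y\<in>S. norm (T x b - T y b) \<le> C b * dist x y)"
    using bl unfolding bounded_lipschitz_on_def by (intro bchoice ballI) blast
  then obtain C where C: "\<And>b. b \<in> Basis \<Longrightarrow> C b \<ge> 0"
    "\<And>b x. b \<in> Basis \<Longrightarrow> x \<in> S \<Longrightarrow> norm (T x b) \<le> C b"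
    "\<And>b x y. b \<in> Basis \<Longrightarrow> x \<in> S \<Longrightarrow> y \<in> S \<Longrightarrow> norm (T x b - T y b) \<le> C b * dist x y"
    by blast
  have rep: "T x f = (\<Sum>b\<in>Basis. (f \<bullet> b) *\<^sub>R T x b)" if "x \<in> S" for x f
  proof -
    have "T x f = T x (\<Sum>b\<in>Basis. (f \<bullet> b) *\<^sub>R b)" by (simp only: euclidean_representation)
    also have "\<dots> = (\<Sum>b\<in>Basis. (f \<bullet> b) *\<^sub>R T x b)"
      by (simp only: linear_sum[OF lin[OF that]] linear_scale[OF lin[OF that]])
    finally show ?thesis .
  qed
  have fb: "\<bar>f \<bullet> b\<bar> \<le> norm f" if "b \<in> Basis" for f b :: 'a using that by (rule Basis_le_norm)
  show thesis
  proof (rule that[of "\<Sum>b\<in>Basis. C b"])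
    show "(\<Sum>b\<in>Basis. C b) \<ge> 0" by (intro sum_nonneg C(1))
    fix x y f assume x: "x \<in> S"
    have "norm (T x f) \<le> (\<Sum>b\<in>Basis. norm f * C b)"
      unfolding rep[OF x, of f]
      by (intro sum_norm_le, unfold norm_scaleR) (intro mult_mono fb C x norm_ge_zero)
    then show "norm (T x f) \<le> (\<Sum>b\<in>Basis. C b) * norm f"
      by (simp add: sum_distrib_left mult.commute)
    assume y: "y \<in> S"
    have "T x f - T y f = (\<Sum>b\<in>Basis. (f \<bullet> b) *\<^sub>R (T x b - T y b))"
      unfolding rep[OF x, of f] rep[OF y, of f] by (simp add: sum_subtractf scaleR_diff_right)
    also have "norm \<dots> \<le> (\<Sum>b\<in>Basis. norm f * (C b * dist x y))"
      by (intro sum_norm_le, unfold norm_scaleR) (intro mult_mono fb C x y norm_ge_zero)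
    finally show "norm (T x f - T y f) \<le> (\<Sum>b\<in>Basis. C b) * dist x y * norm f"
      by (simp add: sum_distrib_left sum_distrib_right mult_ac)
  qed
qed

section \<open>Divergence identities against test functions\<close>

text \<open>C^2 test functions supported in the closed ball of radius \<open>r\<close>. The gradient
  \<open>g\<close> is carried explicitly so that the pair can be rescaled without recomputing
  derivatives.\<close>

definition test_pair :: "('a::euclidean_space \<Rightarrow> real) \<Rightarrow> ('a \<Rightarrow> 'a) \<Rightarrow> real \<Rightarrow> bool" where
  "test_pair \<psi> g r \<longleftrightarrow> (\<forall>x. (\<psi> has_derivative (\<lambda>h. g x \<bullet> h)) (at x)) \<and>
     (\<exists>H. (\<forall>x. (g has_derivative H x) (at x)) \<and> (\<forall>h. continuous_on UNIV (\<lambda>x. H x h))) \<and>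
     (\<forall>x. norm x > r \<longrightarrow> \<psi> x = 0)"

lemma test_pair_gradient_zero:
  assumes "test_pair \<psi> g r" "norm x > r"
  shows "g x = 0"
proof -
  have "open {x :: 'a. r < norm x}" by (intro open_Collect_less continuous_intros)
  then have "(\<psi> has_derivative (\<lambda>h. 0)) (at x)"
    using assms unfolding test_pair_def
    by (intro has_derivative_transform_within_open[of "\<lambda>x. 0" "\<lambda>h. 0" x UNIV "{x. norm x > r}" \<psi>]) auto
  then have "(\<lambda>h. g x \<bullet> h) = (\<lambda>h. 0)"
    using assms(1) has_derivative_unique unfolding test_pair_def by blast
  then have "g x \<bullet> g x = 0" by metis
  then show ?thesis by simp
qed

lemma test_pair_continuous:
  assumes "test_pair \<psi> g r"
  shows "continuous_on UNIV g" "continuous_on UNIV \<psi>"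
  using assms unfolding test_pair_def
  by (meson continuous_on_eq_continuous_within has_derivative_continuous continuous_at_imp_continuous_at_within)+

text \<open>Integrate the derivative of \<open>\<psi> x * (W x \<bullet> b)\<close> in direction
  \<open>b\<close> and sum over the basis. It serves the affine part of the blown-up field, whose
  divergence is a constant.\<close>

lemma integral_by_parts_divergence:
  fixes W :: "'a::euclidean_space \<Rightarrow> 'a"
  assumes tp: "test_pair \<psi> g r"
    and W: "\<And>x. (W has_derivative DW x) (at x)" and DW: "\<And>h. continuous_on UNIV (\<lambda>x. DW x h)"
  shows "integral UNIV (\<lambda>x. W x \<bullet> g x) = - integral UNIV (\<lambda>x. \<psi> x * (\<Sum>b\<in>Basis. DW x b \<bullet> b))"
proof -
  note cg = test_pair_continuous[OF tp]
  have cW: "continuous_on UNIV W"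
    using W by (meson continuous_on_eq_continuous_within has_derivative_continuous continuous_at_imp_continuous_at_within)
  have psi: "(\<psi> has_derivative (\<lambda>h. g x \<bullet> h)) (at x)" for x using tp by (simp add: test_pair_def)
  have psi0: "\<psi> x = 0" "g x = 0" if "norm x > r" for x
    using tp that test_pair_gradient_zero[OF tp that] by (auto simp: test_pair_def)
  let ?B = "cbox (0 - r *\<^sub>R One) (0 + r *\<^sub>R One) :: 'a set"
  have out: "norm x > r" if "x \<notin> ?B" for x
    using that cball_subset_centered_cbox[of 0 r] by (metis mem_cball_0 not_le subsetD)
  have int: "f integrable_on UNIV" if "continuous_on UNIV f" "\<And>x. norm x > r \<Longrightarrow> f x = 0" for f :: "'a \<Rightarrow> real"
    by (rule integrable_compact_support(2)[OF continuous_on_subset[OF that(1) subset_UNIV]])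
       (rule that(2)[OF out])
  have 1: "integral UNIV (\<lambda>x. \<psi> x * (DW x b \<bullet> b) + (g x \<bullet> b) * (W x \<bullet> b)) = 0" for b
    by (rule integral_derivative_compact_support[of "\<lambda>x. \<psi> x * (W x \<bullet> b)"
          "\<lambda>x h. \<psi> x * (DW x h \<bullet> b) + (g x \<bullet> h) * (W x \<bullet> b)" b r])
       (use psi0 in \<open>auto intro!: derivative_eq_intros psi W continuous_intros cg cW DW\<close>)
  have eq: "(\<Sum>b\<in>Basis. (g x \<bullet> b) * (W x \<bullet> b)) = W x \<bullet> g x" for x
    by (subst (3) euclidean_inner) (simp only: mult.commute)
  have "0 = (\<Sum>b\<in>Basis. integral UNIV (\<lambda>x. \<psi> x * (DW x b \<bullet> b) + (g x \<bullet> b) * (W x \<bullet> b)))"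
    using 1 by simp
  also have "\<dots> = integral UNIV (\<lambda>x. \<Sum>b\<in>Basis. \<psi> x * (DW x b \<bullet> b) + (g x \<bullet> b) * (W x \<bullet> b))"
    by (intro integral_sum[symmetric] int) (use psi0 in \<open>auto intro!: continuous_intros cg cW DW\<close>)
  also have "\<dots> = integral UNIV (\<lambda>x. \<psi> x * (\<Sum>b\<in>Basis. DW x b \<bullet> b) + W x \<bullet> g x)"
    by (intro arg_cong[where f="integral UNIV"] ext)
       (simp only: sum.distrib sum_distrib_left eq)
  also have "\<dots> = integral UNIV (\<lambda>x. \<psi> x * (\<Sum>b\<in>Basis. DW x b \<bullet> b)) + integral UNIV (\<lambda>x. W x \<bullet> g x)"
    by (intro integral_add int) (use psi0 in \<open>auto intro!: continuous_intros cg cW DW\<close>)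
  finally show ?thesis by linarith
qed

text \<open>Since \<open>Dg\<close> is symmetric, the integrands differ by \<open>\<partial>\<^sub>f (U \<bullet> g) - div ((f \<bullet> g) U)\<close>.\<close>

lemma integral_by_parts_directional:
  fixes U :: "'a::euclidean_space \<Rightarrow> 'a"
  assumes tp: "test_pair \<psi> g r"
    and U: "\<And>x. (U has_derivative DU x) (at x)" and DU: "\<And>h. continuous_on UNIV (\<lambda>x. DU x h)"
  shows "integral UNIV (\<lambda>x. DU x f \<bullet> g x) = integral UNIV (\<lambda>x. (\<Sum>b\<in>Basis. DU x b \<bullet> b) * (f \<bullet> g x))"
proof -
  obtain H where g: "\<And>x. (g has_derivative H x) (at x)" and H: "\<And>h. continuous_on UNIV (\<lambda>x. H x h)"
    using tp unfolding test_pair_def by blast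
  note cg = test_pair_continuous[OF tp]
  have cU: "continuous_on UNIV U"
    using U by (meson continuous_on_eq_continuous_within has_derivative_continuous continuous_at_imp_continuous_at_within)
  have psi: "(\<psi> has_derivative (\<lambda>h. g x \<bullet> h)) (at x)" for x using tp by (simp add: test_pair_def)
  have sym: "H x s \<bullet> t = H x t \<bullet> s" for x s t
    by (rule symmetric_second_derivative[OF open_UNIV UNIV_I psi g])
  have g0: "g x = 0" if "norm x > r" for x using test_pair_gradient_zero[OF tp that] .
  have "open {x :: 'a. r < norm x}" by (intro open_Collect_less continuous_intros)
  then have H0: "H x h = 0" if "norm x > r" for x h
  proof -
    have "(g has_derivative (\<lambda>h. 0)) (at x)"
      using g0 \<open>open _\<close> that
      by (intro has_derivative_transform_within_open[of "\<lambda>x. 0" "\<lambda>h. 0" x UNIV "{x. norm x > r}" g]) auto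
    then show ?thesis using has_derivative_unique[OF g] by metis
  qed
  let ?B = "cbox (0 - r *\<^sub>R One) (0 + r *\<^sub>R One) :: 'a set"
  have out: "norm x > r" if "x \<notin> ?B" for x
    using that cball_subset_centered_cbox[of 0 r] by (metis mem_cball_0 not_le subsetD)
  have int: "f integrable_on UNIV" if "continuous_on UNIV f" "\<And>x. norm x > r \<Longrightarrow> f x = 0" for f :: "'a \<Rightarrow> real"
    by (rule integrable_compact_support(2)[OF continuous_on_subset[OF that(1) subset_UNIV]])
       (rule that(2)[OF out])
  have 1: "integral UNIV (\<lambda>x. U x \<bullet> H x f + DU x f \<bullet> g x) = 0"
    by (rule integral_derivative_compact_support[of "\<lambda>x. U x \<bullet> g x" "\<lambda>x h. U x \<bullet> H x h + DU x h \<bullet> g x" f r])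
       (use g0 in \<open>auto intro!: derivative_eq_intros g U continuous_intros cg cU DU H\<close>)
  have 2: "integral UNIV (\<lambda>x. (f \<bullet> g x) * (DU x b \<bullet> b) + (f \<bullet> H x b) * (U x \<bullet> b)) = 0" for b
    by (rule integral_derivative_compact_support[of "\<lambda>x. (f \<bullet> g x) * (U x \<bullet> b)"
          "\<lambda>x h. (f \<bullet> g x) * (DU x h \<bullet> b) + (f \<bullet> H x h) * (U x \<bullet> b)" b r])
       (use g0 in \<open>auto intro!: derivative_eq_intros g U continuous_intros cg cU DU H\<close>)
  \<comment> \<open>Symmetry of the Hessian enters here: it produces the term that \<open>1\<close>
    and the sum of the identities \<open>2\<close> have in common.\<close>
  have eq: "(\<Sum>b\<in>Basis. (f \<bullet> H x b) * (U x \<bullet> b)) = U x \<bullet> H x f" for x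
  proof -
    have "f \<bullet> H x b = H x f \<bullet> b" for b using sym[of x b f] by (simp add: inner_commute)
    then show ?thesis by (subst (2) euclidean_inner) (simp only: mult.commute)
  qed
  have "0 = (\<Sum>b\<in>Basis. integral UNIV (\<lambda>x. (f \<bullet> g x) * (DU x b \<bullet> b) + (f \<bullet> H x b) * (U x \<bullet> b)))"
    using 2 by simp
  also have "\<dots> = integral UNIV (\<lambda>x. \<Sum>b\<in>Basis. (f \<bullet> g x) * (DU x b \<bullet> b) + (f \<bullet> H x b) * (U x \<bullet> b))"
    by (intro integral_sum[symmetric] int) (use g0 H0 in \<open>auto intro!: continuous_intros cg cU DU H\<close>)
  also have "\<dots> = integral UNIV (\<lambda>x. (\<Sum>b\<in>Basis. DU x b \<bullet> b) * (f \<bullet> g x) + U x \<bullet> H x f)"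
    by (intro arg_cong[where f="integral UNIV"] ext)
       (simp only: sum.distrib eq sum_distrib_right mult.commute[of "f \<bullet> g _"])
  also have "\<dots> = integral UNIV (\<lambda>x. (\<Sum>b\<in>Basis. DU x b \<bullet> b) * (f \<bullet> g x)) + integral UNIV (\<lambda>x. U x \<bullet> H x f)"
    by (intro integral_add int) (use g0 H0 in \<open>auto intro!: continuous_intros cg cU DU H\<close>)
  finally have "integral UNIV (\<lambda>x. (\<Sum>b\<in>Basis. DU x b \<bullet> b) * (f \<bullet> g x)) + integral UNIV (\<lambda>x. U x \<bullet> H x f) = 0" ..
  moreover have "integral UNIV (\<lambda>x. U x \<bullet> H x f) + integral UNIV (\<lambda>x. DU x f \<bullet> g x) = 0"
    using 1 by (subst integral_add[symmetric]) (use g0 H0 in \<open>auto intro!: int continuous_intros cg cU DU H\<close>)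
  ultimately show ?thesis by linarith
qed

section \<open>The truncated Newton kernel\<close>

text \<open>With \<open>n\<close> the dimension, \<open>rho n (|x|\<^sup>2) x\<close> is the gradient of the Newton potential outside the unit
  ball; inside, the profile is continued by its tangent line, which keeps it \<open>C\<^sup>1\<close> with Lipschitz
  derivative. Below \<open>N x \<bullet> x\<close> replaces \<open>|x|\<^sup>2\<close>, so that \<open>N\<inverse>\<close> is the coefficient matrix of the operator,
  and \<open>m\<close> is the inverse of the scale of the truncation. All scales agree away from the origin; the
  differences \<open>DZ\<close> of consecutive scales therefore have compact support and integral zero.\<close>

definition rho :: "real \<Rightarrow> real \<Rightarrow> real" where
  "rho n s = (if s \<le> 1 then 1 + n / 2 * (1 - s) else s powr (- n / 2))"

definition rho' :: "real \<Rightarrow> real \<Rightarrow> real" where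
  "rho' n s = - (n / 2) * (max s 1) powr (- n / 2 - 1)"

lemma has_real_derivative_rho: "(rho n has_real_derivative rho' n s) (at s)"
proof -
  have l: "((\<lambda>s. 1 + n / 2 * (1 - s)) has_real_derivative - (n / 2)) (at s)" for s
    by (auto intro!: derivative_eq_intros)
  have r: "((\<lambda>s. s powr (- n / 2)) has_real_derivative - (n / 2) * s powr (- n / 2 - 1)) (at s)" if "s \<ge> 1" for s
    using that by (auto intro!: derivative_eq_intros)
  consider "s < 1" | "s = 1" | "s > 1" by linarith
  then show ?thesis
  proof cases
    case 1
    then have "rho' n s = - (n / 2)" by (simp add: rho'_def)
    moreover have "(rho n has_real_derivative - (n / 2)) (at s)"
      by (rule has_field_derivative_transform_within_open[OF l open_lessThan[of 1]]) (use 1 in \<open>auto simp: rho_def\<close>)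
    ultimately show ?thesis by simp
  next
    case 3
    then have "rho' n s = - (n / 2) * s powr (- n / 2 - 1)" by (simp add: rho'_def)
    moreover have "(rho n has_real_derivative - (n / 2) * s powr (- n / 2 - 1)) (at s)"
      by (rule has_field_derivative_transform_within_open[OF r open_greaterThan[of 1]]) (use 3 in \<open>auto simp: rho_def\<close>)
    ultimately show ?thesis by simp
  next
    case 2
    \<comment> \<open>At \<open>s = 1\<close> both pieces have slope \<open>- (n / 2)\<close>; the
      two one-sided derivatives are glued.\<close>
    have "(rho n has_real_derivative - (n / 2)) (at 1 within {..1})"
      by (rule has_field_derivative_transform_within[OF has_field_derivative_at_within[OF l] zero_less_one])
         (auto simp: rho_def)
    moreover have "(rho n has_real_derivative - (n / 2)) (at 1 within {1..})"
      by (rule has_field_derivative_transform_within[OF has_field_derivative_at_within[OF r[of 1, simplified]] zero_less_one])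
         (auto simp: rho_def)
    ultimately have "(rho n has_real_derivative - (n / 2)) (at 1 within ({..1} \<union> {1..}))"
      unfolding has_field_derivative_iff by (subst at_within_union) (rule filterlim_sup)
    moreover have "{..1} \<union> {1..} = (UNIV :: real set)" by auto
    ultimately show ?thesis using 2 by (simp add: rho'_def)
  qed
qed

lemma rho_lipschitz:
  assumes "n \<ge> 0"
  shows "\<bar>rho n s - rho n t\<bar> \<le> n / 2 * \<bar>s - t\<bar>"
proof -
  have "norm (rho' n s) \<le> n / 2" for s
  proof -
    have "(max s 1) powr (- n / 2 - 1) \<le> 1 powr (- n / 2 - 1)"
      using assms by (intro powr_mono2') auto
    then show ?thesis using assms by (simp add: rho'_def abs_mult mult_left_le)
  qed
  then have "norm (rho n s - rho n t) \<le> n / 2 * norm (s - t)"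
    by (intro field_differentiable_bound[of UNIV "rho n" "rho' n"]) (auto intro: has_real_derivative_rho)
  then show ?thesis by simp
qed

text \<open>\<open>max s 1\<close> is 1-Lipschitz, and on \<open>{1..}\<close> the power has a
  bounded derivative since its singularity at 0 is out of reach.\<close>

lemma rho'_lipschitz:
  assumes "n \<ge> 0"
  shows "\<bar>rho' n s - rho' n t\<bar> \<le> n / 2 * (n / 2 + 1) * \<bar>s - t\<bar>"
proof -
  define e where "e = - n / 2 - 1"
  have "\<bar>x powr e - y powr e\<bar> \<le> (n / 2 + 1) * \<bar>x - y\<bar>" if "x \<ge> 1" "y \<ge> 1" for x y
  proof -
    have "norm (e * z powr (e - 1)) \<le> n / 2 + 1" if "z \<in> {1..}" for z
    proof -
      have "z powr (e - 1) \<le> 1 powr (e - 1)"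
        using assms that by (intro powr_mono2') (auto simp: e_def)
      then have "\<bar>e\<bar> * z powr (e - 1) \<le> \<bar>e\<bar> * 1" by (intro mult_left_mono) auto
      moreover have "\<bar>e\<bar> * 1 = n / 2 + 1" using assms by (simp add: e_def)
      moreover have "norm (e * z powr (e - 1)) = \<bar>e\<bar> * z powr (e - 1)" by (simp add: abs_mult)
      ultimately show ?thesis by linarith
    qed
    then have "norm (x powr e - y powr e) \<le> (n / 2 + 1) * norm (x - y)"
      by (intro field_differentiable_bound[of "{1..}" _ "\<lambda>z. e * z powr (e - 1)"])
         (use that in \<open>auto intro!: derivative_eq_intros\<close>)
    then show ?thesis by simp
  qed
  then have "\<bar>(max s 1) powr e - (max t 1) powr e\<bar> \<le> (n / 2 + 1) * \<bar>max s 1 - max t 1\<bar>"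
    by simp
  also have "\<dots> \<le> (n / 2 + 1) * \<bar>s - t\<bar>"
    using assms by (intro mult_left_mono) auto
  finally have "\<bar>(max s 1) powr e - (max t 1) powr e\<bar> \<le> (n / 2 + 1) * \<bar>s - t\<bar>" .
  then have "n / 2 * \<bar>(max s 1) powr e - (max t 1) powr e\<bar> \<le> n / 2 * ((n / 2 + 1) * \<bar>s - t\<bar>)"
    using assms by (intro mult_left_mono) auto
  moreover have "rho' n s - rho' n t = - (n / 2 * ((max s 1) powr e - (max t 1) powr e))"
    by (simp add: rho'_def e_def right_diff_distrib)
  ultimately show ?thesis using assms by (simp add: abs_mult mult.assoc)
qed

lemma continuous_on_rho [continuous_intros]:
  "continuous_on S f \<Longrightarrow> continuous_on S (\<lambda>x. rho n (f x))"
  using continuous_on_compose2[of UNIV "rho n" S f]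
  by (metis DERIV_isCont continuous_at_imp_continuous_on has_real_derivative_rho subset_UNIV)

lemma continuous_on_rho' [continuous_intros]:
  "continuous_on S f \<Longrightarrow> continuous_on S (\<lambda>x. rho' n (f x))"
  unfolding rho'_def by (intro continuous_intros) auto

locale kernel =
  fixes N :: "'a::euclidean_space \<Rightarrow> 'a" and l :: real
  assumes linN: "linear N" and symN: "N x \<bullet> y = N y \<bullet> x"
    and l_pos: "l > 0" and coercive: "l * (norm x)\<^sup>2 \<le> N x \<bullet> x"
begin

definition U :: "real \<Rightarrow> 'a \<Rightarrow> 'a" where
  "U m x = (m ^ DIM('a) * rho (real DIM('a)) (m\<^sup>2 * (N x \<bullet> x))) *\<^sub>R x"

definition DU :: "real \<Rightarrow> 'a \<Rightarrow> 'a \<Rightarrow> 'a" where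
  "DU m x f = m ^ DIM('a) *\<^sub>R (rho (real DIM('a)) (m\<^sup>2 * (N x \<bullet> x)) *\<^sub>R f +
     (2 * m\<^sup>2 * rho' (real DIM('a)) (m\<^sup>2 * (N x \<bullet> x)) * (N x \<bullet> f)) *\<^sub>R x)"

text \<open>The divergence of \<open>U m\<close>, by \<open>divergence_U\<close>. The untruncated
  field is divergence free away from the origin, so only the ellipsoid
  \<open>m\<^sup>2 * (N x \<bullet> x) \<le> 1\<close> contributes: a tent, acting as an approximate
  identity as \<open>m\<close> grows.\<close>

definition divU :: "real \<Rightarrow> 'a \<Rightarrow> real" where
  "divU m x = m ^ DIM('a) * (real DIM('a) * (real DIM('a) + 2) / 2) * max 0 (1 - m\<^sup>2 * (N x \<bullet> x))"

lemma bounded_linear_N: "bounded_linear N"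
  using linN linear_conv_bounded_linear by blast

lemma continuous_on_N [continuous_intros]: "continuous_on S f \<Longrightarrow> continuous_on S (\<lambda>x. N (f x))"
  by (rule bounded_linear.continuous_on[OF bounded_linear_N])

lemma has_derivative_U: "(U m has_derivative DU m x) (at x)"
proof -
  have N: "(N has_derivative N) (at x)"
    by (rule bounded_linear_imp_has_derivative[OF bounded_linear_N])
  have s: "((\<lambda>x. m\<^sup>2 * (N x \<bullet> x)) has_derivative (\<lambda>h. m\<^sup>2 * (2 * (N x \<bullet> h)))) (at x)"
    by (auto intro!: derivative_eq_intros N simp: symN[of _ x])
  have "((\<lambda>x. rho (real DIM('a)) (m\<^sup>2 * (N x \<bullet> x))) has_derivative
      (\<lambda>h. rho' (real DIM('a)) (m\<^sup>2 * (N x \<bullet> x)) * (m\<^sup>2 * (2 * (N x \<bullet> h))))) (at x)"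
    using has_derivative_compose[OF s, of "rho (real DIM('a))" "(*) (rho' (real DIM('a)) (m\<^sup>2 * (N x \<bullet> x)))"]
      has_real_derivative_rho[of "real DIM('a)" "m\<^sup>2 * (N x \<bullet> x)"]
    by (simp add: has_field_derivative_def)
  then show ?thesis
    unfolding U_def[abs_def]
    by (rule has_derivative_eq_rhs[OF has_derivative_scaleR[OF has_derivative_mult_right has_derivative_ident]])
       (auto simp: DU_def fun_eq_iff scaleR_add_right mult_ac)
qed

lemma continuous_on_DU [continuous_intros]:
  "continuous_on S f \<Longrightarrow> continuous_on S g \<Longrightarrow> continuous_on S (\<lambda>x. DU m (f x) (g x))"
  unfolding DU_def by (intro continuous_intros)

lemma continuous_on_U [continuous_intros]:
  "continuous_on S f \<Longrightarrow> continuous_on S (\<lambda>x. U m (f x))"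
  unfolding U_def by (intro continuous_intros)

lemma continuous_on_divU [continuous_intros]:
  "continuous_on S f \<Longrightarrow> continuous_on S (\<lambda>x. divU m (f x))"
  unfolding divU_def by (intro continuous_intros)

lemma linear_DU: "linear (DU m x)"
  by (rule linearI) (simp_all add: DU_def inner_add_right algebra_simps)

text \<open>\<open>N (U m x)\<close> is a function of \<open>N x \<bullet> x\<close> times
  \<open>N x\<close>, hence a gradient field, and its derivative is a Hessian. This is what makes
  the convolution below a gradient once \<open>N\<close> is applied.\<close>

lemma symmetric_N_DU: "N (DU m x f) \<bullet> h = N (DU m x h) \<bullet> f"
  unfolding DU_def linear_scale[OF linN] linear_add[OF linN] inner_scaleR_left inner_add_left
  using symN[of f h] by (simp add: mult_ac)

lemma divergence_U: "(\<Sum>b\<in>Basis. DU m x b \<bullet> b) = divU m x"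
proof -
  define s where "s = m\<^sup>2 * (N x \<bullet> x)"
  define n where "n = real DIM('a)"
  have "(\<Sum>b\<in>Basis. DU m x b \<bullet> b) = (\<Sum>b\<in>Basis. m ^ DIM('a) * (rho n s + 2 * m\<^sup>2 * rho' n s * ((N x \<bullet> b) * (x \<bullet> b))))"
    by (intro sum.cong) (auto simp: DU_def s_def n_def inner_add_left algebra_simps)
  also have "\<dots> = m ^ DIM('a) * (n * rho n s + 2 * m\<^sup>2 * rho' n s * (N x \<bullet> x))"
    unfolding euclidean_inner[of "N x" x] sum_distrib_left[symmetric] sum.distrib by (simp add: n_def)
  also have "\<dots> = m ^ DIM('a) * (n * rho n s + 2 * s * rho' n s)"
    by (simp add: s_def)
  \<comment> \<open>For \<open>s > 1\<close> the exponent \<open>- n / 2\<close> is exactly the one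
    for which the two terms cancel; for \<open>s \<le> 1\<close> the linear profile leaves the
    tent.\<close>
  also have "n * rho n s + 2 * s * rho' n s = n * (n + 2) / 2 * max 0 (1 - s)"
  proof (cases "s \<le> 1")
    case True then show ?thesis by (simp add: rho_def rho'_def max_def field_simps)
  next
    case False
    then have "s * s powr (- n / 2 - 1) = s powr (- n / 2)"
      by (simp add: powr_mult_base)
    with False show ?thesis by (simp add: rho_def rho'_def max_def field_simps)
  qed
  finally show ?thesis by (simp add: divU_def s_def n_def)
qed

section \<open>Locality and scaling of the kernels\<close>

definition supp_radius :: real where "supp_radius = 1 / sqrt l"

lemma supp_radius_pos: "supp_radius > 0"
  using l_pos by (simp add: supp_radius_def)

text \<open>Coercivity gives \<open>N x \<bullet> x \<ge> l * (norm x)\<^sup>2\<close>, and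
  \<open>supp_radius = 1 / sqrt l\<close>. Points outside the ball of radius
  \<open>supp_radius / m\<close> thus fall into the untruncated range of \<open>rho\<close>.\<close>

lemma far:
  assumes "m > 0" "norm x \<ge> supp_radius / m"
  shows "m\<^sup>2 * (N x \<bullet> x) \<ge> 1"
proof -
  have "1 \<le> norm x * (m * sqrt l)"
    using assms l_pos by (simp add: supp_radius_def field_simps)
  then have "1 \<le> (norm x * (m * sqrt l))\<^sup>2" by (simp add: one_le_power)
  also have "\<dots> = m\<^sup>2 * (l * (norm x)\<^sup>2)" using l_pos by (simp add: power_mult_distrib)
  also have "\<dots> \<le> m\<^sup>2 * (N x \<bullet> x)" using coercive by (intro mult_left_mono) auto
  finally show ?thesis .
qed

text \<open>The prefactor \<open>m ^ DIM('a)\<close> of \<open>U\<close> cancels the scale exactly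
  in the untruncated range, which is why \<open>U\<close> does not depend on \<open>m\<close>
  there.\<close>

lemma powr_homogeneous:
  assumes "m > 0" "s > 0"
  shows "m ^ DIM('a) * (m\<^sup>2 * s) powr (- real DIM('a) / 2) = s powr (- real DIM('a) / 2)"
    and "m ^ DIM('a) * (m\<^sup>2 * (m\<^sup>2 * s) powr (- real DIM('a) / 2 - 1)) = s powr (- real DIM('a) / 2 - 1)"
proof -
  have 1: "(m\<^sup>2) powr (- real DIM('a) / 2) = inverse (m ^ DIM('a))"
    using assms by (simp add: powr_powr powr_minus powr_realpow flip: powr_numeral)
  have 2: "(m\<^sup>2) powr (- real DIM('a) / 2 - 1) = inverse (m ^ DIM('a)) / m\<^sup>2"
    using assms 1 by (simp add: powr_diff)
  show "m ^ DIM('a) * (m\<^sup>2 * s) powr (- real DIM('a) / 2) = s powr (- real DIM('a) / 2)"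
    using assms 1 by (simp add: powr_mult)
  show "m ^ DIM('a) * (m\<^sup>2 * (m\<^sup>2 * s) powr (- real DIM('a) / 2 - 1)) = s powr (- real DIM('a) / 2 - 1)"
    using assms unfolding powr_mult 2 by simp
qed

lemma far_formula:
  assumes m: "m > 0" and s: "m\<^sup>2 * (N x \<bullet> x) \<ge> 1"
  shows "U m x = ((N x \<bullet> x) powr (- real DIM('a) / 2)) *\<^sub>R x"
    and "DU m x f = ((N x \<bullet> x) powr (- real DIM('a) / 2)) *\<^sub>R f -
       (real DIM('a) * (N x \<bullet> x) powr (- real DIM('a) / 2 - 1) * (N x \<bullet> f)) *\<^sub>R x"
proof -
  let ?s = "N x \<bullet> x" and ?n = "real DIM('a)"
  have pos: "?s > 0" using m s by (smt (verit) mult_nonneg_nonpos zero_le_power2)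
  have r: "rho ?n (m\<^sup>2 * ?s) = (m\<^sup>2 * ?s) powr (- ?n / 2)"
    using s by (auto simp: rho_def)
  have r': "rho' ?n (m\<^sup>2 * ?s) = - (?n / 2) * (m\<^sup>2 * ?s) powr (- ?n / 2 - 1)"
    using s by (simp add: rho'_def)
  note h = powr_homogeneous[OF m pos]
  show "U m x = (?s powr (- ?n / 2)) *\<^sub>R x"
    unfolding U_def r h ..
  have "DU m x f = (m ^ DIM('a) * (m\<^sup>2 * ?s) powr (- ?n / 2)) *\<^sub>R f +
      (m ^ DIM('a) * (m\<^sup>2 * (m\<^sup>2 * ?s) powr (- ?n / 2 - 1)) * (- ?n * (N x \<bullet> f))) *\<^sub>R x"
    unfolding DU_def r r' by (simp add: scaleR_add_right scaleR_diff_right mult_ac)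
  then show "DU m x f = (?s powr (- ?n / 2)) *\<^sub>R f -
      (?n * ?s powr (- ?n / 2 - 1) * (N x \<bullet> f)) *\<^sub>R x"
    unfolding h by (simp add: mult_ac)
qed

lemma U_stable:
  assumes m: "m > 0" and x: "norm x \<ge> supp_radius / m"
  shows "U (4 * m) x = U m x" "DU (4 * m) x f = DU m x f"
proof -
  have s: "m\<^sup>2 * (N x \<bullet> x) \<ge> 1" by (rule far[OF m x])
  then have "(4 * m)\<^sup>2 * (N x \<bullet> x) \<ge> 1" by (simp add: power_mult_distrib)
  from far_formula[OF _ this] far_formula[OF m s] m
  show "U (4 * m) x = U m x" "DU (4 * m) x f = DU m x f" by simp_all
qed

text \<open>The scaling of a Calderon-Zygmund kernel, homogeneous of degree minus the dimension; it
  reduces estimates at all scales to \<open>m = 1\<close>.\<close>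

lemma DU_scale: "DU m x f = m ^ DIM('a) *\<^sub>R DU 1 (m *\<^sub>R x) f"
  by (simp add: DU_def linear_scale[OF linN] power2_eq_square mult_ac)

lemma DU_bounds:
  obtains C where "C \<ge> 0" "\<And>x f. norm x \<le> R \<Longrightarrow> norm (DU m x f) \<le> C * norm f"
    "\<And>x y f. norm x \<le> R \<Longrightarrow> norm y \<le> R \<Longrightarrow> norm (DU m x f - DU m y f) \<le> C * dist x y * norm f"
proof -
  let ?S = "cball 0 R :: 'a set" and ?n = "real DIM('a)"
  have blN: "bounded_lipschitz_on ?S N"
    by (rule bounded_lipschitz_on_linear[OF bounded_linear_N bounded_cball])
  have blid: "bounded_lipschitz_on ?S (\<lambda>x. x)"
    by (rule bounded_lipschitz_on_linear[OF bounded_linear_ident bounded_cball])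
  have bls: "bounded_lipschitz_on ?S (\<lambda>x. m\<^sup>2 * (N x \<bullet> x))"
    by (intro bounded_lipschitz_on_mult bounded_lipschitz_on_const bounded_lipschitz_on_inner blN blid)
  have blr: "bounded_lipschitz_on ?S (\<lambda>x. rho ?n (m\<^sup>2 * (N x \<bullet> x)))"
    by (rule bounded_lipschitz_on_compose[OF bls]) (unfold real_norm_def, rule rho_lipschitz, simp)
  have blr': "bounded_lipschitz_on ?S (\<lambda>x. rho' ?n (m\<^sup>2 * (N x \<bullet> x)))"
    by (rule bounded_lipschitz_on_compose[OF bls]) (unfold real_norm_def, rule rho'_lipschitz, simp)
  have "bounded_lipschitz_on ?S (\<lambda>x. DU m x b)" for b
    unfolding DU_def
    by (intro bounded_lipschitz_on_add bounded_lipschitz_on_scaleR bounded_lipschitz_on_mult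
        bounded_lipschitz_on_inner bounded_lipschitz_on_const blr blr' blN blid)
  from linear_family_bounded_lipschitz[where T = "DU m" and S = ?S, OF linear_DU this]
  show thesis using that by (metis mem_cball_0)
qed

definition DZ :: "real \<Rightarrow> 'a \<Rightarrow> 'a \<Rightarrow> 'a" where
  "DZ m x f = DU (4 * m) x f - DU m x f"

lemma DZ_zero: "m > 0 \<Longrightarrow> norm x \<ge> supp_radius / m \<Longrightarrow> DZ m x f = 0"
  using U_stable by (simp add: DZ_def)

lemma DZ_scale: "DZ m x f = m ^ DIM('a) *\<^sub>R DZ 1 (m *\<^sub>R x) f"
  unfolding DZ_def DU_scale[of "4 * m"] DU_scale[of m] DU_scale[of "4 * 1"]
  by (simp add: scaleR_diff_right power_mult_distrib mult_ac)

lemma linear_DZ: "linear (DZ m x)"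
  unfolding DZ_def[abs_def] by (intro linear_compose_sub linear_DU)

lemma continuous_on_DZ [continuous_intros]:
  "continuous_on S f \<Longrightarrow> continuous_on S g \<Longrightarrow> continuous_on S (\<lambda>x. DZ m (f x) (g x))"
  unfolding DZ_def by (intro continuous_intros)

text \<open>By \<open>DZ_scale\<close> it is enough to treat \<open>m = 1\<close>. On the ball of
  radius \<open>2 * supp_radius\<close> the bounds come from \<open>DU_bounds\<close>. A pair with
  one point in the support and the other outside this ball is at distance at least
  \<open>supp_radius\<close>, where the sup bound already acts as a Lipschitz bound.\<close>

lemma DZ_bounds:
  obtains C where "C > 0" "\<And>m x f. m > 0 \<Longrightarrow> norm (DZ m x f) \<le> C * m ^ DIM('a) * norm f"
    "\<And>m x y f. m > 0 \<Longrightarrow> norm (DZ m x f - DZ m y f) \<le> C * m ^ DIM('a) * (m * dist x y) * norm f"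
proof -
  let ?R = "2 * supp_radius"
  note sp = supp_radius_pos
  obtain C1 where C1: "C1 \<ge> 0" "\<And>x f. norm x \<le> ?R \<Longrightarrow> norm (DU 1 x f) \<le> C1 * norm f"
    "\<And>x y f. norm x \<le> ?R \<Longrightarrow> norm y \<le> ?R \<Longrightarrow> norm (DU 1 x f - DU 1 y f) \<le> C1 * dist x y * norm f"
    using DU_bounds by metis
  obtain C4 where C4: "C4 \<ge> 0" "\<And>x f. norm x \<le> ?R \<Longrightarrow> norm (DU 4 x f) \<le> C4 * norm f"
    "\<And>x y f. norm x \<le> ?R \<Longrightarrow> norm y \<le> ?R \<Longrightarrow> norm (DU 4 x f - DU 4 y f) \<le> C4 * dist x y * norm f"
    using DU_bounds by metis
  define C where "C = C1 + C4"
  have C0: "C \<ge> 0" using C1 C4 by (simp add: C_def)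
  have zero: "DZ 1 x f = 0" if "norm x \<ge> supp_radius" for x f using DZ_zero[of 1 x] that by simp
  have b: "norm (DZ 1 x f) \<le> C * norm f" for x f
  proof (cases "norm x \<ge> supp_radius")
    case False
    then have "norm (DU 4 x f - DU 1 x f) \<le> C4 * norm f + C1 * norm f"
      using sp by (intro order_trans[OF norm_triangle_ineq4] add_mono C4 C1) auto
    then show ?thesis by (simp add: DZ_def C_def algebra_simps)
  qed (simp add: zero C0)
  have lip1: "norm (DZ 1 x f - DZ 1 y f) \<le> C * dist x y * norm f" if "norm x \<le> ?R" "norm y \<le> ?R" for x y f
  proof -
    have "DZ 1 x f - DZ 1 y f = (DU 4 x f - DU 4 y f) - (DU 1 x f - DU 1 y f)" by (simp add: DZ_def)
    also have "norm \<dots> \<le> C4 * dist x y * norm f + C1 * dist x y * norm f"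
      using that by (intro order_trans[OF norm_triangle_ineq4] add_mono C4 C1) auto
    finally show ?thesis by (simp add: C_def algebra_simps)
  qed
  define K where "K = C + C / supp_radius + 1"
  have K: "K > 0" "C \<le> K" "C / supp_radius \<le> K" using C0 sp by (auto simp: K_def add_nonneg_pos)
  have far: "norm (DZ 1 x f - DZ 1 y f) \<le> K * dist x y * norm f"
    if "norm x < supp_radius" "norm y > ?R" for x y f
  proof -
    have "supp_radius \<le> dist x y"
      using that norm_triangle_ineq2[of y x] by (simp add: dist_norm norm_minus_commute)
    then have "C * norm f \<le> C / supp_radius * dist x y * norm f"
      using C0 sp by (intro mult_right_mono) (auto simp: field_simps mult_left_mono)
    also have "\<dots> \<le> K * dist x y * norm f"
      using K by (intro mult_right_mono) auto
    finally show ?thesis using b[of x f] zero[of y f] that sp by simp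
  qed
  have lip: "norm (DZ 1 x f - DZ 1 y f) \<le> K * dist x y * norm f" for x y f
  proof -
    consider "norm x \<le> ?R" "norm y \<le> ?R" | "norm x < supp_radius" "norm y > ?R"
      | "norm y < supp_radius" "norm x > ?R" | "norm x \<ge> supp_radius" "norm y \<ge> supp_radius"
      by linarith
    then show ?thesis
    proof cases
      case 1
      have "C * dist x y * norm f \<le> K * dist x y * norm f" using K by (intro mult_right_mono) auto
      with lip1[OF 1] show ?thesis by (rule order_trans)
    next
      case 2 then show ?thesis by (rule far)
    next
      case 3 then show ?thesis using far[OF 3, of f] by (simp add: dist_commute norm_minus_commute)
    next
      case 4 then show ?thesis using K by (simp add: zero)
    qed
  qed
  show thesis
  proof (rule that[OF K(1)])
    fix m :: real and x y f :: 'a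
    assume m: "m > 0"
    have "C * norm f \<le> K * norm f" using K by (intro mult_right_mono) auto
    then have "norm (DZ 1 (m *\<^sub>R x) f) \<le> K * norm f" using b order_trans by blast
    then have "m ^ DIM('a) * norm (DZ 1 (m *\<^sub>R x) f) \<le> m ^ DIM('a) * (K * norm f)"
      using m by (intro mult_left_mono) auto
    then show "norm (DZ m x f) \<le> K * m ^ DIM('a) * norm f"
      unfolding DZ_scale[of m] using m by (simp add: mult_ac)
    have "dist (m *\<^sub>R x) (m *\<^sub>R y) = m * dist x y" using m by (simp add: dist_norm flip: scaleR_diff_right)
    then have "norm (DZ 1 (m *\<^sub>R x) f - DZ 1 (m *\<^sub>R y) f) \<le> K * (m * dist x y) * norm f"
      using lip[of "m *\<^sub>R x" f "m *\<^sub>R y"] by simp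
    then have "m ^ DIM('a) * norm (DZ 1 (m *\<^sub>R x) f - DZ 1 (m *\<^sub>R y) f) \<le> m ^ DIM('a) * (K * (m * dist x y) * norm f)"
      using m by (intro mult_left_mono) auto
    then show "norm (DZ m x f - DZ m y f) \<le> K * m ^ DIM('a) * (m * dist x y) * norm f"
      unfolding DZ_scale[of m] scaleR_diff_right[symmetric] using m by (simp add: mult_ac)
  qed
qed

end

section \<open>Hoelder estimates for the constant-coefficient problem\<close>

lemma outside_centered_cbox:
  fixes x :: "'a::euclidean_space"
  assumes "y \<notin> cbox (x - r *\<^sub>R One) (x + r *\<^sub>R One)"
  shows "dist x y > r"
proof -
  have "y \<notin> cball x r" using assms cball_subset_centered_cbox[of x r] by blast
  then show ?thesis by simp
qed

lemma norm_integral_supported_in_ball: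
  fixes f :: "'a::euclidean_space \<Rightarrow> 'b::banach"
  assumes cont: "continuous_on UNIV f" and supp: "\<And>y. dist x y > r \<Longrightarrow> f y = 0"
    and B: "0 \<le> B" "\<And>y. norm (f y) \<le> B" and r: "0 \<le> r"
  shows "norm (integral UNIV f) \<le> B * (2 * r) ^ DIM('a)"
proof -
  let ?B = "cbox (x - r *\<^sub>R One) (x + r *\<^sub>R One)"
  have out: "f y = 0" if "y \<notin> ?B" for y
    by (rule supp[OF outside_centered_cbox[OF that]])
  have i: "integral UNIV f = integral ?B f"
    by (rule integrable_compact_support(3)[OF continuous_on_subset[OF cont subset_UNIV]]) (rule out)
  have "(f has_integral integral ?B f) ?B"
    by (intro integrable_integral integrable_continuous continuous_on_subset[OF cont]) auto
  then have "norm (integral ?B f) \<le> B * Henstock_Kurzweil_Integration.content ?B"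
    using B by (intro has_integral_bound) auto
  then have "norm (integral UNIV f) \<le> B * Henstock_Kurzweil_Integration.content ?B"
    using i by (simp only:)
  then show ?thesis unfolding content_centered_cbox[OF r] .
qed

lemma geometric_tail:
  fixes a :: "nat \<Rightarrow> 'b::banach"
  assumes "\<And>j. norm (a j) \<le> B / 2 ^ j"
  shows "summable a" "norm (suminf a - (\<Sum>j<J. a j)) \<le> 2 * B / 2 ^ J"
proof -
  have sg: "(\<lambda>j. B / 2 ^ (j + J)) sums (2 * B / 2 ^ J)" for J
  proof -
    have "(\<lambda>j. B / 2 ^ J * (1 / 2) ^ j) sums (B / 2 ^ J * (1 / (1 - 1 / 2)))"
      by (intro sums_mult geometric_sums) simp
    moreover have "B / 2 ^ J * (1 / 2) ^ j = B / 2 ^ (j + J)" for j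
      by (simp add: power_add power_one_over field_simps)
    moreover have "B / 2 ^ J * (1 / (1 - 1 / 2)) = 2 * B / 2 ^ J" by simp
    ultimately show ?thesis by (simp only:)
  qed
  have sn: "summable (\<lambda>j. norm (a j))"
    by (rule summable_comparison_test'[OF sums_summable[OF sg[of 0]], of 0]) (use assms in simp)
  then show sa: "summable a" by (rule summable_norm_cancel)
  have s: "summable (\<lambda>j. norm (a (j + J)))" by (rule summable_ignore_initial_segment[OF sn])
  have "suminf a - (\<Sum>j<J. a j) = (\<Sum>j. a (j + J))"
    unfolding suminf_split_initial_segment[OF sa, of J] by simp
  also have "norm \<dots> \<le> (\<Sum>j. norm (a (j + J)))" by (rule summable_norm[OF s])
  also have "\<dots> \<le> (\<Sum>j. B / 2 ^ (j + J))"
    by (rule suminf_le[OF _ s sums_summable[OF sg]]) (rule assms)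
  also have "\<dots> = 2 * B / 2 ^ J" by (rule sums_unique[OF sg, symmetric])
  finally show "norm (suminf a - (\<Sum>j<J. a j)) \<le> 2 * B / 2 ^ J" .
qed

text \<open>Splitting the series where \<open>2^j \<cdot> sqrt d\<close> passes \<open>1\<close> balances the two bounds.\<close>

lemma dyadic_series_bound:
  fixes a :: "nat \<Rightarrow> 'b::banach"
  assumes K: "K \<ge> 0" and d: "d \<ge> 0"
    and 1: "\<And>j. norm (a j) \<le> 2 * K / 2 ^ j" and 2: "\<And>j. norm (a j) \<le> K * 2 ^ j * d"
  shows "summable a" "norm (suminf a) \<le> 6 * K * sqrt d"
proof -
  show sa: "summable a" by (rule geometric_tail(1)[OF 1])
  have tail: "norm (\<Sum>j. a (j + J)) \<le> 4 * K / 2 ^ J" for J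
    using geometric_tail(2)[OF 1, of J] suminf_split_initial_segment[OF sa, of J] by simp
  show "norm (suminf a) \<le> 6 * K * sqrt d"
  \<comment> \<open>For \<open>d = 0\<close> the second bound kills every term, and for
    \<open>d \<ge> 1\<close> the first bound suffices alone; the splitting concerns
    \<open>0 < d < 1\<close>.\<close>
  proof (cases "d = 0 \<or> d \<ge> 1")
    case True
    then show ?thesis
    proof
      assume "d = 0"
      then have "a = (\<lambda>j. 0)" using 2 by auto
      with \<open>d = 0\<close> show ?thesis by simp
    next
      assume "d \<ge> 1"
      then have "4 * K \<le> 6 * K * sqrt d" using K mult_mono[of "4 * K" "6 * K" 1 "sqrt d"] by simp
      with tail[of 0] show ?thesis by simp
    qed
  next
    case False
    then have d01: "0 < sqrt d" "sqrt d < 1" using d by auto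
    obtain n where "inverse (sqrt d) < 2 ^ n" using real_arch_pow[of 2 "inverse (sqrt d)"] by auto
    then have ex: "1 \<le> 2 ^ n * sqrt d" using d01 by (simp add: field_simps)
    \<comment> \<open>The first index past the balance point: \<open>J\<close> itself controls the
      tail by \<open>4 * K * sqrt d\<close>, its predecessor \<open>I\<close> the head by
      \<open>2 * K * sqrt d\<close>.\<close>
    define J where "J = (LEAST n. 1 \<le> 2 ^ n * sqrt d)"
    have J: "1 \<le> 2 ^ J * sqrt d" unfolding J_def by (rule LeastI[of _ n]) (rule ex)
    have "J \<noteq> 0"
    proof
      assume "J = 0" with J d01 show False by simp
    qed
    then obtain I where I: "J = Suc I" using not0_implies_Suc by blast
    have "\<not> 1 \<le> 2 ^ I * sqrt d" using not_less_Least[of I "\<lambda>n. 1 \<le> 2 ^ n * sqrt d"] I J_def by simp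
    then have I2: "2 ^ I * sqrt d \<le> 1" by simp
    have "norm (\<Sum>j<J. a j) \<le> (\<Sum>j<J. K * 2 ^ j * d)"
      by (rule sum_norm_le) (use 2 in simp)
    also have "\<dots> = K * d * (\<Sum>j<J. 2 ^ j)" by (simp add: sum_distrib_left mult_ac)
    also have "(\<Sum>j<J. 2 ^ j) = (2 ^ J - 1 :: real)" using geometric_sum[of "2::real" J] by simp
    also have "K * d * (2 ^ J - 1) \<le> K * d * 2 ^ J" using K d by (intro mult_left_mono) auto
    also have "\<dots> = K * sqrt d * 2 * (2 ^ I * sqrt d)"
      using d by (simp add: I mult_ac)
    also have "\<dots> \<le> K * sqrt d * 2 * 1" using I2 K d by (intro mult_left_mono) auto
    finally have head: "norm (\<Sum>j<J. a j) \<le> 2 * K * sqrt d" by simp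
    have "4 * K / 2 ^ J \<le> 4 * K * sqrt d"
      using J K mult_left_mono[of 1 "2 ^ J * sqrt d" "4 * K"] by (simp add: field_simps)
    then have "norm (\<Sum>j. a (j + J)) \<le> 4 * K * sqrt d" using tail order_trans by blast
    moreover have "norm (suminf a) \<le> norm (\<Sum>j. a (j + J)) + norm (\<Sum>j<J. a j)"
      unfolding suminf_split_initial_segment[OF sa, of J] by (rule norm_triangle_ineq)
    ultimately show ?thesis using head by linarith
  qed
qed

section \<open>Hoelder densities on the unit ball\<close>

lemma dist_le_sqrt_unit_ball:
  fixes x y :: "'a::euclidean_space"
  assumes "norm x \<le> 1" "norm y \<le> 1"
  shows "dist x y \<le> 2 * sqrt (dist x y)"
proof -
  have "dist x y \<le> 2" using assms norm_triangle_ineq4[of x y] by (simp add: dist_norm)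
  then have "sqrt (dist x y) \<le> sqrt (2\<^sup>2)" by (intro real_sqrt_le_mono) simp
  then have "sqrt (dist x y) \<le> 2" by simp
  then have "sqrt (dist x y) * sqrt (dist x y) \<le> 2 * sqrt (dist x y)" by (intro mult_right_mono) auto
  then show ?thesis by simp
qed

text \<open>One number \<open>M\<close> bounds both the sup norm and the seminorm of exponent 1/2.
  The Hoelder condition is global, so a density has to vanish on the unit sphere; this is the reason
  for the cutoff in the contraction argument.\<close>

definition holder_density :: "('a::euclidean_space \<Rightarrow> 'b::euclidean_space) \<Rightarrow> real \<Rightarrow> bool" where
  "holder_density F M \<longleftrightarrow> 0 \<le> M \<and> (\<forall>x. norm x > 1 \<longrightarrow> F x = 0) \<and> (\<forall>x. norm (F x) \<le> M) \<and>
     (\<forall>x y. norm (F x - F y) \<le> M * sqrt (dist x y))"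

lemma holder_density_continuous:
  assumes "holder_density F M"
  shows "continuous_on S F"
proof -
  have "isCont F x" for x
  proof -
    have "((\<lambda>y. M * sqrt (dist y x)) \<longlongrightarrow> M * sqrt (dist x x)) (at x)" by (intro tendsto_intros)
    then have "((\<lambda>y. M * sqrt (dist y x)) \<longlongrightarrow> 0) (at x)" by simp
    then have "((\<lambda>y. F y - F x) \<longlongrightarrow> 0) (at x)"
      by (rule Lim_null_comparison[rotated]) (use assms in \<open>auto simp: holder_density_def\<close>)
    then show ?thesis unfolding isCont_def by (simp add: LIM_zero_iff)
  qed
  then show ?thesis by (simp add: continuous_at_imp_continuous_on)
qed

lemma holder_density_diff:
  assumes "holder_density F A" "holder_density G B"
  shows "holder_density (\<lambda>x. F x - G x) (A + B)"
proof -
  have "norm (F x - G x - (F y - G y)) \<le> (A + B) * sqrt (dist x y)" for x y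
  proof -
    have "F x - G x - (F y - G y) = (F x - F y) - (G x - G y)" by simp
    also have "norm \<dots> \<le> A * sqrt (dist x y) + B * sqrt (dist x y)"
      by (rule order_trans[OF norm_triangle_ineq4], rule add_mono) (use assms in \<open>auto simp: holder_density_def\<close>)
    finally show ?thesis by (simp add: algebra_simps)
  qed
  moreover have "norm (F x - G x) \<le> A + B" for x
    by (rule order_trans[OF norm_triangle_ineq4], rule add_mono) (use assms in \<open>auto simp: holder_density_def\<close>)
  ultimately show ?thesis using assms by (auto simp: holder_density_def)
qed

abbreviation unit_box :: "'a::euclidean_space set" where "unit_box \<equiv> cbox (- One) One"

lemma outside_unit_box:
  fixes x :: "'a::euclidean_space"
  assumes "x \<notin> unit_box"
  shows "norm x > 1"
proof -
  show ?thesis using outside_centered_cbox[of x 0 1] assms by simp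
qed

lemma content_unit_box: "Henstock_Kurzweil_Integration.content (unit_box :: 'a::euclidean_space set) = 2 ^ DIM('a)"
  using content_centered_cbox[of 1 "0::'a"] by simp

lemma integral_unit_box:
  fixes f :: "'a::euclidean_space \<Rightarrow> 'b::banach"
  assumes "continuous_on UNIV f" "\<And>x. norm x > 1 \<Longrightarrow> f x = 0"
  shows "integral UNIV f = integral unit_box f" "f integrable_on UNIV"
  by (rule integrable_compact_support[OF continuous_on_subset[OF assms(1) subset_UNIV]], erule assms(2)[OF outside_unit_box])+

section \<open>Convolution with the truncated kernels and its increments between scales\<close>

context kernel
begin

text \<open>Convolution of \<open>F\<close> with the matrix kernel \<open>DU m\<close>. A density
  vanishes outside the unit ball, so integrating over \<open>unit_box\<close> loses nothing, and the
  compact domain allows differentiation under the integral sign.\<close>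

definition V_approx :: "real \<Rightarrow> ('a \<Rightarrow> 'a) \<Rightarrow> 'a \<Rightarrow> 'a" where
  "V_approx m F x = integral unit_box (\<lambda>y. DU m (x - y) (F y))"

definition pot_approx :: "real \<Rightarrow> ('a \<Rightarrow> 'a) \<Rightarrow> 'a \<Rightarrow> real" where
  "pot_approx m F x = integral unit_box (\<lambda>y. N (U m (x - y)) \<bullet> F y)"

lemma DU_simps:
  "DU m x (f - g) = DU m x f - DU m x g" "DU m x 0 = 0"
  "DZ m x (f - g) = DZ m x f - DZ m x g" "DZ m x 0 = 0"
  using linear_diff[OF linear_DU] linear_0[OF linear_DU] linear_diff[OF linear_DZ] linear_0[OF linear_DZ] by blast+

text \<open>By the Leibniz rule the derivative in direction \<open>h\<close> has the integrand
  \<open>N (DU m (x - y) h) \<bullet> F y\<close>; \<open>symmetric_N_DU\<close> exchanges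
  \<open>h\<close> with \<open>F y\<close>.\<close>

lemma has_derivative_pot_approx:
  assumes F: "continuous_on UNIV F"
  shows "(pot_approx m F has_derivative (\<lambda>h. N (V_approx m F x) \<bullet> h)) (at x)"
proof -
  let ?g = "\<lambda>x y. N (DU m (x - y) (F y))"
  have F': "continuous_on S (\<lambda>z. F (f z))" if "continuous_on S f" for S :: "('a \<times> 'a) set" and f
    using continuous_on_compose2[OF F that] by auto
  have bl: "bounded_linear (blinfun_inner_right :: 'a \<Rightarrow> _)" by (rule bounded_linear_blinfun_inner_right)
  have d: "((\<lambda>x. N (U m (x - t)) \<bullet> F t) has_derivative blinfun_apply (blinfun_inner_right (?g x t))) (at x within UNIV)" for x t
  proof -
    have "((\<lambda>x. U m (x - t)) has_derivative DU m (x - t)) (at x)"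
      by (rule has_derivative_compose[of "\<lambda>x. x - t" "\<lambda>h. h" x UNIV "U m", OF _ has_derivative_U])
         (auto intro!: derivative_eq_intros)
    then have "((\<lambda>x. N (U m (x - t)) \<bullet> F t) has_derivative (\<lambda>h. N (DU m (x - t) h) \<bullet> F t)) (at x)"
      by (intro has_derivative_inner_left bounded_linear.has_derivative[OF bounded_linear_N])
    then show ?thesis by (simp add: symmetric_N_DU[of m "x - t" _ "F t"])
  qed
  have "(pot_approx m F has_derivative integral unit_box (\<lambda>y. blinfun_inner_right (?g x y))) (at x within UNIV)"
    unfolding pot_approx_def[abs_def]
    by (rule leibniz_rule[OF d])
       (auto intro!: integrable_continuous continuous_intros F' continuous_on_subset[OF F subset_UNIV]
          bounded_linear.continuous_on[OF bl] simp: split_beta)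
  moreover have "integral unit_box (\<lambda>y. blinfun_inner_right (?g x y)) = blinfun_inner_right (N (V_approx m F x))"
  proof -
    have "integral unit_box ((\<lambda>z. blinfun_inner_right (N z)) \<circ> (\<lambda>y. DU m (x - y) (F y))) =
        blinfun_inner_right (N (integral unit_box (\<lambda>y. DU m (x - y) (F y))))"
      by (rule integral_linear)
         (auto intro!: integrable_continuous continuous_intros continuous_on_subset[OF F subset_UNIV]
           bounded_linear_compose[OF bl bounded_linear_N])
    then show ?thesis by (simp add: o_def V_approx_def)
  qed
  ultimately show ?thesis by simp
qed

lemma continuous_on_V_approx:
  assumes F: "continuous_on UNIV F"
  shows "continuous_on UNIV (V_approx m F)"
proof -
  have F': "continuous_on S (\<lambda>z. F (f z))" if "continuous_on S f" for S :: "('a \<times> 'a) set" and f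
    using continuous_on_compose2[OF F that] by auto
  show ?thesis
    unfolding V_approx_def[abs_def]
    by (intro integral_continuous_on_param) (auto intro!: continuous_intros F' simp: split_beta)
qed

lemma V_approx_diff:
  assumes F: "continuous_on UNIV F" and G: "continuous_on UNIV G"
  shows "V_approx m (\<lambda>x. F x - G x) x = V_approx m F x - V_approx m G x"
  unfolding V_approx_def DU_simps
  by (intro integral_diff integrable_continuous continuous_intros continuous_on_subset[OF F] continuous_on_subset[OF G]) auto

text \<open>As a function of \<open>y\<close>, \<open>DZ m (x - y) f\<close> is the derivative along
  \<open>f\<close> of the compactly supported field \<open>U m (x - y) - U (4 * m) (x - y)\<close>.
  This cancellation is the source of all decay in the scale.\<close>

lemma integral_DZ_zero:
  assumes m: "m > 0"
  shows "integral UNIV (\<lambda>y. DZ m (x - y) f) = 0"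
proof (rule euclidean_eqI)
  fix b :: 'a assume b: "b \<in> Basis"
  let ?r = "norm x + supp_radius / m"
  have far: "norm (x - y) \<ge> supp_radius / m" if "norm y > ?r" for y
    using that norm_triangle_ineq3[of y x] by (simp add: norm_minus_commute)
  have dU: "((\<lambda>y. U k (x - y)) has_derivative (\<lambda>h. DU k (x - y) (- h))) (at y)" for k y
    by (rule has_derivative_compose[of "\<lambda>y. x - y" "\<lambda>h. - h" y UNIV "U k", OF _ has_derivative_U])
       (auto intro!: derivative_eq_intros)
  have "integral UNIV (\<lambda>y. (DU m (x - y) (- f) - DU (4 * m) (x - y) (- f)) \<bullet> b) = 0"
  proof (rule integral_derivative_compact_support[of "\<lambda>y. (U m (x - y) - U (4 * m) (x - y)) \<bullet> b"
          "\<lambda>y h. (DU m (x - y) (- h) - DU (4 * m) (x - y) (- h)) \<bullet> b" f ?r])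
    show "((\<lambda>y. (U m (x - y) - U (4 * m) (x - y)) \<bullet> b) has_derivative
        (\<lambda>h. (DU m (x - y) (- h) - DU (4 * m) (x - y) (- h)) \<bullet> b)) (at y)" for y
      by (intro has_derivative_inner_left has_derivative_diff dU)
    show "continuous_on UNIV (\<lambda>y. (DU m (x - y) (- f) - DU (4 * m) (x - y) (- f)) \<bullet> b)"
      by (intro continuous_intros)
    show "(U m (x - y) - U (4 * m) (x - y)) \<bullet> b = 0" if "?r < norm y" for y
      unfolding U_stable(1)[OF m far[OF that]] by simp
  qed
  moreover have "DU m z (- f) - DU (4 * m) z (- f) = DZ m z f" for z
    by (simp add: DZ_def linear_neg[OF linear_DU])
  ultimately have *: "integral UNIV (\<lambda>y. DZ m (x - y) f \<bullet> b) = 0" by (simp only:)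
  have z: "DZ m (x - y) f = 0" if "y \<notin> cbox (0 - ?r *\<^sub>R One) (0 + ?r *\<^sub>R One)" for y
  proof -
    have "norm y > ?r" using outside_centered_cbox[OF that] by simp
    then show ?thesis using DZ_zero[OF m far] by blast
  qed
  have "(\<lambda>y. DZ m (x - y) f) integrable_on UNIV"
    by (rule integrable_compact_support(2)[OF _ z]) (intro continuous_intros)
  from integral_component_eq[OF this, of b] * show "integral UNIV (\<lambda>y. DZ m (x - y) f) \<bullet> b = 0 \<bullet> b" by simp
qed

text \<open>The cancellation allows subtracting an arbitrary constant vector \<open>z\<close>. It
  will be the value of \<open>F\<close> at the centre, so that Hoelder continuity can be
  used.\<close>

lemma V_approx_step:
  assumes F: "holder_density F M" and m: "m > 0"
  shows "V_approx (4 * m) F x - V_approx m F x = integral UNIV (\<lambda>y. DZ m (x - y) (F y - z))"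
proof -
  note cF = holder_density_continuous[OF F]
  have F0: "F y = 0" if "norm y > 1" for y using F that by (simp add: holder_density_def)
  have "V_approx (4 * m) F x - V_approx m F x = integral unit_box (\<lambda>y. DZ m (x - y) (F y))"
    unfolding V_approx_def DZ_def
    by (intro integral_diff[symmetric] integrable_continuous continuous_intros cF)
  also have "\<dots> = integral UNIV (\<lambda>y. DZ m (x - y) (F y))"
    by (rule integral_unit_box(1)[symmetric]) (auto intro!: continuous_intros cF simp: F0 DU_simps)
  also have "\<dots> = integral UNIV (\<lambda>y. DZ m (x - y) (F y)) - integral UNIV (\<lambda>y. DZ m (x - y) z)"
    by (simp add: integral_DZ_zero[OF m])
  also have "\<dots> = integral UNIV (\<lambda>y. DZ m (x - y) (F y) - DZ m (x - y) z)"
  proof (rule integral_diff[symmetric])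
    show "(\<lambda>y. DZ m (x - y) (F y)) integrable_on UNIV"
      by (rule integral_unit_box(2)) (auto intro!: continuous_intros cF simp: F0 DU_simps)
    let ?r = "supp_radius / m"
    have z: "DZ m (x - y) z = 0" if "y \<notin> cbox (x - ?r *\<^sub>R One) (x + ?r *\<^sub>R One)" for y
    proof (rule DZ_zero[OF m])
      show "?r \<le> norm (x - y)" using outside_centered_cbox[OF that] by (simp add: dist_norm)
    qed
    show "(\<lambda>y. DZ m (x - y) z) integrable_on UNIV"
      by (rule integrable_compact_support(2)[OF _ z]) (intro continuous_intros)
  qed
  finally show ?thesis by (simp add: DU_simps)
qed

text \<open>Let n be the dimension. The kernel \<open>DZ m\<close> has size m^n on a ball of radius
  comparable to 1/m, and \<open>F\<close> oscillates there by a multiple of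
  \<open>M / sqrt m\<close>; with \<open>m = 4 ^ j\<close> this gives \<open>M / 2 ^ j\<close>. A
  difference in space gains the factor \<open>m * dist x x'\<close>, hence
  \<open>2 ^ j * dist x x'\<close>.\<close>

lemma V_approx_step_bounds:
  obtains K where "K > 0"
    "\<And>F M j x. holder_density F M \<Longrightarrow> norm (V_approx (4 * 4 ^ j) F x - V_approx (4 ^ j) F x) \<le> K * M / 2 ^ j"
    "\<And>F M j x x'. holder_density F M \<Longrightarrow>
       norm ((V_approx (4 * 4 ^ j) F x - V_approx (4 ^ j) F x) - (V_approx (4 * 4 ^ j) F x' - V_approx (4 ^ j) F x'))
       \<le> K * M * 2 ^ j * dist x x'"
proof -
  let ?n = "DIM('a)" and ?R = supp_radius
  note R = supp_radius_pos
  obtain C where C: "C > 0" "\<And>m x f. m > 0 \<Longrightarrow> norm (DZ m x f) \<le> C * m ^ ?n * norm f"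
    "\<And>m x y f. m > 0 \<Longrightarrow> norm (DZ m x f - DZ m y f) \<le> C * m ^ ?n * (m * dist x y) * norm f"
    using DZ_bounds by metis
  \<comment> \<open>The box around the ball of radius \<open>2 * ?R / m\<close> has side
    \<open>4 * ?R / m\<close>, and \<open>M * sqrt (2 * ?R / m)\<close> is the oscillation over it;
    both estimates below fit into this constant.\<close>
  define A where "A = C * (4 * ?R) ^ ?n * sqrt (2 * ?R)"
  have A: "A > 0" using C R by (simp add: A_def)
  have sqrt4: "sqrt (4 ^ j) = 2 ^ j" for j :: nat
    by (simp add: real_sqrt_power)
  have b1: "norm (V_approx (4 * 4 ^ j) F x - V_approx (4 ^ j) F x) \<le> A * M / 2 ^ j"
    if F: "holder_density F M" for F M j x
  proof -
    define m :: real where "m = 4 ^ j"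
    have m: "m > 0" by (simp add: m_def)
    have M: "M \<ge> 0" and hol: "\<And>x y. norm (F x - F y) \<le> M * sqrt (dist x y)"
      using F by (auto simp: holder_density_def)
    note cF = holder_density_continuous[OF F]
    have "norm (integral UNIV (\<lambda>y. DZ m (x - y) (F y - F x))) \<le> (C * m ^ ?n * (M * sqrt (?R / m))) * (2 * (?R / m)) ^ ?n"
    proof (rule norm_integral_supported_in_ball[where x = x])
      show "continuous_on UNIV (\<lambda>y. DZ m (x - y) (F y - F x))" by (intro continuous_intros cF)
      show "DZ m (x - y) (F y - F x) = 0" if "?R / m < dist x y" for y
        using that by (intro DZ_zero m) (simp add: dist_norm)
      show "0 \<le> C * m ^ ?n * (M * sqrt (?R / m))" "0 \<le> ?R / m" using C m M R by auto
      show "norm (DZ m (x - y) (F y - F x)) \<le> C * m ^ ?n * (M * sqrt (?R / m))" for y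
      proof (cases "norm (x - y) \<ge> ?R / m")
        case True then show ?thesis using C M R m by (simp add: DZ_zero)
      next
        case False
        then have "M * sqrt (dist y x) \<le> M * sqrt (?R / m)"
          using M by (intro mult_left_mono real_sqrt_le_mono) (auto simp: dist_norm norm_minus_commute)
        then have "norm (F y - F x) \<le> M * sqrt (?R / m)" using hol order_trans by blast
        then have "C * m ^ ?n * norm (F y - F x) \<le> C * m ^ ?n * (M * sqrt (?R / m))"
          using C m by (intro mult_left_mono) auto
        then show ?thesis using C(2)[OF m, of "x - y" "F y - F x"] by linarith
      qed
    qed
    also have "\<dots> = C * (2 * ?R) ^ ?n * sqrt ?R * M / sqrt m"
      using m by (simp add: power_divide power_mult_distrib real_sqrt_divide)
    also have "\<dots> \<le> A * M / sqrt m"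
      unfolding A_def using C R M m
      by (intro divide_right_mono mult_right_mono mult_mono power_mono real_sqrt_le_mono) auto
    finally show ?thesis unfolding V_approx_step[OF F m, of x "F x", unfolded m_def] m_def sqrt4 .
  qed
  \<comment> \<open>For nearby points both kernels live in the ball of radius
    \<open>2 * (?R / m)\<close> around \<open>x\<close>. The same value \<open>F x\<close> is
    subtracted in both, so the difference falls on the kernel.\<close>
  have b2: "norm ((V_approx (4 * 4 ^ j) F x - V_approx (4 ^ j) F x) - (V_approx (4 * 4 ^ j) F x' - V_approx (4 ^ j) F x'))
      \<le> A * M * 2 ^ j * dist x x'"
    if F: "holder_density F M" and d: "dist x x' \<le> ?R / 4 ^ j" for F M j x x'
  proof -
    define m :: real where "m = 4 ^ j"
    have m: "m > 0" by (simp add: m_def)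
    have M: "M \<ge> 0" and hol: "\<And>x y. norm (F x - F y) \<le> M * sqrt (dist x y)"
      using F by (auto simp: holder_density_def)
    note cF = holder_density_continuous[OF F]
    let ?g = "\<lambda>y. DZ m (x - y) (F y - F x) - DZ m (x' - y) (F y - F x)"
    have z: "DZ m (u - y) (F y - F x) = 0" if "2 * (?R / m) < dist x y" "dist x u \<le> ?R / m" for u y
    proof (rule DZ_zero[OF m])
      have "dist x y \<le> dist x u + dist u y" by (rule dist_triangle)
      then have "?R / m \<le> dist u y" using that by linarith
      then show "?R / m \<le> norm (u - y)" by (simp add: dist_norm)
    qed
    have d': "dist x x' \<le> ?R / m" using d by (simp add: m_def)
    have int: "(\<lambda>y. DZ m (u - y) (F y - F x)) integrable_on UNIV" if "dist x u \<le> ?R / m" for u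
    proof (rule integrable_compact_support(2))
      show "continuous_on (cbox (x - (2 * (?R/m)) *\<^sub>R One) (x + (2 * (?R/m)) *\<^sub>R One)) (\<lambda>y. DZ m (u - y) (F y - F x))"
        by (intro continuous_intros cF)
      show "DZ m (u - y) (F y - F x) = 0"
        if "y \<notin> cbox (x - (2 * (?R/m)) *\<^sub>R One) (x + (2 * (?R/m)) *\<^sub>R One)" for y
        by (rule z[OF outside_centered_cbox[OF that] \<open>dist x u \<le> ?R / m\<close>])
    qed
    have "norm (integral UNIV ?g) \<le> (C * m ^ ?n * (m * dist x x') * (M * sqrt (2 * (?R / m)))) * (2 * (2 * (?R / m))) ^ ?n"
    proof (rule norm_integral_supported_in_ball[where x = x])
      show "continuous_on UNIV ?g" by (intro continuous_intros cF)
      show "?g y = 0" if "2 * (?R / m) < dist x y" for y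
        using z[OF that, of x] z[OF that, of x'] d' m R by simp
      show nn: "0 \<le> C * m ^ ?n * (m * dist x x') * (M * sqrt (2 * (?R / m)))" "0 \<le> 2 * (?R / m)"
        using C m M R by auto
      show "norm (?g y) \<le> C * m ^ ?n * (m * dist x x') * (M * sqrt (2 * (?R / m)))" for y
      proof (cases "2 * (?R / m) < dist x y")
        case True
        then have "?g y = 0" using z[of y x] z[of y x'] d' m R by simp
        then show ?thesis using nn by simp
      next
        case False
        then have "M * sqrt (dist y x) \<le> M * sqrt (2 * (?R / m))"
          using M by (intro mult_left_mono real_sqrt_le_mono) (auto simp: dist_commute)
        then have "norm (F y - F x) \<le> M * sqrt (2 * (?R / m))" using hol order_trans by blast
        then have "C * m ^ ?n * (m * dist x x') * norm (F y - F x) \<le> C * m ^ ?n * (m * dist x x') * (M * sqrt (2 * (?R / m)))"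
          using C m by (intro mult_left_mono) auto
        then show ?thesis using C(3)[OF m, of "x - y" "F y - F x" "x' - y"] by (simp add: dist_norm)
      qed
    qed
    also have "\<dots> = A * M * (m / sqrt m) * dist x x'"
      using m by (simp add: A_def power_divide power_mult_distrib real_sqrt_divide real_sqrt_mult)
    also have "m / sqrt m = 2 ^ j"
      using real_div_sqrt[of m] m unfolding m_def sqrt4 by simp
    also have "integral UNIV ?g = integral UNIV (\<lambda>y. DZ m (x - y) (F y - F x)) - integral UNIV (\<lambda>y. DZ m (x' - y) (F y - F x))"
      using d' m R by (intro integral_diff int) auto
    finally show ?thesis
      unfolding V_approx_step[OF F m, of _ "F x", unfolded m_def] m_def .
  qed
  \<comment> \<open>The second summand covers points farther apart than \<open>?R / 4 ^ j\<close>,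
    where two copies of the first bound are absorbed by \<open>2 ^ j * dist x x'\<close>.\<close>
  define K where "K = A + 2 * A / ?R"
  have K: "K > 0" "A \<le> K" "2 * A / ?R \<le> K" using A R by (auto simp: K_def add_pos_pos)
  show thesis
  proof (rule that[OF K(1)])
    fix F :: "'a \<Rightarrow> 'a" and M j x x' assume F: "holder_density F M"
    then have M: "M \<ge> 0" by (simp add: holder_density_def)
    have "A * M / 2 ^ j \<le> K * M / 2 ^ j" using K M by (intro divide_right_mono mult_right_mono) auto
    then show "norm (V_approx (4 * 4 ^ j) F x - V_approx (4 ^ j) F x) \<le> K * M / 2 ^ j"
      using b1[OF F, of j x] by linarith
    show "norm ((V_approx (4 * 4 ^ j) F x - V_approx (4 ^ j) F x) - (V_approx (4 * 4 ^ j) F x' - V_approx (4 ^ j) F x'))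
       \<le> K * M * 2 ^ j * dist x x'"
    proof (cases "dist x x' \<le> ?R / 4 ^ j")
      case True
      have "A * M * 2 ^ j * dist x x' \<le> K * M * 2 ^ j * dist x x'"
        using K M by (intro mult_right_mono) auto
      with b2[OF F True] show ?thesis by linarith
    next
      case False
      have p: "(4::real) ^ j = 2 ^ j * 2 ^ j" by (metis num_double numeral_times_numeral power_mult_distrib)
      have "1 \<le> 4 ^ j * dist x x' / ?R" using False R by (simp add: field_simps)
      then have "2 * A * M / 2 ^ j * 1 \<le> 2 * A * M / 2 ^ j * (4 ^ j * dist x x' / ?R)"
        using A M by (intro mult_left_mono) auto
      also have "\<dots> = 2 * A / ?R * M * 2 ^ j * dist x x'" by (simp add: p)
      also have "\<dots> \<le> K * M * 2 ^ j * dist x x'" using K M by (intro mult_right_mono) auto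
      finally have "A * M / 2 ^ j + A * M / 2 ^ j \<le> K * M * 2 ^ j * dist x x'" by simp
      moreover have "norm ((V_approx (4 * 4 ^ j) F x - V_approx (4 ^ j) F x) - (V_approx (4 * 4 ^ j) F x' - V_approx (4 ^ j) F x'))
        \<le> A * M / 2 ^ j + A * M / 2 ^ j"
        by (rule order_trans[OF norm_triangle_ineq4], rule add_mono) (rule b1[OF F])+
      ultimately show ?thesis by linarith
    qed
  qed
qed

end

section \<open>The limiting singular integral operator\<close>

context kernel
begin

text \<open>The limit of \<open>V_approx (4 ^ J) F\<close> in telescoped form. The limiting kernel
  is not absolutely integrable at the origin; the series, whose terms exploit the cancellation, both
  defines the operator and carries its estimates.\<close>

definition V :: "('a \<Rightarrow> 'a) \<Rightarrow> 'a \<Rightarrow> 'a" where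
  "V F x = V_approx 1 F x + (\<Sum>j. V_approx (4 * 4 ^ j) F x - V_approx (4 ^ j) F x)"

lemma V_approx_error:
  obtains K where "K > 0"
    "\<And>F M J x. holder_density F M \<Longrightarrow> norm (V F x - V_approx (4 ^ J) F x) \<le> K * M / 2 ^ J"
proof -
  obtain K where K: "K > 0" "\<And>F M j x. holder_density F M \<Longrightarrow>
      norm (V_approx (4 * 4 ^ j) F x - V_approx (4 ^ j) F x) \<le> K * M / 2 ^ j"
    using V_approx_step_bounds by metis
  show thesis
  proof (rule that[of "2 * K"])
    show "2 * K > 0" using K by simp
    fix F :: "'a \<Rightarrow> 'a" and M J x assume F: "holder_density F M"
    have "(\<Sum>j<J. V_approx (4 * 4 ^ j) F x - V_approx (4 ^ j) F x) = V_approx (4 ^ J) F x - V_approx 1 F x"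
      using sum_lessThan_telescope[of "\<lambda>j. V_approx (4 ^ j) F x" J] by simp
    then have "V F x - V_approx (4 ^ J) F x = (\<Sum>j. V_approx (4 * 4 ^ j) F x - V_approx (4 ^ j) F x) -
        (\<Sum>j<J. V_approx (4 * 4 ^ j) F x - V_approx (4 ^ j) F x)"
      by (simp add: V_def)
    then show "norm (V F x - V_approx (4 ^ J) F x) \<le> 2 * K * M / 2 ^ J"
      using geometric_tail(2)[of "\<lambda>j. V_approx (4 * 4 ^ j) F x - V_approx (4 ^ j) F x" "K * M" J, OF K(2)[OF F]]
      by (simp only: mult.assoc)
  qed
qed

lemma uniform_limit_V:
  assumes F: "holder_density F M"
  shows "uniform_limit UNIV (\<lambda>J. V_approx (4 ^ J) F) (V F) sequentially"
proof -
  obtain K where K: "K > 0" "\<And>J x. norm (V F x - V_approx (4 ^ J) F x) \<le> K * M / 2 ^ J"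
    using V_approx_error F by metis
  show ?thesis
  proof (rule uniform_limitI)
    fix e :: real assume "e > 0"
    have "(\<lambda>J. K * M / 2 ^ J) \<longlonglongrightarrow> 0" by (rule LIMSEQ_divide_realpow_zero) simp
    then have "\<forall>\<^sub>F J in sequentially. K * M / 2 ^ J < e" using \<open>e > 0\<close> by (rule order_tendstoD(2))
    then show "\<forall>\<^sub>F J in sequentially. \<forall>x\<in>UNIV. dist (V_approx (4 ^ J) F x) (V F x) < e"
    proof eventually_elim
      case (elim J)
      show ?case
      proof
        fix x show "dist (V_approx (4 ^ J) F x) (V F x) < e"
          using K(2)[of x J] elim by (simp add: dist_norm norm_minus_commute)
      qed
    qed
  qed
qed

lemma continuous_on_V:
  assumes "holder_density F M"
  shows "continuous_on UNIV (V F)"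
  by (rule uniform_limit_theorem[OF _ uniform_limit_V[OF assms]])
     (auto intro!: always_eventually continuous_on_V_approx holder_density_continuous[OF assms])

lemma V_diff:
  assumes F: "holder_density F A" and G: "holder_density G B"
  shows "V (\<lambda>x. F x - G x) x = V F x - V G x"
proof (rule tendsto_unique[OF trivial_limit_sequentially])
  show "(\<lambda>J. V_approx (4 ^ J) (\<lambda>x. F x - G x) x) \<longlonglongrightarrow> V (\<lambda>x. F x - G x) x"
    using tendsto_uniform_limitI[OF uniform_limit_V[OF holder_density_diff[OF F G]] UNIV_I] .
  have "(\<lambda>J. V_approx (4 ^ J) F x - V_approx (4 ^ J) G x) \<longlonglongrightarrow> V F x - V G x"
    by (intro tendsto_diff tendsto_uniform_limitI[OF uniform_limit_V[OF F] UNIV_I]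
        tendsto_uniform_limitI[OF uniform_limit_V[OF G] UNIV_I])
  then show "(\<lambda>J. V_approx (4 ^ J) (\<lambda>x. F x - G x) x) \<longlonglongrightarrow> V F x - V G x"
    by (simp only: V_approx_diff[OF holder_density_continuous[OF F] holder_density_continuous[OF G]])
qed

text \<open>The gradients \<open>N (V_approx (4 ^ J) F x)\<close> of the approximate potentials
  converge uniformly, which yields an antiderivative of the limit.\<close>

lemma V_potential:
  assumes F: "holder_density F M"
  shows "\<exists>v. \<forall>x. (v has_derivative (\<lambda>h. N (V F x) \<bullet> h)) (at x)"
proof -
  obtain B where B: "B > 0" "\<And>x. norm (N x) \<le> norm x * B"
    using bounded_linear.pos_bounded[OF bounded_linear_N] by blast
  have "\<exists>v. \<forall>x\<in>UNIV. (v has_derivative (\<lambda>h. N (V F x) \<bullet> h)) (at x within UNIV)"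
  proof (rule has_antiderivative_sequence[of UNIV "\<lambda>J. pot_approx (4 ^ J) F"])
    show "(pot_approx (4 ^ J) F has_derivative (\<lambda>h. N (V_approx (4 ^ J) F x) \<bullet> h)) (at x within UNIV)" for J x
      using has_derivative_pot_approx[OF holder_density_continuous[OF F]] by simp
    fix e :: real assume "e > 0"
    then have "e / B > 0" using B by simp
    from uniform_limitD[OF uniform_limit_V[OF F] this]
    show "\<forall>\<^sub>F J in sequentially. \<forall>x\<in>UNIV. \<forall>h. norm (N (V_approx (4 ^ J) F x) \<bullet> h - N (V F x) \<bullet> h) \<le> e * norm h"
    proof eventually_elim
      case (elim J)
      show ?case
      proof (intro ballI allI)
        fix x h :: 'a
        have "dist (V_approx (4 ^ J) F x) (V F x) * B \<le> e / B * B"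
          using elim B by (intro mult_right_mono) (auto intro: less_imp_le)
        then have "norm (N (V_approx (4 ^ J) F x - V F x)) \<le> e"
          using B(2)[of "V_approx (4 ^ J) F x - V F x"] B(1) by (simp add: dist_norm)
        then have "norm (N (V_approx (4 ^ J) F x - V F x)) * norm h \<le> e * norm h"
          by (intro mult_right_mono) auto
        then have "norm (N (V_approx (4 ^ J) F x - V F x) \<bullet> h) \<le> e * norm h"
          using Cauchy_Schwarz_ineq2 order_trans unfolding real_norm_def by blast
        then show "norm (N (V_approx (4 ^ J) F x) \<bullet> h - N (V F x) \<bullet> h) \<le> e * norm h"
          by (simp add: linear_diff[OF linN] inner_diff_left)
      qed
    qed
  qed simp
  then show ?thesis by simp
qed

text \<open>The series is handled by \<open>dyadic_series_bound\<close>. The base term has the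
  Lipschitz but not compactly supported kernel \<open>DU 1\<close>; for
  \<open>norm x \<le> 1\<close> its argument stays in the ball of radius 2 on the support of
  \<open>F\<close>, where \<open>DU_bounds\<close> applies.\<close>

lemma V_bounds:
  obtains K where "K > 0"
    "\<And>F M x. holder_density F M \<Longrightarrow> norm x \<le> 1 \<Longrightarrow> norm (V F x) \<le> K * M"
    "\<And>F M x y. holder_density F M \<Longrightarrow> norm x \<le> 1 \<Longrightarrow> norm y \<le> 1 \<Longrightarrow> norm (V F x - V F y) \<le> K * M * sqrt (dist x y)"
proof -
  let ?W = "\<lambda>j F x. V_approx (4 * 4 ^ j) F x - V_approx (4 ^ j) F x"
  obtain A where A: "A > 0"
    "\<And>F M j x. holder_density F M \<Longrightarrow> norm (?W j F x) \<le> A * M / 2 ^ j"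
    "\<And>F M j x y. holder_density F M \<Longrightarrow> norm (?W j F x - ?W j F y) \<le> A * M * 2 ^ j * dist x y"
    by (rule V_approx_step_bounds) blast
  obtain C where C: "C \<ge> 0" "\<And>x f. norm x \<le> 2 \<Longrightarrow> norm (DU 1 x f) \<le> C * norm f"
    "\<And>x y f. norm x \<le> 2 \<Longrightarrow> norm y \<le> 2 \<Longrightarrow> norm (DU 1 x f - DU 1 y f) \<le> C * dist x y * norm f"
    using DU_bounds by metis
  define D where "D = C * 2 ^ DIM('a)"
  have D: "D \<ge> 0" using C by (simp add: D_def)
  have bound: "norm (integral unit_box f) \<le> B * 2 ^ DIM('a)"
    if "0 \<le> B" "continuous_on UNIV f" "\<And>y. norm (f y) \<le> B" for f :: "'a \<Rightarrow> 'a" and B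
    using has_integral_bound[of B f "integral unit_box f" "- One" One] that
      integrable_integral[OF integrable_continuous[OF continuous_on_subset[OF that(2) subset_UNIV]]]
    by (simp add: content_unit_box)
  have V0: "norm (V_approx 1 F x) \<le> D * M" if F: "holder_density F M" and x: "norm x \<le> 1" for F M x
  proof -
    have M: "M \<ge> 0" using F by (simp add: holder_density_def)
    have "norm (V_approx 1 F x) \<le> (C * M) * 2 ^ DIM('a)"
      unfolding V_approx_def
    proof (rule bound)
      show "0 \<le> C * M" using C M by simp
      show "continuous_on UNIV (\<lambda>y. DU 1 (x - y) (F y))" by (intro continuous_intros holder_density_continuous[OF F])
      show "norm (DU 1 (x - y) (F y)) \<le> C * M" for y
      proof (cases "norm y > 1")
        case True
        then have "F y = 0" using F by (simp add: holder_density_def)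
        then show ?thesis using C M by (simp add: DU_simps)
      next
        case False
        then have "norm (x - y) \<le> 2" using x norm_triangle_ineq4[of x y] by linarith
        then have "norm (DU 1 (x - y) (F y)) \<le> C * norm (F y)" by (rule C(2))
        also have "\<dots> \<le> C * M" using C F by (intro mult_left_mono) (auto simp: holder_density_def)
        finally show ?thesis .
      qed
    qed
    then show ?thesis by (simp add: D_def mult_ac)
  qed
  have V1: "norm (V_approx 1 F x - V_approx 1 F y) \<le> 2 * D * M * sqrt (dist x y)"
    if F: "holder_density F M" and x: "norm x \<le> 1" "norm y \<le> 1" for F M x y
  proof -
    have M: "M \<ge> 0" using F by (simp add: holder_density_def)
    note cF = holder_density_continuous[OF F]
    have "V_approx 1 F x - V_approx 1 F y = integral unit_box (\<lambda>t. DU 1 (x - t) (F t) - DU 1 (y - t) (F t))"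
      unfolding V_approx_def by (intro integral_diff[symmetric] integrable_continuous continuous_intros cF)
    also have "norm \<dots> \<le> (C * dist x y * M) * 2 ^ DIM('a)"
    proof (rule bound)
      show "0 \<le> C * dist x y * M" using C M by simp
      show "continuous_on UNIV (\<lambda>t. DU 1 (x - t) (F t) - DU 1 (y - t) (F t))" by (intro continuous_intros cF)
      show "norm (DU 1 (x - t) (F t) - DU 1 (y - t) (F t)) \<le> C * dist x y * M" for t
      proof (cases "norm t > 1")
        case True
        then have "F t = 0" using F by (simp add: holder_density_def)
        then show ?thesis using C M by (simp add: DU_simps)
      next
        case False
        then have "norm (x - t) \<le> 2" "norm (y - t) \<le> 2"
          using x norm_triangle_ineq4[of x t] norm_triangle_ineq4[of y t] by linarith+
        then have "norm (DU 1 (x - t) (F t) - DU 1 (y - t) (F t)) \<le> C * dist (x - t) (y - t) * norm (F t)"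
          by (rule C(3))
        also have "\<dots> \<le> C * dist (x - t) (y - t) * M"
          using C F by (intro mult_left_mono) (auto simp: holder_density_def)
        finally show ?thesis by (simp add: dist_norm)
      qed
    qed
    also have "\<dots> = D * M * dist x y" by (simp add: D_def)
    also have "\<dots> \<le> D * M * (2 * sqrt (dist x y))"
    proof -
      have "dist x y \<le> 2 * sqrt (dist x y)" by (rule dist_le_sqrt_unit_ball[OF x])
      then show ?thesis using D M by (intro mult_left_mono) auto
    qed
    finally show ?thesis by (simp add: mult_ac)
  qed
  define K where "K = 2 * D + 6 * A"
  show thesis
  proof (rule that[of K])
    show "K > 0" using A D by (simp add: K_def)
    fix F :: "'a \<Rightarrow> 'a" and M and x :: 'a assume F: "holder_density F M" and x: "norm x \<le> 1"
    have M: "M \<ge> 0" using F by (simp add: holder_density_def)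
    have s: "summable (\<lambda>j. ?W j F z)" "norm (\<Sum>j. ?W j F z) \<le> 2 * (A * M)" for z
      using geometric_tail(1)[of "\<lambda>j. ?W j F z" "A * M"]
        geometric_tail(2)[of "\<lambda>j. ?W j F z" "A * M" 0] A(2)[OF F, of _ z] by simp_all
    have "norm (V F x) \<le> norm (V_approx 1 F x) + norm (\<Sum>j. ?W j F x)"
      unfolding V_def by (rule norm_triangle_ineq)
    also have "\<dots> \<le> D * M + 2 * (A * M)"
      using V0[OF F x] s(2)[of x] by simp
    also have "\<dots> = (D + 2 * A) * M" by (simp add: algebra_simps)
    also have "\<dots> \<le> K * M" using A D M by (intro mult_right_mono) (auto simp: K_def)
    finally show "norm (V F x) \<le> K * M" .
    fix y :: 'a assume y: "norm y \<le> 1"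
    have AM: "0 \<le> A * M" using A M by simp
    have b: "norm (?W j F x - ?W j F y) \<le> 2 * (A * M) / 2 ^ j" for j
    proof -
      have "norm (?W j F x - ?W j F y) \<le> A * M / 2 ^ j + A * M / 2 ^ j"
        by (rule order_trans[OF norm_triangle_ineq4], rule add_mono) (rule A(2)[OF F])+
      then show ?thesis by simp
    qed
    have "(\<Sum>j. ?W j F x) - (\<Sum>j. ?W j F y) = (\<Sum>j. ?W j F x - ?W j F y)"
      by (rule suminf_diff[OF s(1) s(1)])
    also have "norm \<dots> \<le> 6 * (A * M) * sqrt (dist x y)"
      by (rule dyadic_series_bound(2)[of "A * M" "dist x y" "\<lambda>j. ?W j F x - ?W j F y"])
        (rule AM zero_le_dist b A(3)[OF F])+
    finally have 1: "norm ((\<Sum>j. ?W j F x) - (\<Sum>j. ?W j F y)) \<le> 6 * (A * M) * sqrt (dist x y)" .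
    have "V F x - V F y = (V_approx 1 F x - V_approx 1 F y) + ((\<Sum>j. ?W j F x) - (\<Sum>j. ?W j F y))"
      by (simp add: V_def)
    also have "norm \<dots> \<le> 2 * D * M * sqrt (dist x y) + 6 * (A * M) * sqrt (dist x y)"
      using V1[OF F x y] 1 by (rule norm_triangle_mono)
    finally show "norm (V F x - V F y) \<le> K * M * sqrt (dist x y)"
      by (simp add: K_def algebra_simps)
  qed
qed

section \<open>The mass of the mollifiers and the divergence identity\<close>

definition mass :: real where "mass = integral UNIV (divU 1)"

lemma divU_zero: "m > 0 \<Longrightarrow> norm x \<ge> supp_radius / m \<Longrightarrow> divU m x = 0"
  using far[of m x] by (simp add: divU_def)

lemma divU_bound:
  "m \<ge> 0 \<Longrightarrow> 0 \<le> divU m x \<and> divU m x \<le> m ^ DIM('a) * (real DIM('a) * (real DIM('a) + 2) / 2)"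
proof -
  assume m: "m \<ge> 0"
  have "0 \<le> l * (norm x)\<^sup>2" using l_pos by simp
  then have "N x \<bullet> x \<ge> 0" using coercive[of x] by linarith
  then have "max 0 (1 - m\<^sup>2 * (N x \<bullet> x)) \<le> 1" by simp
  then have "m ^ DIM('a) * (real DIM('a) * (real DIM('a) + 2) / 2) * max 0 (1 - m\<^sup>2 * (N x \<bullet> x))
    \<le> m ^ DIM('a) * (real DIM('a) * (real DIM('a) + 2) / 2) * 1"
    using m by (intro mult_left_mono) auto
  then show ?thesis using m by (simp add: divU_def)
qed

lemma divU_integrable: "m > 0 \<Longrightarrow> (\<lambda>y. divU m (x - y)) integrable_on UNIV"
proof -
  assume m: "m > 0"
  have z: "divU m (x - y) = 0" if "y \<notin> cbox (x - (supp_radius / m) *\<^sub>R One) (x + (supp_radius / m) *\<^sub>R One)" for y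
    using outside_centered_cbox[OF that] by (intro divU_zero m) (simp add: dist_norm)
  show ?thesis
    by (rule integrable_compact_support(2)[OF _ z]) (intro continuous_intros)
qed

text \<open>Induction on the scale: the difference of consecutive mollifiers is the trace of
  \<open>DZ\<close>, whose integral vanishes. The base case uses that \<open>divU 1\<close> is
  even.\<close>

lemma integral_divU:
  "integral UNIV (\<lambda>y. divU (4 ^ J) (x - y)) = mass"
proof (induction J arbitrary: x)
  case 0
  have "divU 1 (x - y) = divU 1 (y + (- x))" for y
  proof -
    have "x - y = - (y + (- x))" by simp
    then show ?thesis
      by (simp only: divU_def linear_neg[OF linN] inner_minus_left inner_minus_right minus_minus)
  qed
  moreover have "integral UNIV (\<lambda>y. divU 1 (y + (- x))) = integral UNIV (divU 1)"
  proof (rule integral_translation_compact_support)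
    show "continuous_on UNIV (divU 1)" by (intro continuous_intros)
    show "divU 1 y = 0" if "y \<notin> cbox (0 - supp_radius *\<^sub>R One) (0 + supp_radius *\<^sub>R One)" for y
      using outside_centered_cbox[OF that] by (intro divU_zero) auto
  qed
  ultimately show ?case by (simp add: mass_def)
next
  case (Suc J)
  let ?m = "4 ^ J :: real" and ?r = "supp_radius / 4 ^ J"
  have eq: "divU (4 * ?m) z - divU ?m z = (\<Sum>b\<in>Basis. DZ ?m z b \<bullet> b)" for z
    unfolding divergence_U[symmetric] DZ_def inner_diff_left sum_subtractf ..
  have i: "(\<lambda>y. DZ ?m (x - y) b) integrable_on UNIV" for b
  proof -
    have z: "DZ ?m (x - y) b = 0" if "y \<notin> cbox (x - ?r *\<^sub>R One) (x + ?r *\<^sub>R One)" for y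
      using outside_centered_cbox[OF that] by (intro DZ_zero) (auto simp: dist_norm)
    show ?thesis
      by (rule integrable_compact_support(2)[OF _ z]) (intro continuous_intros)
  qed
  have i': "(\<lambda>y. DZ ?m (x - y) b \<bullet> b) integrable_on UNIV" for b
    using integrable_component[OF i] .
  have "integral UNIV (\<lambda>y. divU (4 * ?m) (x - y)) - integral UNIV (\<lambda>y. divU ?m (x - y))
      = integral UNIV (\<lambda>y. divU (4 * ?m) (x - y) - divU ?m (x - y))"
    by (intro integral_diff[symmetric] divU_integrable) auto
  also have "\<dots> = (\<Sum>b\<in>Basis. integral UNIV (\<lambda>y. DZ ?m (x - y) b \<bullet> b))"
    unfolding eq by (rule integral_sum[OF finite_Basis i'])
  also have "\<dots> = 0"
    by (simp only: integral_component_eq[OF i] integral_DZ_zero[of ?m] zero_less_power zero_less_numeral inner_zero_left sum.neutral_const)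
  finally show ?case using Suc by simp
qed

text \<open>\<open>divU 1\<close> is continuous, nonnegative and positive at the origin. Positivity
  permits the division by \<open>mass\<close> in the fixed point equation.\<close>

lemma mass_pos: "mass > 0"
proof -
  let ?r = supp_radius
  let ?B = "cbox (0 - ?r *\<^sub>R One) (0 + ?r *\<^sub>R One) :: 'a set"
  have c: "continuous_on ?B (divU 1)" by (intro continuous_intros)
  have z: "divU 1 y = 0" if "y \<notin> ?B" for y
    using outside_centered_cbox[OF that] by (intro divU_zero) auto
  have m: "mass = integral ?B (divU 1)"
    unfolding mass_def by (rule integrable_compact_support(3)[OF c z])
  have i: "(divU 1 has_integral mass) ?B"
    unfolding m by (intro integrable_integral integrable_continuous c)
  have nn: "0 \<le> divU 1 x" for x using divU_bound[of 1 x] by simp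
  have "mass \<ge> 0" using has_integral_nonneg[OF i nn] .
  moreover have "mass \<noteq> 0"
  proof
    assume "mass = 0"
    have "0 \<in> box (0 - ?r *\<^sub>R One) (0 + ?r *\<^sub>R One :: 'a)" using supp_radius_pos by (simp add: mem_box)
    then have "divU 1 0 = 0"
      using has_integral_0_cbox_imp_0[OF c nn i[unfolded \<open>mass = 0\<close>], of 0] box_subset_cbox by blast
    then show False by (simp add: divU_def linear_0[OF linN])
  qed
  ultimately show ?thesis by simp
qed

text \<open>Approximate identity with a rate: within distance \<open>supp_radius / m\<close> of
  \<open>x\<close> the density oscillates by at most \<open>M * sqrt (supp_radius / m)\<close>, and
  \<open>m = 4 ^ J\<close>.\<close>

lemma mollification_error:
  obtains K where "K \<ge> 0"
    "\<And>(F :: 'a \<Rightarrow> 'a) M J x. holder_density F M \<Longrightarrow>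
       norm (integral unit_box (\<lambda>y. divU (4 ^ J) (x - y) *\<^sub>R F y) - mass *\<^sub>R F x) \<le> K * M / 2 ^ J"
proof -
  let ?n = "DIM('a)" and ?R = supp_radius
  note R = supp_radius_pos
  define E where "E = real ?n * (real ?n + 2) / 2"
  have E: "E \<ge> 0" by (simp add: E_def)
  define K where "K = E * sqrt ?R * (2 * ?R) ^ ?n"
  show thesis
  proof (rule that[of K])
    show "K \<ge> 0" using E R by (simp add: K_def)
    fix F :: "'a \<Rightarrow> 'a" and M J x assume F: "holder_density F M"
    have M: "M \<ge> 0" and F0: "\<And>y. norm y > 1 \<Longrightarrow> F y = 0" and hol: "\<And>x y. norm (F x - F y) \<le> M * sqrt (dist x y)"
      using F by (auto simp: holder_density_def)
    note cF = holder_density_continuous[OF F]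
    define m :: real where "m = 4 ^ J"
    have m: "m > 0" by (simp add: m_def)
    have cm: "continuous_on UNIV (\<lambda>y. divU m (x - y) *\<^sub>R F y)" by (intro continuous_intros cF)
    have i1: "integral unit_box (\<lambda>y. divU m (x - y) *\<^sub>R F y) = integral UNIV (\<lambda>y. divU m (x - y) *\<^sub>R F y)"
      "(\<lambda>y. divU m (x - y) *\<^sub>R F y) integrable_on UNIV"
      using integral_unit_box[OF cm] F0 by simp_all
    have i2: "((\<lambda>y. divU m (x - y) *\<^sub>R F x) has_integral (mass *\<^sub>R F x)) UNIV"
    proof -
      have "((\<lambda>y. divU m (x - y)) has_integral mass) UNIV"
        using integrable_integral[OF divU_integrable[OF m, of x]] integral_divU[of J x] by (simp add: m_def)
      then show ?thesis by (rule has_integral_scaleR_left)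
    qed
    have "integral unit_box (\<lambda>y. divU m (x - y) *\<^sub>R F y) - mass *\<^sub>R F x =
        integral UNIV (\<lambda>y. divU m (x - y) *\<^sub>R F y - divU m (x - y) *\<^sub>R F x)"
      using i1 integral_diff[OF i1(2) has_integral_integrable[OF i2]] integral_unique[OF i2] by simp
    also have "norm \<dots> \<le> (m ^ ?n * E * (M * sqrt (?R / m))) * (2 * (?R / m)) ^ ?n"
    proof (rule norm_integral_supported_in_ball[where x = x])
      show "continuous_on UNIV (\<lambda>y. divU m (x - y) *\<^sub>R F y - divU m (x - y) *\<^sub>R F x)"
        by (intro continuous_intros cF)
      show "divU m (x - y) *\<^sub>R F y - divU m (x - y) *\<^sub>R F x = 0" if "?R / m < dist x y" for y
        using divU_zero[OF m, of "x - y"] that by (simp add: dist_norm)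
      show nn: "0 \<le> m ^ ?n * E * (M * sqrt (?R / m))" "0 \<le> ?R / m" using m M R E by auto
      show "norm (divU m (x - y) *\<^sub>R F y - divU m (x - y) *\<^sub>R F x) \<le> m ^ ?n * E * (M * sqrt (?R / m))" for y
      proof (cases "norm (x - y) \<ge> ?R / m")
        case True then show ?thesis using divU_zero[OF m True] nn by simp
      next
        case False
        then have "M * sqrt (dist y x) \<le> M * sqrt (?R / m)"
          using M by (intro mult_left_mono real_sqrt_le_mono) (auto simp: dist_norm norm_minus_commute)
        then have "norm (F y - F x) \<le> M * sqrt (?R / m)" using hol order_trans by blast
        then have "\<bar>divU m (x - y)\<bar> * norm (F y - F x) \<le> m ^ ?n * E * (M * sqrt (?R / m))"
          using divU_bound[of m "x - y"] m by (intro mult_mono) (auto simp: E_def)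
        then show ?thesis by (simp flip: scaleR_diff_right)
      qed
    qed
    also have "\<dots> = K * M / sqrt m"
      using m by (simp add: K_def power_divide power_mult_distrib real_sqrt_divide)
    also have "sqrt m = 2 ^ J" by (simp add: m_def real_sqrt_power)
    finally show "norm (integral unit_box (\<lambda>y. divU (4 ^ J) (x - y) *\<^sub>R F y) - mass *\<^sub>R F x) \<le> K * M / 2 ^ J"
      by (simp add: m_def)
  qed
qed

text \<open>The divergence of the derivative of \<open>U m\<close> along \<open>f\<close> is the
  derivative of \<open>divU m\<close> along \<open>f\<close>.
  \<open>integral_by_parts_directional\<close> expresses this against test functions, and two
  exchanges of integrals carry it through the convolution.\<close>

lemma V_approx_weak:
  assumes cF: "continuous_on UNIV F" and tp: "test_pair \<psi> g 1"
  shows "integral unit_box (\<lambda>x. V_approx m F x \<bullet> g x) =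
    integral unit_box (\<lambda>x. integral unit_box (\<lambda>y. divU m (x - y) *\<^sub>R F y) \<bullet> g x)"
proof -
  have cg: "continuous_on UNIV g" by (rule test_pair_continuous(1)[OF tp])
  have F': "continuous_on S (\<lambda>z. F (f z))" "continuous_on S (\<lambda>z. g (f z))"
    if "continuous_on S f" for S :: "('a \<times> 'a) set" and f
    using continuous_on_compose2[OF cF that] continuous_on_compose2[OF cg that] by auto
  note cF' = continuous_on_subset[OF cF subset_UNIV] and cg' = continuous_on_subset[OF cg subset_UNIV]
  have g0: "g x = 0" if "norm x > 1" for x using test_pair_gradient_zero[OF tp that] .
  have ibp: "integral unit_box (\<lambda>x. DU m (x - y) f \<bullet> g x) = integral unit_box (\<lambda>x. divU m (x - y) * (f \<bullet> g x))" for y f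
  proof -
    have d: "((\<lambda>x. U m (x - y)) has_derivative DU m (x - y)) (at x)" for x
      by (rule has_derivative_compose[of "\<lambda>x. x - y" "\<lambda>h. h" x UNIV "U m", OF _ has_derivative_U])
         (auto intro!: derivative_eq_intros)
    have c: "continuous_on UNIV (\<lambda>x. DU m (x - y) h)" for h by (intro continuous_intros)
    have "integral UNIV (\<lambda>x. DU m (x - y) f \<bullet> g x) = integral UNIV (\<lambda>x. divU m (x - y) * (f \<bullet> g x))"
      using integral_by_parts_directional[OF tp d c, of f] by (simp add: divergence_U)
    moreover have "integral UNIV (\<lambda>x. DU m (x - y) f \<bullet> g x) = integral unit_box (\<lambda>x. DU m (x - y) f \<bullet> g x)"
      by (rule integral_unit_box(1)) (use g0 in \<open>auto intro!: continuous_intros cg\<close>)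
    moreover have "integral UNIV (\<lambda>x. divU m (x - y) * (f \<bullet> g x)) = integral unit_box (\<lambda>x. divU m (x - y) * (f \<bullet> g x))"
      by (rule integral_unit_box(1)) (use g0 in \<open>auto intro!: continuous_intros cg\<close>)
    ultimately show ?thesis by simp
  qed
  have "V_approx m F x \<bullet> g x = integral unit_box (\<lambda>y. DU m (x - y) (F y) \<bullet> g x)" for x
    unfolding V_approx_def
    by (intro integral_component_eq[symmetric] integrable_continuous continuous_intros cF')
  then have "integral unit_box (\<lambda>x. V_approx m F x \<bullet> g x) =
      integral unit_box (\<lambda>x. integral unit_box (\<lambda>y. DU m (x - y) (F y) \<bullet> g x))" by simp
  also have "\<dots> = integral unit_box (\<lambda>y. integral unit_box (\<lambda>x. DU m (x - y) (F y) \<bullet> g x))"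
    by (rule integral_swap_continuous) (auto intro!: continuous_intros F' simp: split_beta)
  also have "\<dots> = integral unit_box (\<lambda>y. integral unit_box (\<lambda>x. divU m (x - y) * (F y \<bullet> g x)))"
    by (simp only: ibp)
  also have "\<dots> = integral unit_box (\<lambda>x. integral unit_box (\<lambda>y. divU m (x - y) * (F y \<bullet> g x)))"
    by (rule integral_swap_continuous) (auto intro!: continuous_intros F' simp: split_beta)
  also have "(\<lambda>x. integral unit_box (\<lambda>y. divU m (x - y) * (F y \<bullet> g x))) =
      (\<lambda>x. integral unit_box (\<lambda>y. divU m (x - y) *\<^sub>R F y) \<bullet> g x)"
  proof
    fix x
    have "(\<lambda>y. divU m (x - y) *\<^sub>R F y) integrable_on unit_box"
      by (intro integrable_continuous continuous_intros cF')
    from integral_component_eq[OF this, of "g x"]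
    show "integral unit_box (\<lambda>y. divU m (x - y) * (F y \<bullet> g x)) = integral unit_box (\<lambda>y. divU m (x - y) *\<^sub>R F y) \<bullet> g x"
      by (simp only: inner_scaleR_left)
  qed
  finally show ?thesis .
qed

text \<open>Weak form of \<open>div (V F) = mass * div F\<close>: the mollifications in
  \<open>V_approx_weak\<close> tend to \<open>mass *\<^sub>R F\<close>. Together with
  \<open>V_potential\<close> this makes \<open>V\<close> the solution operator of the
  constant-coefficient problem with right-hand side in divergence form.\<close>

lemma V_weak:
  assumes F: "holder_density F M" and tp: "test_pair \<psi> g 1"
  shows "integral unit_box (\<lambda>x. V F x \<bullet> g x) = mass * integral unit_box (\<lambda>x. F x \<bullet> g x)"
proof -
  let ?mol = "\<lambda>J x. integral unit_box (\<lambda>y. divU (4 ^ J) (x - y) *\<^sub>R F y)"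
  note cF = holder_density_continuous[OF F]
  have cg: "continuous_on UNIV g" by (rule test_pair_continuous(1)[OF tp])
  note cg' = continuous_on_subset[OF cg subset_UNIV]
  note cV = continuous_on_subset[OF continuous_on_V[OF F] subset_UNIV]
  have cVa: "continuous_on S (V_approx m F)" for m S
    using continuous_on_V_approx[OF cF] continuous_on_subset by blast
  obtain K1 where "\<And>F M J x. holder_density F M \<Longrightarrow> norm (V F x - V_approx (4 ^ J) F x) \<le> K1 * M / 2 ^ J"
    by (rule V_approx_error) blast
  note K1 = this[OF F]
  obtain K2 where "\<And>(F :: 'a \<Rightarrow> 'a) M J x. holder_density F M \<Longrightarrow>
      norm (integral unit_box (\<lambda>y. divU (4 ^ J) (x - y) *\<^sub>R F y) - mass *\<^sub>R F x) \<le> K2 * M / 2 ^ J"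
    by (rule mollification_error) blast
  note K2 = this[OF F]
  have "bounded (g ` unit_box)"
    by (rule compact_imp_bounded[OF compact_continuous_image[OF cg' compact_cbox]])
  then obtain G where G: "\<And>x. x \<in> unit_box \<Longrightarrow> norm (g x) \<le> G"
    unfolding bounded_iff by blast
  have "(0::'a) \<in> unit_box" by (simp add: mem_box)
  then have G0: "G \<ge> 0" using G norm_ge_zero order_trans by blast
  have cmol: "continuous_on unit_box (?mol J)" for J
  proof -
    have F': "continuous_on S (\<lambda>z. F (f z))" if "continuous_on S f" for S :: "('a \<times> 'a) set" and f
      using continuous_on_compose2[OF cF that] by auto
    show ?thesis
      by (intro integral_continuous_on_param) (auto intro!: continuous_intros F' simp: split_beta)
  qed
  \<comment> \<open>A uniform error \<open>K * M / 2 ^ J\<close> passes to the pairing with the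
    bounded field \<open>g\<close>; this serves both limits below.\<close>
  have est: "norm (integral unit_box (\<lambda>x. P x \<bullet> g x) - integral unit_box (\<lambda>x. Q x \<bullet> g x)) \<le> (K * M / 2 ^ J) * G * 2 ^ DIM('a)"
    if "continuous_on unit_box P" "continuous_on unit_box Q" "\<And>x. norm (P x - Q x) \<le> K * M / 2 ^ J" for P Q :: "'a \<Rightarrow> 'a" and K J
  proof -
    have B: "0 \<le> K * M / 2 ^ J" using that(3)[of 0] norm_ge_zero order_trans by blast
    have "integral unit_box (\<lambda>x. P x \<bullet> g x) - integral unit_box (\<lambda>x. Q x \<bullet> g x) =
        integral unit_box (\<lambda>x. (P x - Q x) \<bullet> g x)"
      unfolding inner_diff_left
      by (intro integral_diff[symmetric] integrable_continuous continuous_intros that cg')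
    moreover have "((\<lambda>x. (P x - Q x) \<bullet> g x) has_integral integral unit_box (\<lambda>x. (P x - Q x) \<bullet> g x)) unit_box"
      by (intro integrable_integral integrable_continuous continuous_intros that cg')
    then have "norm (integral unit_box (\<lambda>x. (P x - Q x) \<bullet> g x)) \<le> ((K * M / 2 ^ J) * G) * Henstock_Kurzweil_Integration.content (unit_box :: 'a set)"
    proof (rule has_integral_bound[rotated])
      show "0 \<le> (K * M / 2 ^ J) * G" by (rule mult_nonneg_nonneg[OF B G0])
      fix x :: 'a assume "x \<in> unit_box"
      then have "norm (P x - Q x) * norm (g x) \<le> (K * M / 2 ^ J) * G"
        using that(3) G B by (intro mult_mono) auto
      then show "norm ((P x - Q x) \<bullet> g x) \<le> (K * M / 2 ^ J) * G"
        using Cauchy_Schwarz_ineq2 order_trans unfolding real_norm_def by blast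
    qed
    ultimately show ?thesis unfolding content_unit_box by simp
  qed
  have lim: "(\<lambda>J. (K * M / 2 ^ J) * G * 2 ^ DIM('a)) \<longlonglongrightarrow> 0" for K
  proof -
    have "(\<lambda>J. K * M * G * 2 ^ DIM('a) / 2 ^ J) \<longlonglongrightarrow> 0" by (rule LIMSEQ_divide_realpow_zero) simp
    then show ?thesis by (simp add: mult.commute mult.left_commute)
  qed
  have "(\<lambda>J. integral unit_box (\<lambda>x. V_approx (4 ^ J) F x \<bullet> g x)) \<longlonglongrightarrow> integral unit_box (\<lambda>x. V F x \<bullet> g x)"
  proof (rule LIM_zero_cancel, rule Lim_null_comparison[OF _ lim[of K1]], rule always_eventually, rule allI)
    fix J
    have "norm (integral unit_box (\<lambda>x. V F x \<bullet> g x) - integral unit_box (\<lambda>x. V_approx (4 ^ J) F x \<bullet> g x))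
        \<le> (K1 * M / 2 ^ J) * G * 2 ^ DIM('a)"
      by (rule est[OF cV cVa K1])
    then show "norm (integral unit_box (\<lambda>x. V_approx (4 ^ J) F x \<bullet> g x) - integral unit_box (\<lambda>x. V F x \<bullet> g x))
        \<le> (K1 * M / 2 ^ J) * G * 2 ^ DIM('a)"
      by (subst norm_minus_commute)
  qed
  moreover have "(\<lambda>J. integral unit_box (\<lambda>x. ?mol J x \<bullet> g x)) \<longlonglongrightarrow> integral unit_box (\<lambda>x. (mass *\<^sub>R F x) \<bullet> g x)"
  proof (rule LIM_zero_cancel, rule Lim_null_comparison[OF _ lim[of K2]], rule always_eventually, rule allI)
    fix J
    show "norm (integral unit_box (\<lambda>x. ?mol J x \<bullet> g x) - integral unit_box (\<lambda>x. (mass *\<^sub>R F x) \<bullet> g x))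
        \<le> (K2 * M / 2 ^ J) * G * 2 ^ DIM('a)"
      by (rule est[OF cmol _ K2]) (intro continuous_intros cF)
  qed
  ultimately have "integral unit_box (\<lambda>x. V F x \<bullet> g x) = integral unit_box (\<lambda>x. (mass *\<^sub>R F x) \<bullet> g x)"
    unfolding V_approx_weak[OF cF tp] by (rule LIMSEQ_unique)
  also have "\<dots> = mass * integral unit_box (\<lambda>x. F x \<bullet> g x)" by simp
  finally show ?thesis .
qed

end

section \<open>The contraction argument\<close>

definition cutoff :: "'a::euclidean_space \<Rightarrow> real" where
  "cutoff y = max 0 (min 1 (2 - 2 * norm y))"

lemma cutoff_range: "0 \<le> cutoff y" "cutoff y \<le> 1"
  by (auto simp: cutoff_def)

lemma cutoff_eq_1: "norm y \<le> 1 / 2 \<Longrightarrow> cutoff y = 1"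
  by (simp add: cutoff_def)

lemma cutoff_eq_0: "norm y \<ge> 1 \<Longrightarrow> cutoff y = 0"
  by (simp add: cutoff_def)

lemma cutoff_holder: "\<bar>cutoff x - cutoff y\<bar> \<le> 2 * sqrt (dist x y)"
proof (cases "dist x y \<ge> 1")
  case True
  then have "1 \<le> 2 * sqrt (dist x y)" using real_sqrt_ge_1_iff[of "dist x y"] by linarith
  then show ?thesis using cutoff_range[of x] cutoff_range[of y] by linarith
next
  case False
  have "\<bar>norm x - norm y\<bar> \<le> dist x y" by (simp add: dist_norm norm_triangle_ineq3)
  then have "\<bar>cutoff x - cutoff y\<bar> \<le> 2 * dist x y" by (auto simp: cutoff_def max_def min_def)
  also have "dist x y = sqrt (dist x y) * sqrt (dist x y)" by simp
  also have "\<dots> \<le> 1 * sqrt (dist x y)" using False by (intro mult_right_mono) auto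
  finally show ?thesis by simp
qed

lemma holder_density_mono: "holder_density F A \<Longrightarrow> A \<le> B \<Longrightarrow> holder_density F B"
proof -
  assume F: "holder_density F A" and AB: "A \<le> B"
  have "A * sqrt (dist x y) \<le> B * sqrt (dist x y)" for x y using AB by (intro mult_right_mono) auto
  then show ?thesis using F AB unfolding holder_density_def by (meson order_trans)
qed

lemma holder_density_zero: "holder_density (\<lambda>x. 0) 0"
  by (simp add: holder_density_def)

lemma holder_density_minus: "holder_density F A \<Longrightarrow> holder_density (\<lambda>x. - F x) A"
  by (simp add: holder_density_def norm_minus_commute)

lemma holder_density_add:
  assumes "holder_density F A" "holder_density G B"
  shows "holder_density (\<lambda>x. F x + G x) (A + B)"
  using holder_density_diff[OF assms(1) holder_density_minus[OF assms(2)]] by simp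

text \<open>The constant is \<open>6 = 4 + 2\<close>: the Hoelder constant of \<open>e\<close> plus
  that of the cutoff. Across the unit sphere, beyond which nothing is known about \<open>e\<close>,
  the cutoff itself is at most \<open>2 * sqrt (dist x y)\<close>, so the extension by zero stays
  Hoelder.\<close>

lemma holder_density_cutoff:
  fixes e :: "'a::euclidean_space \<Rightarrow> 'b::euclidean_space"
  assumes c: "c > 0" and A: "A \<ge> 0" and b: "\<And>y. norm y \<le> 1 \<Longrightarrow> norm (e y) \<le> A"
    and h: "\<And>x y. norm x \<le> 1 \<Longrightarrow> norm y \<le> 1 \<Longrightarrow> norm (e x - e y) \<le> 4 * A * sqrt (dist x y)"
  shows "holder_density (\<lambda>y. if norm y \<le> 1 then (- cutoff y / c) *\<^sub>R e y else 0) (6 / c * A)"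
proof -
  let ?F = "\<lambda>y. if norm y \<le> 1 then (- cutoff y / c) *\<^sub>R e y else 0"
  let ?G = "\<lambda>y. if norm y \<le> 1 then cutoff y *\<^sub>R e y else 0"
  have FG: "?F y = (- 1 / c) *\<^sub>R ?G y" for y by simp
  have mixed: "norm (cutoff x *\<^sub>R e x) \<le> 6 * A * sqrt (dist x y)" if "norm x \<le> 1" "norm y > 1" for x y
  proof -
    have "cutoff x \<le> 2 * sqrt (dist x y)" using cutoff_holder[of x y] cutoff_eq_0[of y] that by simp
    then have "cutoff x * norm (e x) \<le> 2 * sqrt (dist x y) * A"
      using b[OF that(1)] cutoff_range by (intro mult_mono) auto
    also have "\<dots> \<le> 6 * A * sqrt (dist x y)" using A mult_right_mono[of "2 * A" "6 * A" "sqrt (dist x y)"] by (simp add: mult_ac)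
    finally show ?thesis using cutoff_range[of x] by simp
  qed
  have G: "norm (?G x - ?G y) \<le> 6 * A * sqrt (dist x y)" for x y
  proof -
    consider "norm x \<le> 1" "norm y \<le> 1" | "norm x \<le> 1" "norm y > 1" | "norm x > 1" "norm y \<le> 1"
      | "norm x > 1" "norm y > 1" by linarith
    then show ?thesis
    proof cases
      case 1
      have "norm (cutoff x *\<^sub>R (e x - e y) + (cutoff x - cutoff y) *\<^sub>R e y) \<le> 1 * (4 * A * sqrt (dist x y)) + 2 * sqrt (dist x y) * A"
      proof (rule norm_triangle_mono)
        show "norm (cutoff x *\<^sub>R (e x - e y)) \<le> 1 * (4 * A * sqrt (dist x y))"
          unfolding norm_scaleR using h[OF 1] cutoff_range[of x] by (intro mult_mono) auto
        show "norm ((cutoff x - cutoff y) *\<^sub>R e y) \<le> 2 * sqrt (dist x y) * A"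
          unfolding norm_scaleR using b[OF 1(2)] cutoff_holder[of x y] by (intro mult_mono) auto
      qed
      moreover have "?G x - ?G y = cutoff x *\<^sub>R (e x - e y) + (cutoff x - cutoff y) *\<^sub>R e y"
        using 1 by (simp add: scaleR_diff_right scaleR_diff_left)
      ultimately show ?thesis by simp
    next
      case 2 then show ?thesis using mixed[of x y] by simp
    next
      case 3 then show ?thesis using mixed[of y x] by (simp add: dist_commute)
    next
      case 4 then show ?thesis using A by simp
    qed
  qed
  have "norm (?F x - ?F y) \<le> 6 / c * A * sqrt (dist x y)" for x y
  proof -
    have "norm (?F x - ?F y) = norm (?G x - ?G y) / c"
      unfolding FG scaleR_diff_right[symmetric] norm_scaleR using c by simp
    also have "\<dots> \<le> (6 * A * sqrt (dist x y)) / c" using c by (intro divide_right_mono G) auto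
    finally show ?thesis by simp
  qed
  moreover have "norm (?F x) \<le> 6 / c * A" for x
  proof (cases "norm x \<le> 1")
    case True
    then have "cutoff x * norm (e x) \<le> 1 * A" using b cutoff_range by (intro mult_mono) auto
    then have "cutoff x * norm (e x) / c \<le> 6 * A / c" using A c by (intro divide_right_mono) auto
    then show ?thesis using True cutoff_range[of x] c by simp
  qed (use A c in simp)
  ultimately show ?thesis using A c by (auto simp: holder_density_def)
qed

text \<open>In \<open>y\<close> a small Lipschitz constant takes the place of a derivative, since
  the coefficient is merely C^1. The Lipschitz dependence of \<open>L\<close> on both arguments is
  what a Hoelder bound for \<open>E y (P y) - E y (Q y)\<close> consumes. The arguments are confined
  to the unit ball, so iterates have to satisfy \<open>norm (V F y) \<le> 1\<close>.\<close>

definition small_perturbation ::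
    "real \<Rightarrow> ('a::euclidean_space \<Rightarrow> 'a \<Rightarrow> 'a) \<Rightarrow> ('a \<Rightarrow> 'a \<Rightarrow> 'a \<Rightarrow> 'a) \<Rightarrow> bool" where
  "small_perturbation \<theta> E L \<longleftrightarrow> 0 \<le> \<theta> \<and> E 0 0 = 0 \<and>
     (\<forall>y z. norm y \<le> 1 \<longrightarrow> norm z \<le> 1 \<longrightarrow>
        (E y has_derivative L y z) (at z) \<and> (\<forall>h. norm (L y z h) \<le> \<theta> * norm h)) \<and>
     (\<forall>y z y' z' h. norm y \<le> 1 \<longrightarrow> norm z \<le> 1 \<longrightarrow> norm y' \<le> 1 \<longrightarrow> norm z' \<le> 1 \<longrightarrow>
        norm (L y z h - L y' z' h) \<le> \<theta> * (dist y y' + dist z z') * norm h) \<and>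
     (\<forall>y y' z. norm y \<le> 1 \<longrightarrow> norm y' \<le> 1 \<longrightarrow> norm z \<le> 1 \<longrightarrow>
        norm (E y z - E y' z) \<le> \<theta> * dist y y')"

text \<open>The factor \<open>- 1 / c\<close>, with \<open>c = mass\<close>, makes a fixed point
  \<open>F\<close> satisfy \<open>mass *\<^sub>R F y = - E y (V F y)\<close> wherever the cutoff is
  1.\<close>

definition superposition :: "real \<Rightarrow> ('a::euclidean_space \<Rightarrow> 'a \<Rightarrow> 'a) \<Rightarrow> ('a \<Rightarrow> 'a) \<Rightarrow> 'a \<Rightarrow> 'a" where
  "superposition c E W y = (if norm y \<le> 1 then (- cutoff y / c) *\<^sub>R E y (W y) else 0)"

text \<open>The size of the first iterate: at \<open>W = 0\<close> the perturbation is controlled by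
  \<open>E 0 0 = 0\<close> and its Lipschitz constant in \<open>y\<close>.\<close>

lemma superposition_zero:
  assumes E: "small_perturbation \<theta> E L" and c: "c > 0" and W: "\<And>y. norm y \<le> 1 \<Longrightarrow> W y = 0"
  shows "holder_density (superposition c E W) (6 / c * \<theta>)"
proof -
  have \<theta>: "\<theta> \<ge> 0" and E0: "E 0 0 = 0"
    and lip: "\<And>y y'. norm y \<le> 1 \<Longrightarrow> norm y' \<le> 1 \<Longrightarrow> norm (E y 0 - E y' 0) \<le> \<theta> * dist y y'"
    using E unfolding small_perturbation_def by auto
  have "holder_density (\<lambda>y. if norm y \<le> 1 then (- cutoff y / c) *\<^sub>R E y 0 else 0) (6 / c * \<theta>)"
  proof (rule holder_density_cutoff[OF c \<theta>])
    fix y :: 'a assume y: "norm y \<le> 1"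
    have "norm (E y 0 - E 0 0) \<le> \<theta> * dist y 0" by (rule lip) (use y in auto)
    also have "\<dots> \<le> \<theta>" using y \<theta> by (simp add: mult_left_le)
    finally show "norm (E y 0) \<le> \<theta>" using E0 by simp
  next
    fix x y :: 'a assume x: "norm x \<le> 1" and y: "norm y \<le> 1"
    have "norm (E x 0 - E y 0) \<le> \<theta> * dist x y" by (rule lip[OF x y])
    also have "\<dots> \<le> \<theta> * (2 * sqrt (dist x y))" using dist_le_sqrt_unit_ball[OF x y] \<theta> by (rule mult_left_mono)
    also have "\<dots> \<le> 4 * \<theta> * sqrt (dist x y)" using \<theta> mult_right_mono[of "2 * \<theta>" "4 * \<theta>" "sqrt (dist x y)"] by simp
    finally show "norm (E x 0 - E y 0) \<le> 4 * \<theta> * sqrt (dist x y)" .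
  qed
  moreover have "superposition c E W = (\<lambda>y. if norm y \<le> 1 then (- cutoff y / c) *\<^sub>R E y 0 else 0)"
    by (rule ext) (simp add: superposition_def W)
  ultimately show ?thesis by simp
qed

text \<open>Mean value inequality along the segment \<open>w y\<close> from \<open>Q y\<close> to
  \<open>P y\<close>, at one point for the sup bound and for the difference of two points for the
  Hoelder bound. The result is linear in \<open>d\<close>, which makes the iteration
  contract.\<close>

lemma superposition_diff:
  fixes E :: "'a::euclidean_space \<Rightarrow> 'a \<Rightarrow> 'a"
  assumes E: "small_perturbation \<theta> E L" and c: "c > 0" and d: "d \<ge> 0"
    and P: "\<And>y. norm y \<le> 1 \<Longrightarrow> norm (P y) \<le> 1"
      "\<And>x y. norm x \<le> 1 \<Longrightarrow> norm y \<le> 1 \<Longrightarrow> norm (P x - P y) \<le> sqrt (dist x y)"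
    and Q: "\<And>y. norm y \<le> 1 \<Longrightarrow> norm (Q y) \<le> 1"
      "\<And>x y. norm x \<le> 1 \<Longrightarrow> norm y \<le> 1 \<Longrightarrow> norm (Q x - Q y) \<le> sqrt (dist x y)"
    and PQ: "\<And>y. norm y \<le> 1 \<Longrightarrow> norm (P y - Q y) \<le> d"
      "\<And>x y. norm x \<le> 1 \<Longrightarrow> norm y \<le> 1 \<Longrightarrow> norm ((P x - Q x) - (P y - Q y)) \<le> d * sqrt (dist x y)"
  shows "holder_density (\<lambda>y. superposition c E P y - superposition c E Q y) (6 / c * (\<theta> * d))"
proof -
  have \<theta>: "\<theta> \<ge> 0"
    and der: "\<And>y z. norm y \<le> 1 \<Longrightarrow> norm z \<le> 1 \<Longrightarrow> (E y has_derivative L y z) (at z)"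
    and Lb: "\<And>y z h. norm y \<le> 1 \<Longrightarrow> norm z \<le> 1 \<Longrightarrow> norm (L y z h) \<le> \<theta> * norm h"
    and Ll: "\<And>y z y' z' h. norm y \<le> 1 \<Longrightarrow> norm z \<le> 1 \<Longrightarrow> norm y' \<le> 1 \<Longrightarrow> norm z' \<le> 1 \<Longrightarrow>
        norm (L y z h - L y' z' h) \<le> \<theta> * (dist y y' + dist z z') * norm h"
    using E unfolding small_perturbation_def by auto
  define e where "e y = E y (P y) - E y (Q y)" for y
  define w where "w y s = Q y + s *\<^sub>R (P y - Q y)" for y s
  have w1: "norm (w y s) \<le> 1" if "norm y \<le> 1" "s \<in> {0..1}" for y s
  proof -
    have "w y s \<in> closed_segment (Q y) (P y)"
      using that unfolding closed_segment_def w_def by (auto simp: algebra_simps intro!: exI[of _ s])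
    moreover have "closed_segment (Q y) (P y) \<subseteq> cball 0 1"
      using P(1) Q(1) that by (intro closed_segment_subset) auto
    ultimately show ?thesis by auto
  qed
  have dw: "((\<lambda>s. E y (w y s)) has_derivative (\<lambda>h. h *\<^sub>R L y (w y s) (P y - Q y))) (at s within {0..1})"
    if "norm y \<le> 1" "s \<in> {0..1}" for y s
  proof -
    have D: "(E y has_derivative L y (w y s)) (at (w y s))" by (rule der[OF that(1) w1[OF that]])
    have "((\<lambda>s. E y (w y s)) has_derivative (\<lambda>h. L y (w y s) (h *\<^sub>R (P y - Q y)))) (at s within {0..1})"
      by (rule has_derivative_compose[of "w y" _ s, OF _ D]) (auto intro!: derivative_eq_intros simp: w_def[abs_def])
    moreover have "linear (L y (w y s))" using D has_derivative_linear by blast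
    ultimately show ?thesis by (simp add: linear_scale)
  qed
  have e_eq: "e y = E y (w y 1) - E y (w y 0)" for y by (simp add: e_def w_def)
  have eb: "norm (e y) \<le> \<theta> * d" if y: "norm y \<le> 1" for y
  proof -
    have "norm (E y (w y 1) - E y (w y 0)) \<le> (\<theta> * d) * norm (1 - 0 :: real)"
    proof (rule differentiable_bound[of "{0..1}" "\<lambda>s. E y (w y s)", OF _ dw[OF y]])
      fix s :: real assume s: "s \<in> {0..1}"
      have "norm (L y (w y s) (P y - Q y)) \<le> \<theta> * norm (P y - Q y)" by (rule Lb[OF y w1[OF y s]])
      also have "\<dots> \<le> \<theta> * d" using PQ(1)[OF y] \<theta> by (rule mult_left_mono)
      finally have b: "norm (L y (w y s) (P y - Q y)) \<le> \<theta> * d" .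
      show "onorm (\<lambda>h. h *\<^sub>R L y (w y s) (P y - Q y)) \<le> \<theta> * d"
        by (rule onorm_bound) (use b \<theta> d in \<open>auto simp: mult.commute[of "\<theta> * d"] intro!: mult_left_mono\<close>)
    qed auto
    then show ?thesis by (simp add: e_eq)
  qed
  have eh: "norm (e x - e y) \<le> 4 * (\<theta> * d) * sqrt (dist x y)" if x: "norm x \<le> 1" and y: "norm y \<le> 1" for x y
  proof -
    let ?m = "\<lambda>s. E x (w x s) - E y (w y s)"
    let ?m' = "\<lambda>s. L x (w x s) (P x - Q x) - L y (w y s) (P y - Q y)"
    have dm: "(?m has_derivative (\<lambda>h. h *\<^sub>R ?m' s)) (at s within {0..1})" if "s \<in> {0..1}" for s
      using has_derivative_diff[OF dw[OF x that] dw[OF y that]] by (simp add: scaleR_diff_right)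
    have "norm (?m 1 - ?m 0) \<le> (4 * (\<theta> * d) * sqrt (dist x y)) * norm (1 - 0 :: real)"
    proof (rule differentiable_bound[of "{0..1}" ?m, OF _ dm])
      fix s :: real assume s: "s \<in> {0..1}"
      have "linear (L x (w x s))" using der[OF x w1[OF x s]] has_derivative_linear by blast
      \<comment> \<open>Either the direction changes at a fixed base point, which costs
        \<open>\<theta>\<close> times the Hoelder bound of \<open>P - Q\<close>, or the base point
        changes, which costs the Lipschitz constant of \<open>L\<close>.\<close>
      then have eq: "?m' s = L x (w x s) ((P x - Q x) - (P y - Q y)) + (L x (w x s) (P y - Q y) - L y (w y s) (P y - Q y))"
        by (simp add: linear_diff)
      have 1: "norm (L x (w x s) ((P x - Q x) - (P y - Q y))) \<le> \<theta> * (d * sqrt (dist x y))"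
        by (rule order_trans[OF Lb[OF x w1[OF x s]] mult_left_mono[OF PQ(2)[OF x y] \<theta>]])
      have "dist (w x s) (w y s) \<le> sqrt (dist x y)"
      proof -
        have "w x s - w y s = (1 - s) *\<^sub>R (Q x - Q y) + s *\<^sub>R (P x - P y)"
          by (simp add: w_def algebra_simps)
        also have "norm \<dots> \<le> (1 - s) * sqrt (dist x y) + s * sqrt (dist x y)"
          using s P(2)[OF x y] Q(2)[OF x y] by (intro norm_triangle_mono) (auto intro!: mult_left_mono)
        finally show ?thesis by (simp add: dist_norm algebra_simps)
      qed
      \<comment> \<open>Here \<open>3 = 2 + 1\<close>, from \<open>dist_le_sqrt_unit_ball\<close>
        and the bound just shown; together with the estimate \<open>1\<close> the total factor is
        4.\<close>
      then have "dist x y + dist (w x s) (w y s) \<le> 3 * sqrt (dist x y)"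
        using dist_le_sqrt_unit_ball[OF x y] by linarith
      then have "\<theta> * (dist x y + dist (w x s) (w y s)) * norm (P y - Q y) \<le> \<theta> * (3 * sqrt (dist x y)) * d"
        using \<theta> PQ(1)[OF y] by (intro mult_mono mult_nonneg_nonneg add_nonneg_nonneg) auto
      then have 2: "norm (L x (w x s) (P y - Q y) - L y (w y s) (P y - Q y)) \<le> \<theta> * (3 * sqrt (dist x y)) * d"
        by (rule order_trans[OF Ll[OF x w1[OF x s] y w1[OF y s]]])
      have "norm (?m' s) \<le> \<theta> * (d * sqrt (dist x y)) + \<theta> * (3 * sqrt (dist x y)) * d"
        unfolding eq using 1 2 by (rule norm_triangle_mono)
      then have b: "norm (?m' s) \<le> 4 * (\<theta> * d) * sqrt (dist x y)" by (simp add: algebra_simps)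
      show "onorm (\<lambda>h. h *\<^sub>R ?m' s) \<le> 4 * (\<theta> * d) * sqrt (dist x y)"
        by (rule onorm_bound)
           (use b \<theta> d in \<open>auto simp: mult.commute[of "4 * (\<theta> * d) * sqrt (dist x y)"] intro!: mult_left_mono\<close>)
    qed auto
    moreover have "e x - e y = ?m 1 - ?m 0" by (simp add: e_eq)
    ultimately show ?thesis by simp
  qed
  have "holder_density (\<lambda>y. if norm y \<le> 1 then (- cutoff y / c) *\<^sub>R e y else 0) (6 / c * (\<theta> * d))"
    by (rule holder_density_cutoff[OF c _ eb eh]) (use \<theta> d in simp)
  moreover have "(\<lambda>y. superposition c E P y - superposition c E Q y) = (\<lambda>y. if norm y \<le> 1 then (- cutoff y / c) *\<^sub>R e y else 0)"
    by (rule ext) (simp add: superposition_def e_def scaleR_diff_right)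
  ultimately show ?thesis by simp
qed

section \<open>The fixed point by successive approximation\<close>

context kernel
begin

lemma fixed_point:
  obtains \<theta>0 K where "\<theta>0 > 0" "K > 0"
    "\<And>\<theta> E L. \<theta> \<le> \<theta>0 \<Longrightarrow> small_perturbation \<theta> E L \<Longrightarrow>
      \<exists>F. holder_density F (K * \<theta>) \<and> F = superposition mass E (V F) \<and>
        (\<forall>y. norm y \<le> 1 \<longrightarrow> norm (V F y) \<le> min 1 (K * \<theta>))"
proof -
  obtain K where K: "K > 0"
    and Vb: "\<And>F M x. holder_density F M \<Longrightarrow> norm x \<le> 1 \<Longrightarrow> norm (V F x) \<le> K * M"
    and Vh: "\<And>F M x y. holder_density F M \<Longrightarrow> norm x \<le> 1 \<Longrightarrow> norm y \<le> 1 \<Longrightarrow>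
      norm (V F x - V F y) \<le> K * M * sqrt (dist x y)"
    by (rule V_bounds) blast
  define C where "C = 6 / mass"
  have C: "C > 0" using mass_pos by (simp add: C_def)
  \<comment> \<open>Chosen so that \<open>K * (2 * B) \<le> 1\<close> below, where \<open>B\<close>
    is the size of the first iterate. This keeps \<open>norm (V F y) \<le> 1\<close> along the
    iteration and makes the map contract by the factor 1/2.\<close>
  define \<theta>0 where "\<theta>0 = 1 / (2 * K * C)"
  show thesis
  proof (rule that[of \<theta>0 "2 * C + 2 * K * C"])
    show "\<theta>0 > 0" "2 * C + 2 * K * C > 0" using K C by (auto simp: \<theta>0_def add_pos_pos)
    fix \<theta> :: real and E :: "'a \<Rightarrow> 'a \<Rightarrow> 'a" and L
    assume th: "\<theta> \<le> \<theta>0" and E: "small_perturbation \<theta> E L"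
    have \<theta>: "\<theta> \<ge> 0" using E by (simp add: small_perturbation_def)
    define B where "B = C * \<theta>"
    have B: "B \<ge> 0" using C \<theta> by (simp add: B_def)
    have KB: "K * (2 * B) \<le> 1"
    proof -
      have "\<theta> * (2 * K * C) \<le> \<theta>0 * (2 * K * C)" using th K C by (intro mult_right_mono) auto
      then show ?thesis using K C by (simp add: B_def \<theta>0_def mult_ac)
    qed
    define T where "T F = superposition mass E (V F)" for F
    have Tdiff: "holder_density (\<lambda>y. T F y - T G y) (B * (K * D))"
      if F: "holder_density F (2 * B)" and G: "holder_density G (2 * B)" and FG: "holder_density (\<lambda>y. F y - G y) D" for F G D
    proof -
      have D: "D \<ge> 0" using FG by (simp add: holder_density_def)
      have one: "norm (V H y) \<le> 1" "norm (V H x - V H y) \<le> sqrt (dist x y)"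
        if "holder_density H (2 * B)" "norm x \<le> 1" "norm y \<le> 1" for H x y
      proof -
        show "norm (V H y) \<le> 1" using Vb[OF that(1,3)] KB by linarith
        have "K * (2 * B) * sqrt (dist x y) \<le> 1 * sqrt (dist x y)" using KB by (intro mult_right_mono) auto
        then show "norm (V H x - V H y) \<le> sqrt (dist x y)" using Vh[OF that] by linarith
      qed
      have "holder_density (\<lambda>y. superposition mass E (V F) y - superposition mass E (V G) y) (6 / mass * (\<theta> * (K * D)))"
      proof (rule superposition_diff[OF E mass_pos])
        show "0 \<le> K * D" using K D by simp
        show "norm (V F y - V G y) \<le> K * D" if "norm y \<le> 1" for y
          using Vb[OF FG that] V_diff[OF F G] by simp
        show "norm (V F x - V G x - (V F y - V G y)) \<le> K * D * sqrt (dist x y)" if "norm x \<le> 1" "norm y \<le> 1" for x y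
          using Vh[OF FG that] V_diff[OF F G] by simp
      qed (use one[OF F] one[OF G] in auto)
      then show ?thesis by (simp add: T_def B_def C_def mult_ac)
    qed
    define G where "G = rec_nat (\<lambda>x. 0 :: 'a) (\<lambda>_. T)"
    have G0: "G 0 = (\<lambda>x. 0)" and GS: "G (Suc m) = T (G m)" for m by (simp_all add: G_def)
    have V0: "V (\<lambda>x. 0) y = 0" for y
      using V_diff[OF holder_density_zero holder_density_zero, of y] by simp
    \<comment> \<open>The second bound is the partial sum of the first; it keeps all iterates in the
      ball of radius \<open>2 * B\<close>, where \<open>Tdiff\<close> applies.\<close>
    have G: "holder_density (\<lambda>y. G (Suc m) y - G m y) (B / 2 ^ m) \<and> holder_density (G m) (2 * B - 2 * B / 2 ^ m)" for m
    proof (induction m)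
      case 0
      have "holder_density (T (\<lambda>x. 0)) B"
        using superposition_zero[OF E mass_pos, of "V (\<lambda>x. 0)"] V0 by (simp add: T_def B_def C_def)
      then show ?case using holder_density_zero by (simp add: G0 GS)
    next
      case (Suc m)
      have "holder_density (\<lambda>y. (G (Suc m) y - G m y) + G m y) (B / 2 ^ m + (2 * B - 2 * B / 2 ^ m))"
        using Suc by (intro holder_density_add) auto
      moreover have "B / 2 ^ m + (2 * B - 2 * B / 2 ^ m) = 2 * B - 2 * B / 2 ^ Suc m" by (simp add: field_simps)
      ultimately have 1: "holder_density (G (Suc m)) (2 * B - 2 * B / 2 ^ Suc m)" by simp
      have "holder_density (\<lambda>y. T (G (Suc m)) y - T (G m) y) (B * (K * (B / 2 ^ m)))"
      proof (rule Tdiff)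
        show "holder_density (G (Suc m)) (2 * B)" by (rule holder_density_mono[OF 1]) (use B in simp)
        show "holder_density (G m) (2 * B)" by (rule holder_density_mono[OF conjunct2[OF Suc.IH]]) (use B in simp)
        show "holder_density (\<lambda>y. G (Suc m) y - G m y) (B / 2 ^ m)" using Suc by simp
      qed
      then have "holder_density (\<lambda>y. G (Suc (Suc m)) y - G (Suc m) y) (B * (K * (B / 2 ^ m)))" by (simp add: GS)
      then have "holder_density (\<lambda>y. G (Suc (Suc m)) y - G (Suc m) y) (B / 2 ^ Suc m)"
      proof (rule holder_density_mono)
        have "K * (2 * B) * (B / 2 ^ Suc m) \<le> 1 * (B / 2 ^ Suc m)" using KB B by (intro mult_right_mono) auto
        then show "B * (K * (B / 2 ^ m)) \<le> B / 2 ^ Suc m" by (simp add: mult_ac)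
      qed
      with 1 show ?case by simp
    qed
    have G2: "holder_density (G m) (2 * B)" for m
      by (rule holder_density_mono[OF conjunct2[OF G]]) (use B in simp)
    \<comment> \<open>The limit is taken as a telescoping series, so that sup and Hoelder bounds of
      its tails come from \<open>geometric_tail\<close>.\<close>
    define F where "F x = (\<Sum>j. G (Suc j) x - G j x)" for x
    have tel: "(\<Sum>j<m. G (Suc j) x - G j x) = G m x" for m x
      using sum_lessThan_telescope[of "\<lambda>j. G j x" m] by (simp add: G0)
    have d: "norm (G (Suc j) x - G j x) \<le> B / 2 ^ j" for j x
      using G[of j] by (simp add: holder_density_def)
    have FG: "holder_density (\<lambda>x. F x - G m x) (2 * B / 2 ^ m)" for m
      unfolding holder_density_def
    proof (intro conjI allI impI)
      show "0 \<le> 2 * B / 2 ^ m" using B by simp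
      have z: "G j x = 0" if "norm x > 1" for j x using G2[of j] that by (simp add: holder_density_def)
      show "F x - G m x = 0" if "norm x > 1" for x by (simp add: F_def z[OF that])
      show "norm (F x - G m x) \<le> 2 * B / 2 ^ m" for x
        using geometric_tail(2)[of "\<lambda>j. G (Suc j) x - G j x", OF d, of m] by (simp add: F_def tel)
      show "norm (F x - G m x - (F y - G m y)) \<le> 2 * B / 2 ^ m * sqrt (dist x y)" for x y
      proof -
        let ?a = "\<lambda>j. (G (Suc j) x - G j x) - (G (Suc j) y - G j y)"
        have "norm (?a j) \<le> B * sqrt (dist x y) / 2 ^ j" for j
          using G[of j] by (simp add: holder_density_def)
        note t = geometric_tail(2)[of ?a, OF this, of m]
        have "suminf ?a = F x - F y"
          unfolding F_def by (rule suminf_diff[symmetric]) (rule geometric_tail(1)[OF d])+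
        then have "suminf ?a - (\<Sum>j<m. ?a j) = F x - G m x - (F y - G m y)"
          by (simp only: sum_subtractf[of "\<lambda>j. G (Suc j) x - G j x"] tel) simp
        with t show ?thesis by (simp add: mult_ac)
      qed
    qed
    have F2: "holder_density F (2 * B)" using FG[of 0] by (simp add: G0)
    \<comment> \<open>\<open>T F - F\<close> is compared with
      \<open>T (G m) - G (Suc m) = 0\<close>; the contraction estimate and the tail bound make the
      error a multiple of \<open>1 / 2 ^ m\<close>.\<close>
    have "F x = T F x" for x
    proof -
      have "norm (T F x - F x) \<le> 2 * B * (K * (2 * B) + 1) / 2 ^ m" for m
      proof -
        have 1: "norm (T F x - T (G m) x) \<le> B * (K * (2 * B / 2 ^ m))"
          using Tdiff[OF F2 G2 FG] by (simp add: holder_density_def)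
        have 2: "norm (F x - G (Suc m) x) \<le> 2 * B / 2 ^ Suc m"
          using FG[of "Suc m"] by (simp add: holder_density_def del: power_Suc)
        have "T F x - F x = (T F x - T (G m) x) - (F x - G (Suc m) x)" by (simp add: GS)
        then have "norm (T F x - F x) \<le> norm (T F x - T (G m) x) + norm (F x - G (Suc m) x)"
          by (metis norm_triangle_ineq4)
        also have "\<dots> \<le> B * (K * (2 * B / 2 ^ m)) + 2 * B / 2 ^ Suc m" by (rule add_mono[OF 1 2])
        also have "\<dots> = (B * K * (2 * B) + B) / 2 ^ m" by (simp add: field_simps)
        also have "\<dots> \<le> (2 * B * (K * (2 * B) + 1)) / 2 ^ m"
          using B K by (intro divide_right_mono) (auto simp: algebra_simps)
        finally show ?thesis .
      qed
      moreover have "(\<lambda>m. 2 * B * (K * (2 * B) + 1) / 2 ^ m) \<longlonglongrightarrow> 0" by (rule LIMSEQ_divide_realpow_zero) simp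
      ultimately have "norm (T F x - F x) \<le> 0" by (intro LIMSEQ_le_const) auto
      then show ?thesis by simp
    qed
    then have fixF: "F = superposition mass E (V F)" unfolding T_def[symmetric] by (rule ext)
    have le: "2 * B \<le> (2 * C + 2 * K * C) * \<theta>" "K * (2 * B) \<le> (2 * C + 2 * K * C) * \<theta>"
      using C K \<theta> by (auto simp: B_def algebra_simps)
    have "norm (V F y) \<le> min 1 ((2 * C + 2 * K * C) * \<theta>)" if "norm y \<le> 1" for y
      using Vb[OF F2 that] KB le by linarith
    with fixF holder_density_mono[OF F2 le(1)]
    show "\<exists>F. holder_density F ((2 * C + 2 * K * C) * \<theta>) \<and> F = superposition mass E (V F) \<and>
        (\<forall>y. norm y \<le> 1 \<longrightarrow> norm (V F y) \<le> min 1 ((2 * C + 2 * K * C) * \<theta>))" by blast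
  qed
qed

end

section \<open>The nonlinear problem on the unit ball and the blow-up\<close>

lemma test_pair_mono: "test_pair \<psi> g r \<Longrightarrow> r \<le> s \<Longrightarrow> test_pair \<psi> g s"
  unfolding test_pair_def by auto

context kernel
begin

text \<open>In the half ball the cutoff is 1, so the fixed point gives
  \<open>div (V F) + div (E x (V F x)) = div (V F) - mass * div F = 0\<close> weakly; hence test
  pairs of radius \<open>1/2\<close>. Smallness of \<open>v\<close> follows from
  \<open>N (W x)\<close> being its gradient and from a bound of order \<open>\<theta>\<close> on
  \<open>W\<close>.\<close>

lemma local_solution:
  assumes \<delta>: "\<delta> > 0"
  obtains \<theta> where "\<theta> > 0"
    "\<And>E L. small_perturbation \<theta> E L \<Longrightarrow> \<exists>v W. continuous_on UNIV W \<and>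
       (\<forall>x. (v has_derivative (\<lambda>h. N (W x) \<bullet> h)) (at x)) \<and>
       (\<forall>x. norm x \<le> 1 \<longrightarrow> norm (W x) \<le> 1 \<and> \<bar>v x\<bar> \<le> \<delta>) \<and>
       (\<forall>\<psi> g. test_pair \<psi> g (1/2) \<longrightarrow> ((\<lambda>x. (W x + E x (W x)) \<bullet> g x) has_integral 0) unit_box)"
proof -
  obtain \<theta>0 K where \<theta>0: "\<theta>0 > 0" and K: "K > 0"
    and fp: "\<And>\<theta> E L. \<theta> \<le> \<theta>0 \<Longrightarrow> small_perturbation \<theta> E L \<Longrightarrow>
      \<exists>F. holder_density F (K * \<theta>) \<and> F = superposition mass E (V F) \<and>
        (\<forall>y. norm y \<le> 1 \<longrightarrow> norm (V F y) \<le> min 1 (K * \<theta>))"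
    by (rule fixed_point) blast
  obtain B where B: "B > 0" "\<And>x. norm (N x) \<le> norm x * B"
    using bounded_linear.pos_bounded[OF bounded_linear_N] by blast
  \<comment> \<open>The second entry makes \<open>norm (N (V F z)) \<le> \<delta>\<close> on the
    unit ball, so a potential normalised at the origin is bounded by \<open>\<delta>\<close>
    there.\<close>
  define \<theta> where "\<theta> = min \<theta>0 (\<delta> / (K * B))"
  have \<theta>: "\<theta> > 0" "\<theta> \<le> \<theta>0" using \<theta>0 \<delta> K B by (auto simp: \<theta>_def)
  have "\<theta> * (K * B) \<le> \<delta> / (K * B) * (K * B)" using K B by (intro mult_right_mono) (auto simp: \<theta>_def)
  then have \<theta>\<delta>: "K * \<theta> * B \<le> \<delta>" using K B by (simp add: mult_ac)
  show thesis
  proof (rule that[OF \<theta>(1)])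
    fix E :: "'a \<Rightarrow> 'a \<Rightarrow> 'a" and L assume E: "small_perturbation \<theta> E L"
    obtain F where F: "holder_density F (K * \<theta>)" and fix': "F = superposition mass E (V F)"
      and b: "\<And>y. norm y \<le> 1 \<Longrightarrow> norm (V F y) \<le> min 1 (K * \<theta>)"
      using fp[OF \<theta>(2) E] by blast
    obtain v where v: "\<And>x. (v has_derivative (\<lambda>h. N (V F x) \<bullet> h)) (at x)"
      using V_potential[OF F] by blast
    note cF = holder_density_continuous[OF F] and cV = continuous_on_V[OF F]
    have vb: "\<bar>v x - v 0\<bar> \<le> \<delta>" if "norm x \<le> 1" for x
    proof -
      have "norm (v x - v 0) \<le> \<delta> * norm (x - 0)"
      proof (rule differentiable_bound[OF convex_cball[of 0 1] has_derivative_at_withinI[OF v]])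
        fix z :: 'a assume "z \<in> cball 0 1"
        then have "norm (V F z) * B \<le> K * \<theta> * B" using b[of z] B by (intro mult_right_mono) auto
        then have "norm (N (V F z)) \<le> \<delta>" using B(2)[of "V F z"] \<theta>\<delta> by linarith
        then have "norm (N (V F z)) * norm h \<le> \<delta> * norm h" for h by (rule mult_right_mono) simp
        then have "norm (N (V F z) \<bullet> h) \<le> \<delta> * norm h" for h
          using Cauchy_Schwarz_ineq2 order_trans unfolding real_norm_def by blast
        then show "onorm (\<lambda>h. N (V F z) \<bullet> h) \<le> \<delta>" by (rule onorm_le)
      qed (use that in auto)
      also have "\<dots> \<le> \<delta>" using that \<delta> by (simp add: mult_left_le)
      finally show ?thesis by simp
    qed
    have weak: "((\<lambda>x. (V F x + E x (V F x)) \<bullet> g x) has_integral 0) unit_box" if tp: "test_pair \<psi> g (1/2)" for \<psi> g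
    proof -
      have tp1: "test_pair \<psi> g 1" by (rule test_pair_mono[OF tp]) simp
      note cg = test_pair_continuous(1)[OF tp]
      note c' = continuous_on_subset[OF cV subset_UNIV] continuous_on_subset[OF cg subset_UNIV]
      have "((\<lambda>x. V F x \<bullet> g x - mass * (F x \<bullet> g x)) has_integral
          (integral unit_box (\<lambda>x. V F x \<bullet> g x) - mass * integral unit_box (\<lambda>x. F x \<bullet> g x))) unit_box"
        by (intro has_integral_diff has_integral_mult_right integrable_integral integrable_continuous continuous_intros c' cF)
      then have 1: "((\<lambda>x. V F x \<bullet> g x - mass * (F x \<bullet> g x)) has_integral 0) unit_box"
        by (simp add: V_weak[OF F tp1])
      have "V F x \<bullet> g x - mass * (F x \<bullet> g x) = (V F x + E x (V F x)) \<bullet> g x" for x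
      proof (cases "norm x > 1/2")
        case True
        then show ?thesis using test_pair_gradient_zero[OF tp] by simp
      next
        case False
        then have "F x = (- 1 / mass) *\<^sub>R E x (V F x)"
          by (subst fix') (simp add: superposition_def cutoff_eq_1)
        then have "mass *\<^sub>R F x = - E x (V F x)" using mass_pos by simp
        then have "mass * (F x \<bullet> g x) = - (E x (V F x) \<bullet> g x)" by (metis inner_minus_left inner_scaleR_left)
        then show ?thesis by (simp add: inner_add_left)
      qed
      with 1 show ?thesis by simp
    qed
    show "\<exists>v W. continuous_on UNIV W \<and>
       (\<forall>x. (v has_derivative (\<lambda>h. N (W x) \<bullet> h)) (at x)) \<and>
       (\<forall>x. norm x \<le> 1 \<longrightarrow> norm (W x) \<le> 1 \<and> \<bar>v x\<bar> \<le> \<delta>) \<and>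
       (\<forall>\<psi> g. test_pair \<psi> g (1/2) \<longrightarrow> ((\<lambda>x. (W x + E x (W x)) \<bullet> g x) has_integral 0) unit_box)"
    proof (intro exI[of _ "\<lambda>x. v x - v 0"] exI[of _ "V F"] conjI allI impI)
      show "((\<lambda>x. v x - v 0) has_derivative (\<lambda>h. N (V F x) \<bullet> h)) (at x)" for x
        using has_derivative_diff[OF v[of x] has_derivative_const[of "v 0"]] by simp
    qed (use cV b vb weak in auto)
  qed
qed

text \<open>Freezing the coefficients at \<open>(x0, \<xi>0)\<close> and blowing up \<open>x = x0 + r y\<close> turns a field that is
  strictly differentiable at \<open>(x0, \<xi>0)\<close> into a small perturbation of its linearisation. The trace
  condition says that the quadratic polynomial solves the linearised equation.\<close>

lemma quadratic_approximate_solution: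
  fixes A :: "'a \<Rightarrow> 'a \<Rightarrow> 'a" and D :: "'a \<Rightarrow> 'a \<Rightarrow> 'a \<Rightarrow> 'a" and Ax M B :: "'a \<Rightarrow> 'a"
  assumes strict: "\<And>e. e > 0 \<Longrightarrow> \<exists>\<rho>>0. \<forall>x x' z z'. dist x x0 < \<rho> \<longrightarrow> dist x' x0 < \<rho> \<longrightarrow> dist z \<xi>0 < \<rho> \<longrightarrow> dist z' \<xi>0 < \<rho> \<longrightarrow>
      norm (A x z - A x' z' - Ax (x - x') - M (z - z')) \<le> e * (dist x x' + dist z z')"
    and \<rho>: "\<rho> > 0"
    and der: "\<And>x z. dist x x0 < \<rho> \<Longrightarrow> dist z \<xi>0 < \<rho> \<Longrightarrow> (A x has_derivative D x z) (at z)"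
    and lip: "\<And>x z x' z' h. dist x x0 < \<rho> \<Longrightarrow> dist z \<xi>0 < \<rho> \<Longrightarrow> dist x' x0 < \<rho> \<Longrightarrow> dist z' \<xi>0 < \<rho> \<Longrightarrow>
      norm (D x z h - D x' z' h) \<le> C * (dist x x' + dist z z') * norm h"
    and D0: "\<And>h. D x0 \<xi>0 h = M h" and MN: "\<And>h. M (N h) = h"
    and lin: "linear Ax" "linear M" "linear B" and symB: "\<And>x y. B x \<bullet> y = B y \<bullet> x"
    and trace: "(\<Sum>b\<in>Basis. (Ax b + M (B b)) \<bullet> b) = 0"
    and \<delta>: "\<delta> > 0" and s: "s > 0"
  shows "\<exists>r0>0. \<forall>r. 0 < r \<longrightarrow> r < r0 \<longrightarrow> (\<exists>h G. continuous_on UNIV G \<and>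
      (\<forall>x. (h has_derivative (\<lambda>k. G x \<bullet> k)) (at x)) \<and>
      (\<forall>x\<in>cball x0 r. dist (G x) \<xi>0 < s \<and>
         \<bar>h x - (c0 + \<xi>0 \<bullet> (x - x0) + B (x - x0) \<bullet> (x - x0) / 2)\<bar> \<le> \<delta> * r\<^sup>2) \<and>
      (\<forall>\<psi> g. test_pair (\<lambda>y. \<psi> (x0 + r *\<^sub>R y)) (\<lambda>y. r *\<^sub>R g (x0 + r *\<^sub>R y)) (1/2) \<longrightarrow>
         ((\<lambda>x. A x (G x) \<bullet> g x) has_integral 0) UNIV))"
proof -
  obtain bN where bN: "bN > 0" "\<And>x. norm (N x) \<le> norm x * bN"
    using bounded_linear.pos_bounded[OF bounded_linear_N] by blast
  have blB: "bounded_linear B" using lin(3) linear_conv_bounded_linear by blast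
  obtain bB where bB: "bB > 0" "\<And>x. norm (B x) \<le> norm x * bB"
    using bounded_linear.pos_bounded[OF blB] by blast
  define \<kappa> where "\<kappa> = 1 + bB + bN"
  have \<kappa>: "\<kappa> > 1" using bN bB by (simp add: \<kappa>_def)
  obtain \<theta> where \<theta>: "\<theta> > 0" and sol:
    "\<And>E L. small_perturbation \<theta> E L \<Longrightarrow> \<exists>v W. continuous_on UNIV W \<and>
       (\<forall>x. (v has_derivative (\<lambda>h. N (W x) \<bullet> h)) (at x)) \<and>
       (\<forall>x. norm x \<le> 1 \<longrightarrow> norm (W x) \<le> 1 \<and> \<bar>v x\<bar> \<le> \<delta>) \<and>
       (\<forall>\<psi> g. test_pair \<psi> g (1/2) \<longrightarrow> ((\<lambda>x. (W x + E x (W x)) \<bullet> g x) has_integral 0) unit_box)"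
    by (rule local_solution[OF \<delta>]) blast
  have "\<theta> / (1 + bB) > 0" using \<theta> bB by simp
  from strict[OF this] obtain \<rho>1 where \<rho>1: "\<rho>1 > 0" and st:
    "\<And>x x' z z'. dist x x0 < \<rho>1 \<Longrightarrow> dist x' x0 < \<rho>1 \<Longrightarrow> dist z \<xi>0 < \<rho>1 \<Longrightarrow> dist z' \<xi>0 < \<rho>1 \<Longrightarrow>
      norm (A x z - A x' z' - Ax (x - x') - M (z - z')) \<le> \<theta> / (1 + bB) * (dist x x' + dist z z')"
    by blast
  define C' where "C' = \<bar>C\<bar> + 1"
  have C': "C' > 0" "C \<le> C'" by (auto simp: C'_def)
  \<comment> \<open>In order: the range of \<open>der\<close> and \<open>lip\<close>, the range of
    the two-point estimate \<open>st\<close>, closeness of the gradient to \<open>\<xi>0\<close>,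
    and smallness of the variation of \<open>D\<close> against \<open>\<theta>\<close>.\<close>
  define r0 where "r0 = min (min (\<rho> / \<kappa>) (\<rho>1 / \<kappa>)) (min (s / \<kappa>) (\<theta> / (C' * \<kappa> * bN)))"
  have r0: "r0 > 0" using \<rho> \<rho>1 \<kappa> s \<theta> C' bN by (simp add: r0_def)
  show ?thesis
  proof (intro exI[of _ r0] conjI r0 allI impI)
    fix r assume r: "0 < r" "r < r0"
    have rk: "r * \<kappa> < \<rho>" "r * \<kappa> < \<rho>1" "r * \<kappa> < s"
      using r \<kappa> by (auto simp: r0_def pos_less_divide_eq)
    have rth: "C' * (r * \<kappa>) * bN \<le> \<theta>"
    proof -
      have "r < \<theta> / (C' * \<kappa> * bN)" using r by (simp add: r0_def)
      then show ?thesis using C' \<kappa> bN by (simp add: pos_less_divide_eq mult_ac)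
    qed
    have r\<kappa>: "r \<le> r * \<kappa>" using r \<kappa> by simp
    define X where "X y = x0 + r *\<^sub>R y" for y
    \<comment> \<open>With \<open>z = W y\<close> this is the gradient at \<open>X y\<close> of the
      quadratic polynomial corrected by \<open>r\<^sup>2\<close> times the rescaled
      potential.\<close>
    define Z where "Z y z = \<xi>0 + r *\<^sub>R (B y + N z)" for y z
    have X: "dist (X y) x0 \<le> r * \<kappa>" if "norm y \<le> 1" for y
    proof -
      have "r * norm y \<le> r * 1" using r that by (intro mult_left_mono) auto
      then show ?thesis using r r\<kappa> by (simp add: X_def dist_norm)
    qed
    have Z: "dist (Z y z) \<xi>0 \<le> r * \<kappa>" if "norm y \<le> 1" "norm z \<le> 1" for y z
    proof -
      have "norm y * bB \<le> 1 * bB" "norm z * bN \<le> 1 * bN" using that bN bB by (intro mult_right_mono; simp)+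
      then have "norm (B y + N z) \<le> \<kappa>"
        using norm_triangle_ineq[of "B y" "N z"] bB(2)[of y] bN(2)[of z] by (simp add: \<kappa>_def)
      then have "r * norm (B y + N z) \<le> r * \<kappa>" using r by (intro mult_left_mono) auto
      then show ?thesis using r by (simp add: Z_def dist_norm)
    qed
    \<comment> \<open>The remainder in \<open>A (X y) (Z y z) = A x0 \<xi>0 + r *\<^sub>R (z + Ax y
      + M (B y) + E y z)\<close>. Since \<open>M (N z) = z\<close>, the linear part in
      \<open>z\<close> is the identity.\<close>
    define E where "E y z = (1 / r) *\<^sub>R (A (X y) (Z y z) - A x0 \<xi>0) - z - (Ax y + M (B y))" for y z
    define L where "L y z h = D (X y) (Z y z) (N h) - h" for y z h
    have "small_perturbation \<theta> E L"
      unfolding small_perturbation_def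
    proof (intro conjI allI impI)
      show "0 \<le> \<theta>" using \<theta> by simp
      show "E 0 0 = 0"
        by (simp add: E_def X_def Z_def linear_0[OF lin(1)] linear_0[OF lin(2)] linear_0[OF lin(3)] linear_0[OF linN])
    next
      fix y z :: 'a assume y: "norm y \<le> 1" and z: "norm z \<le> 1"
      have Xr: "dist (X y) x0 < \<rho>" and Zr: "dist (Z y z) \<xi>0 < \<rho>"
        using X[OF y] Z[OF y z] rk by linarith+
      have dA: "(A (X y) has_derivative D (X y) (Z y z)) (at (Z y z))" by (rule der[OF Xr Zr])
      have "(Z y has_derivative (\<lambda>h. r *\<^sub>R N h)) (at z)"
        unfolding Z_def[abs_def]
        by (auto intro!: derivative_eq_intros bounded_linear_imp_has_derivative[OF bounded_linear_N])
      from has_derivative_compose[OF this dA]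
      have "((\<lambda>z. A (X y) (Z y z)) has_derivative (\<lambda>h. D (X y) (Z y z) (r *\<^sub>R N h))) (at z)" .
      then have "(E y has_derivative (\<lambda>h. (1 / r) *\<^sub>R (D (X y) (Z y z) (r *\<^sub>R N h) - 0) - h - 0)) (at z)"
        unfolding E_def[abs_def] by (intro derivative_intros)
      moreover have "linear (D (X y) (Z y z))" using dA has_derivative_linear by blast
      ultimately show "(E y has_derivative L y z) (at z)"
        using r by (simp add: L_def[abs_def] linear_scale)
      show "norm (L y z h) \<le> \<theta> * norm h" for h
      proof -
        \<comment> \<open>The identity subtracted in \<open>L\<close> is \<open>D x0 \<xi>0\<close>
          applied after \<open>N\<close>, so \<open>L\<close> is a difference of derivatives of
          \<open>A\<close> and small by \<open>lip\<close>.\<close>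
        have "L y z h = D (X y) (Z y z) (N h) - D x0 \<xi>0 (N h)" by (simp add: L_def D0 MN)
        also have "norm \<dots> \<le> C * (dist (X y) x0 + dist (Z y z) \<xi>0) * norm (N h)"
          by (rule lip) (use Xr Zr \<rho> in auto)
        also have "dist (X y) x0 + dist (Z y z) \<xi>0 \<le> r * \<kappa>"
        proof -
          have "r * norm y \<le> r * 1" using r y by (intro mult_left_mono) auto
          then have 1: "dist (X y) x0 \<le> r" using r by (simp add: X_def dist_norm)
          have "norm y * bB \<le> 1 * bB" "norm z * bN \<le> 1 * bN" using y z bN bB by (intro mult_right_mono; simp)+
          then have "norm (B y + N z) \<le> bB + bN"
            using norm_triangle_ineq[of "B y" "N z"] bB(2)[of y] bN(2)[of z] by simp
          then have "r * norm (B y + N z) \<le> r * (bB + bN)" using r by (intro mult_left_mono) auto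
          then have "dist (Z y z) \<xi>0 \<le> r * (bB + bN)" using r by (simp add: Z_def dist_norm)
          with 1 show ?thesis by (simp add: \<kappa>_def algebra_simps)
        qed
        then have "C * (dist (X y) x0 + dist (Z y z) \<xi>0) * norm (N h) \<le> C' * (r * \<kappa>) * (norm h * bN)"
          using C' bN(2)[of h] r \<kappa> by (intro mult_mono) (auto intro: mult_nonneg_nonneg add_nonneg_nonneg)
        also have "\<dots> = C' * (r * \<kappa>) * bN * norm h" by simp
        also have "\<dots> \<le> \<theta> * norm h" using rth by (intro mult_right_mono) auto
        finally show ?thesis .
      qed
    next
      fix y z y' z' h :: 'a
      assume y: "norm y \<le> 1" and z: "norm z \<le> 1" and y': "norm y' \<le> 1" and z': "norm z' \<le> 1"
      have "dist (X y) (X y') = r * dist y y'"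
        using r by (simp add: X_def dist_norm flip: scaleR_diff_right)
      moreover have "dist (Z y z) (Z y' z') \<le> r * (bB * dist y y' + bN * dist z z')"
      proof -
        have "Z y z - Z y' z' = r *\<^sub>R (B (y - y') + N (z - z'))"
          by (simp add: Z_def linear_diff[OF lin(3)] linear_diff[OF linN] scaleR_diff_right scaleR_add_right)
        moreover have "norm (B (y - y') + N (z - z')) \<le> bB * dist y y' + bN * dist z z'"
          using bB(2)[of "y - y'"] bN(2)[of "z - z'"] by (intro norm_triangle_mono) (auto simp: dist_norm mult.commute)
        ultimately show ?thesis using r by (simp add: dist_norm)
      qed
      moreover have "bB * dist y y' \<le> (bB + bN) * dist y y'" "bN * dist z z' \<le> \<kappa> * dist z z'"
        using bB bN by (intro mult_right_mono; simp add: \<kappa>_def)+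
      then have "dist y y' + (bB * dist y y' + bN * dist z z') \<le> \<kappa> * (dist y y' + dist z z')"
        by (simp add: \<kappa>_def algebra_simps)
      then have "r * (dist y y' + (bB * dist y y' + bN * dist z z')) \<le> r * (\<kappa> * (dist y y' + dist z z'))"
        using r by (intro mult_left_mono) auto
      ultimately have dd: "dist (X y) (X y') + dist (Z y z) (Z y' z') \<le> r * \<kappa> * (dist y y' + dist z z')"
        by (simp add: distrib_left mult.assoc)
      have "L y z h - L y' z' h = D (X y) (Z y z) (N h) - D (X y') (Z y' z') (N h)" by (simp add: L_def)
      also have "norm \<dots> \<le> C * (dist (X y) (X y') + dist (Z y z) (Z y' z')) * norm (N h)"
        using X[OF y] X[OF y'] Z[OF y z] Z[OF y' z'] rk by (intro lip) linarith+
      also have "\<dots> \<le> C' * (r * \<kappa> * (dist y y' + dist z z')) * (norm h * bN)"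
        using C' bN(2)[of h] r \<kappa> dd by (intro mult_mono) (auto intro: mult_nonneg_nonneg add_nonneg_nonneg)
      also have "\<dots> = C' * (r * \<kappa>) * bN * ((dist y y' + dist z z') * norm h)" by simp
      also have "\<dots> \<le> \<theta> * ((dist y y' + dist z z') * norm h)" using rth by (intro mult_right_mono) auto
      finally show "norm (L y z h - L y' z' h) \<le> \<theta> * (dist y y' + dist z z') * norm h" by (simp add: mult.assoc)
    next
      fix y y' z :: 'a assume y: "norm y \<le> 1" and y': "norm y' \<le> 1" and z: "norm z \<le> 1"
      have dX: "X y - X y' = r *\<^sub>R (y - y')" by (simp add: X_def scaleR_diff_right)
      have dZ: "Z y z - Z y' z = r *\<^sub>R B (y - y')"
        by (simp add: Z_def linear_diff[OF lin(3)] scaleR_diff_right scaleR_add_right)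
      \<comment> \<open>The affine terms subtracted in \<open>E\<close> are the strict derivative
        applied to the increments of \<open>X\<close> and \<open>Z\<close>; the two-point estimate
        \<open>st\<close> then bounds the difference by a small multiple of
        \<open>dist y y'\<close>.\<close>
      have "E y z - E y' z = (1 / r) *\<^sub>R (A (X y) (Z y z) - A (X y') (Z y' z) - Ax (X y - X y') - M (Z y z - Z y' z))"
        using r unfolding dX dZ linear_scale[OF lin(1)] linear_scale[OF lin(2)]
        by (simp add: E_def linear_diff[OF lin(1)] linear_diff[OF lin(2)] linear_diff[OF lin(3)] scaleR_diff_right algebra_simps)
      also have "norm \<dots> = 1 / r * norm (A (X y) (Z y z) - A (X y') (Z y' z) - Ax (X y - X y') - M (Z y z - Z y' z))"
        using r by simp
      also have "\<dots> \<le> 1 / r * (\<theta> / (1 + bB) * (dist (X y) (X y') + dist (Z y z) (Z y' z)))"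
        using X[OF y] X[OF y'] Z[OF y z] Z[OF y' z] rk r by (intro mult_left_mono st) auto
      also have "\<dots> \<le> 1 / r * (\<theta> / (1 + bB) * (r * ((1 + bB) * dist y y')))"
      proof -
        have "norm (B (y - y')) \<le> bB * dist y y'" using bB(2)[of "y - y'"] by (simp add: dist_norm mult.commute)
        then have "r * norm (B (y - y')) \<le> r * (bB * dist y y')" using r by (intro mult_left_mono) auto
        then have "dist (X y) (X y') + dist (Z y z) (Z y' z) \<le> r * ((1 + bB) * dist y y')"
          unfolding dist_norm dX dZ norm_scaleR using r by (simp add: distrib_left distrib_right)
        then show ?thesis using r \<theta> bB by (intro mult_left_mono) auto
      qed
      also have "\<dots> = \<theta> * dist y y'"
      proof -
        have "1 + bB \<noteq> 0" "r \<noteq> 0" using bB(1) r by auto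
        then show ?thesis by simp
      qed
      finally show "norm (E y z - E y' z) \<le> \<theta> * dist y y'" .
    qed
    from sol[OF this] obtain v W where cW: "continuous_on UNIV W"
      and v: "\<And>x. (v has_derivative (\<lambda>h. N (W x) \<bullet> h)) (at x)"
      and W1: "\<And>x. norm x \<le> 1 \<Longrightarrow> norm (W x) \<le> 1" and vb: "\<And>x. norm x \<le> 1 \<Longrightarrow> \<bar>v x\<bar> \<le> \<delta>"
      and weak: "\<And>\<psi> g. test_pair \<psi> g (1/2) \<Longrightarrow> ((\<lambda>x. (W x + E x (W x)) \<bullet> g x) has_integral 0) unit_box"
      by blast
    define Y where "Y x = (1 / r) *\<^sub>R (x - x0)" for x
    have XY: "X (Y x) = x" for x using r by (simp add: X_def Y_def)
    \<comment> \<open>The correction \<open>r\<^sup>2 * v (Y x)\<close> is of the order of the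
      allowed error, while its gradient is only of order \<open>r\<close>.\<close>
    define h where "h x = c0 + \<xi>0 \<bullet> (x - x0) + B (x - x0) \<bullet> (x - x0) / 2 + r\<^sup>2 * v (Y x)" for x
    define G where "G x = Z (Y x) (W (Y x))" for x
    have Y1: "norm (Y x) \<le> 1" if "x \<in> cball x0 r" for x
      using that r by (simp add: Y_def dist_norm norm_minus_commute)
    have G_alt: "G x = \<xi>0 + B (x - x0) + r *\<^sub>R N (W (Y x))" for x
    proof -
      have "r *\<^sub>R B (Y x) = B (r *\<^sub>R Y x)" by (simp only: linear_scale[OF lin(3)])
      then show ?thesis using r by (simp add: G_def Z_def scaleR_add_right Y_def add.assoc)
    qed
    have cWY: "continuous_on UNIV (\<lambda>x. W (Y x))"
      by (rule continuous_on_compose2[OF cW]) (auto simp: Y_def intro!: continuous_intros)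
    have cG: "continuous_on UNIV G"
      unfolding G_alt by (intro continuous_intros cWY bounded_linear.continuous_on[OF blB])
    have dh: "(h has_derivative (\<lambda>k. G x \<bullet> k)) (at x)" for x
    proof -
      have dY: "(Y has_derivative (\<lambda>k. (1 / r) *\<^sub>R k)) (at x)"
        unfolding Y_def[abs_def] by (auto intro!: derivative_eq_intros)
      have dvY: "((\<lambda>x. v (Y x)) has_derivative (\<lambda>k. N (W (Y x)) \<bullet> ((1 / r) *\<^sub>R k))) (at x)"
        by (rule has_derivative_compose[OF dY v])
      have dB: "((\<lambda>x. B (x - x0)) has_derivative B) (at x)"
        by (rule bounded_linear.has_derivative[OF blB]) (auto intro!: derivative_eq_intros)
      have "(h has_derivative (\<lambda>k. \<xi>0 \<bullet> k + (B (x - x0) \<bullet> k + B k \<bullet> (x - x0)) / 2 + r\<^sup>2 * (N (W (Y x)) \<bullet> ((1 / r) *\<^sub>R k)))) (at x)"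
        unfolding h_def[abs_def] by (auto intro!: derivative_eq_intros dvY dB)
      moreover have "\<xi>0 \<bullet> k + (B (x - x0) \<bullet> k + B k \<bullet> (x - x0)) / 2 + r\<^sup>2 * (N (W (Y x)) \<bullet> ((1 / r) *\<^sub>R k)) = G x \<bullet> k" for k
        using r symB[of k "x - x0"] by (simp add: G_alt inner_add_left power2_eq_square)
      ultimately show ?thesis by simp
    qed
    have "((\<lambda>x. A x (G x) \<bullet> g x) has_integral 0) UNIV"
      if tp: "test_pair (\<lambda>y. \<psi> (x0 + r *\<^sub>R y)) (\<lambda>y. r *\<^sub>R g (x0 + r *\<^sub>R y)) (1/2)" for \<psi> g
    proof -
      let ?\<psi> = "\<lambda>y. \<psi> (X y)" and ?g = "\<lambda>y. r *\<^sub>R g (X y)"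
      have tp: "test_pair ?\<psi> ?g (1/2)" using tp by (simp add: X_def)
      note cg = test_pair_continuous(1)[OF tp]
      have g0: "?g y = 0" if "norm y > 1/2" for y using test_pair_gradient_zero[OF tp that] .
      define P where "P y = A x0 \<xi>0 + r *\<^sub>R (Ax y + M (B y))" for y
      have bl: "bounded_linear (\<lambda>y. Ax y + M (B y))"
        using lin linear_conv_bounded_linear by (intro bounded_linear_add bounded_linear_compose[of M B]) blast+
      have dP: "(P has_derivative (\<lambda>k. r *\<^sub>R (Ax k + M (B k)))) (at y)" for y
      proof -
        have "(P has_derivative (\<lambda>k. 0 + r *\<^sub>R (Ax k + M (B k)))) (at y)"
          unfolding P_def[abs_def]
          by (intro has_derivative_add has_derivative_const has_derivative_scaleR_right bounded_linear_imp_has_derivative[OF bl])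
        then show ?thesis by simp
      qed
      have cP: "continuous_on S P" for S
        unfolding P_def[abs_def] by (intro continuous_intros bounded_linear.continuous_on[OF bl])
      \<comment> \<open>The affine part has constant divergence \<open>r\<close> times the trace,
        which is zero; what remains is the weak equation supplied by
        \<open>local_solution\<close>.\<close>
      have "integral UNIV (\<lambda>y. P y \<bullet> ?g y) = - integral UNIV (\<lambda>y. ?\<psi> y * (\<Sum>b\<in>Basis. (r *\<^sub>R (Ax b + M (B b))) \<bullet> b))"
        by (rule integral_by_parts_divergence[OF tp dP continuous_on_const])
      also have "(\<Sum>b\<in>Basis. (r *\<^sub>R (Ax b + M (B b))) \<bullet> b) = 0"
        using trace by (simp only: inner_scaleR_left sum_distrib_left[symmetric] mult_zero_right)
      finally have "integral UNIV (\<lambda>y. P y \<bullet> ?g y) = 0" by simp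
      moreover have cPg: "continuous_on UNIV (\<lambda>y. P y \<bullet> ?g y)" by (intro continuous_intros cP cg)
      moreover have "integral UNIV (\<lambda>y. P y \<bullet> ?g y) = integral unit_box (\<lambda>y. P y \<bullet> ?g y)"
        by (rule integral_unit_box(1)[OF cPg], subst g0) auto
      ultimately have "((\<lambda>y. P y \<bullet> ?g y) has_integral 0) unit_box"
        using integrable_integral[OF integrable_continuous[OF continuous_on_subset[OF cPg subset_UNIV]]] by metis
      from has_integral_add[OF this has_integral_mult_right[OF weak[OF tp], of r]]
      have "((\<lambda>y. P y \<bullet> ?g y + r * ((W y + E y (W y)) \<bullet> ?g y)) has_integral 0) unit_box" by simp
      moreover have "P y \<bullet> ?g y + r * ((W y + E y (W y)) \<bullet> ?g y) = r * (A (X y) (Z y (W y)) \<bullet> g (X y))" for y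
      proof -
        have "P y + r *\<^sub>R (W y + E y (W y)) = A (X y) (Z y (W y))"
          using r by (simp add: P_def E_def scaleR_add_right scaleR_diff_right)
        then have "(P y + r *\<^sub>R (W y + E y (W y))) \<bullet> ?g y = A (X y) (Z y (W y)) \<bullet> ?g y" by simp
        then show ?thesis by (simp only: inner_add_left inner_scaleR_left inner_scaleR_right distrib_left)
      qed
      ultimately have "((\<lambda>y. r * (A (X y) (Z y (W y)) \<bullet> g (X y))) has_integral 0) unit_box" by simp
      from has_integral_mult_right[OF this, of "1 / r"] r
      have "((\<lambda>y. A (X y) (Z y (W y)) \<bullet> g (X y)) has_integral 0) unit_box" by simp
      \<comment> \<open>Change of variables back to \<open>x\<close>: the unit box becomes the box
        centred at \<open>x0\<close> with half side \<open>r\<close>.\<close>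
      from has_integral_affinity'[OF this, of "1 / r" "- (1 / r) *\<^sub>R x0"] r
      have "((\<lambda>x. A (X (Y x)) (Z (Y x) (W (Y x))) \<bullet> g (X (Y x))) has_integral 0)
          (cbox (((- One) - (- (1 / r) *\<^sub>R x0)) /\<^sub>R (1 / r)) ((One - (- (1 / r) *\<^sub>R x0)) /\<^sub>R (1 / r)))"
        by (simp add: Y_def scaleR_diff_right)
      then have hi: "((\<lambda>x. A x (G x) \<bullet> g x) has_integral 0)
          (cbox (((- One) - (- (1 / r) *\<^sub>R x0)) /\<^sub>R (1 / r)) ((One - (- (1 / r) *\<^sub>R x0)) /\<^sub>R (1 / r)))"
        by (simp add: XY G_def)
      show ?thesis
      proof (rule has_integral_on_superset[OF hi])
        fix x assume "x \<notin> cbox (((- One) - (- (1 / r) *\<^sub>R x0)) /\<^sub>R (1 / r)) ((One - (- (1 / r) *\<^sub>R x0)) /\<^sub>R (1 / r))"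
        moreover have "((- One) - (- (1 / r) *\<^sub>R x0)) /\<^sub>R (1 / r) = x0 - r *\<^sub>R One"
          "(One - (- (1 / r) *\<^sub>R x0)) /\<^sub>R (1 / r) = x0 + r *\<^sub>R One"
          using r by (simp_all add: algebra_simps)
        ultimately have "dist x0 x > r" by (intro outside_centered_cbox) simp
        moreover have "norm (Y x) = dist x0 x / r" using r by (simp only: Y_def norm_scaleR dist_norm norm_minus_commute) simp
        ultimately have "norm (Y x) > 1" using r by simp
        then have "?g (Y x) = 0" by (intro g0) simp
        then show "A x (G x) \<bullet> g x = 0" using r by (simp add: XY)
      qed simp
    qed
    then show "\<exists>h G. continuous_on UNIV G \<and>
      (\<forall>x. (h has_derivative (\<lambda>k. G x \<bullet> k)) (at x)) \<and>
      (\<forall>x\<in>cball x0 r. dist (G x) \<xi>0 < s \<and>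
         \<bar>h x - (c0 + \<xi>0 \<bullet> (x - x0) + B (x - x0) \<bullet> (x - x0) / 2)\<bar> \<le> \<delta> * r\<^sup>2) \<and>
      (\<forall>\<psi> g. test_pair (\<lambda>y. \<psi> (x0 + r *\<^sub>R y)) (\<lambda>y. r *\<^sub>R g (x0 + r *\<^sub>R y)) (1/2) \<longrightarrow>
         ((\<lambda>x. A x (G x) \<bullet> g x) has_integral 0) UNIV)"
    proof (intro exI[of _ h] exI[of _ G] conjI allI ballI impI cG dh)
      fix x assume x: "x \<in> cball x0 r"
      show "dist (G x) \<xi>0 < s"
        using Z[OF Y1[OF x] W1[OF Y1[OF x]]] rk(3) by (simp add: G_def)
      have "h x - (c0 + \<xi>0 \<bullet> (x - x0) + B (x - x0) \<bullet> (x - x0) / 2) = r\<^sup>2 * v (Y x)" by (simp add: h_def)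
      moreover have "r\<^sup>2 * \<bar>v (Y x)\<bar> \<le> r\<^sup>2 * \<delta>" using vb[OF Y1[OF x]] by (intro mult_left_mono) auto
      ultimately show "\<bar>h x - (c0 + \<xi>0 \<bullet> (x - x0) + B (x - x0) \<bullet> (x - x0) / 2)\<bar> \<le> \<delta> * r\<^sup>2"
        by (simp add: abs_mult mult.commute)
    qed blast
  qed
qed

end

section \<open>Strict differentiability and the double phase field\<close>

lemma Ck_1_iff:
  fixes f :: "'a::euclidean_space \<Rightarrow> real"
  shows "Ck 1 S f \<longleftrightarrow> (\<forall>x\<in>S. f differentiable (at x)) \<and>
     (\<forall>b\<in>Basis. continuous_on S (\<lambda>x. frechet_derivative f (at x) b))"
  by (simp add: One_nat_def)

lemma has_derivative_gradient:
  fixes f :: "'a::euclidean_space \<Rightarrow> real"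
  assumes "f differentiable (at x)"
  shows "(f has_derivative (\<lambda>h. gradient f x \<bullet> h)) (at x)"
proof -
  have d: "(f has_derivative frechet_derivative f (at x)) (at x)"
    using assms frechet_derivative_works by blast
  then have lin: "linear (frechet_derivative f (at x))" by (rule has_derivative_linear)
  have "frechet_derivative f (at x) h = gradient f x \<bullet> h" for h
  proof -
    have "frechet_derivative f (at x) h = frechet_derivative f (at x) (\<Sum>b\<in>Basis. (h \<bullet> b) *\<^sub>R b)"
      by (simp only: euclidean_representation)
    also have "\<dots> = (\<Sum>b\<in>Basis. (h \<bullet> b) * frechet_derivative f (at x) b)"
      by (simp only: linear_sum[OF lin] linear_scale[OF lin] real_scaleR_def)
    also have "\<dots> = gradient f x \<bullet> h"
      unfolding gradient_def inner_sum_left inner_scaleR_left by (simp only: inner_commute mult.commute)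
    finally show ?thesis .
  qed
  then have "frechet_derivative f (at x) = (\<lambda>h. gradient f x \<bullet> h)" by (rule ext)
  with d show ?thesis by (simp only:)
qed

lemma gradient_unique:
  fixes f :: "'a::euclidean_space \<Rightarrow> real"
  assumes "(f has_derivative (\<lambda>h. g \<bullet> h)) (at x)"
  shows "gradient f x = g"
proof -
  have "frechet_derivative f (at x) = (\<lambda>h. g \<bullet> h)" by (rule frechet_derivative_at[OF assms, symmetric])
  then show ?thesis unfolding gradient_def by (simp only: euclidean_representation)
qed

lemma Ck_1_gradient:
  fixes f :: "'a::euclidean_space \<Rightarrow> real"
  assumes "Ck 1 S f"
  shows "x \<in> S \<Longrightarrow> (f has_derivative (\<lambda>h. gradient f x \<bullet> h)) (at x)"
    and "continuous_on S (gradient f)"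
  using assms unfolding Ck_1_iff gradient_def[abs_def]
  by (auto intro!: has_derivative_gradient[unfolded gradient_def] continuous_intros)

lemma Ck_2_gradient:
  fixes f :: "'a::euclidean_space \<Rightarrow> real"
  assumes "Ck 2 S f" "open S"
  shows "x \<in> S \<Longrightarrow> (f has_derivative (\<lambda>h. gradient f x \<bullet> h)) (at x)"
    and "x \<in> S \<Longrightarrow> (gradient f has_derivative frechet_derivative (gradient f) (at x)) (at x)"
    and "continuous_on S (\<lambda>x. frechet_derivative (gradient f) (at x) k)"
proof -
  have f: "f differentiable (at x)" if "x \<in> S" for x using assms that by (simp add: numeral_2_eq_2)
  have D: "Ck 1 S (\<lambda>x. frechet_derivative f (at x) b)" if "b \<in> Basis" for b
    using assms that by (simp add: numeral_2_eq_2)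
  show "(f has_derivative (\<lambda>h. gradient f x \<bullet> h)) (at x)" if "x \<in> S"
    by (rule has_derivative_gradient[OF f[OF that]])
  let ?d = "\<lambda>b x. frechet_derivative f (at x) b"
  have g: "(gradient f has_derivative (\<lambda>h. \<Sum>b\<in>Basis. (gradient (?d b) x \<bullet> h) *\<^sub>R b)) (at x)" if "x \<in> S" for x
    unfolding gradient_def[of f, abs_def]
    by (intro has_derivative_sum has_derivative_scaleR_left Ck_1_gradient(1)[OF D that])
  show "(gradient f has_derivative frechet_derivative (gradient f) (at x)) (at x)" if "x \<in> S"
    by (rule frechet_derivative_works[THEN iffD1, OF differentiableI[OF g[OF that]]])
  have eq: "frechet_derivative (gradient f) (at x) k = (\<Sum>b\<in>Basis. (gradient (?d b) x \<bullet> k) *\<^sub>R b)" if "x \<in> S" for x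
    by (rule fun_cong[OF frechet_derivative_at[OF g[OF that], symmetric]])
  have "continuous_on S (\<lambda>x. \<Sum>b\<in>Basis. (gradient (?d b) x \<bullet> k) *\<^sub>R b)"
    by (intro continuous_on_sum continuous_on_scaleR continuous_on_inner continuous_on_const Ck_1_gradient(2)[OF D])
  then show "continuous_on S (\<lambda>x. frechet_derivative (gradient f) (at x) k)"
    by (rule continuous_on_eq) (rule eq[symmetric])
qed

text \<open>Increments between two moving points are compared with one fixed linear map. After
  blow-up this says that the remainder has a small Lipschitz constant, which plain differentiability
  at \<open>x0\<close> does not give.\<close>

definition strictly_differentiable ::
    "('a::real_normed_vector \<Rightarrow> 'b::real_normed_vector) \<Rightarrow> ('a \<Rightarrow> 'b) \<Rightarrow> 'a \<Rightarrow> bool" where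
  "strictly_differentiable f f' x0 \<longleftrightarrow> bounded_linear f' \<and>
     (\<forall>e>0. \<exists>\<rho>>0. \<forall>x y. dist x x0 < \<rho> \<longrightarrow> dist y x0 < \<rho> \<longrightarrow> norm (f x - f y - f' (x - y)) \<le> e * norm (x - y))"

lemma strictly_differentiable_imp_has_derivative:
  assumes "strictly_differentiable f f' x0"
  shows "(f has_derivative f') (at x0)"
  unfolding has_derivative_at_alt
proof (intro conjI allI impI)
  show "bounded_linear f'" using assms by (simp add: strictly_differentiable_def)
  fix e :: real assume "e > 0"
  then obtain \<rho> where "\<rho> > 0" "\<And>x y. dist x x0 < \<rho> \<Longrightarrow> dist y x0 < \<rho> \<Longrightarrow> norm (f x - f y - f' (x - y)) \<le> e * norm (x - y)"
    using assms unfolding strictly_differentiable_def by blast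
  then show "\<exists>d>0. \<forall>y. norm (y - x0) < d \<longrightarrow> norm (f y - f x0 - f' (y - x0)) \<le> e * norm (y - x0)"
    by (intro exI[of _ \<rho>]) (auto simp: dist_norm)
qed

text \<open>Mean value inequality for \<open>f\<close> minus its linear part at \<open>x0\<close>,
  on a ball where the derivative varies by at most \<open>e\<close>.\<close>

lemma strictly_differentiableI:
  fixes f :: "'a::real_normed_vector \<Rightarrow> 'b::real_normed_vector"
  assumes r: "r > 0" and f: "\<And>x. dist x x0 < r \<Longrightarrow> (f has_derivative f' x) (at x)"
    and c: "\<And>e. e > 0 \<Longrightarrow> \<exists>\<rho>>0. \<forall>x h. dist x x0 < \<rho> \<longrightarrow> norm (f' x h - f' x0 h) \<le> e * norm h"
  shows "strictly_differentiable f (f' x0) x0"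
  unfolding strictly_differentiable_def
proof (intro conjI allI impI)
  show bl: "bounded_linear (f' x0)" using f[of x0] r has_derivative_bounded_linear by auto
  fix e :: real assume "e > 0"
  from c[OF this] obtain \<rho> where \<rho>: "\<rho> > 0" "\<And>x h. dist x x0 < \<rho> \<Longrightarrow> norm (f' x h - f' x0 h) \<le> e * norm h" by blast
  show "\<exists>\<rho>>0. \<forall>x y. dist x x0 < \<rho> \<longrightarrow> dist y x0 < \<rho> \<longrightarrow> norm (f x - f y - f' x0 (x - y)) \<le> e * norm (x - y)"
  proof (intro exI[of _ "min \<rho> r"] conjI allI impI)
    show "min \<rho> r > 0" using \<rho> r by simp
    fix x y assume xy: "dist x x0 < min \<rho> r" "dist y x0 < min \<rho> r"
    have "norm ((f x - f' x0 x) - (f y - f' x0 y)) \<le> e * norm (x - y)"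
    proof (rule differentiable_bound[OF convex_ball[of x0 "min \<rho> r"], where f' = "\<lambda>z h. f' z h - f' x0 h"])
      fix z assume "z \<in> ball x0 (min \<rho> r)"
      then have z: "dist z x0 < \<rho>" "dist z x0 < r" by (auto simp: dist_commute)
      show "((\<lambda>x. f x - f' x0 x) has_derivative (\<lambda>h. f' z h - f' x0 h)) (at z within ball x0 (min \<rho> r))"
        by (intro has_derivative_diff has_derivative_at_withinI[OF f[OF z(2)]] bounded_linear_imp_has_derivative[OF bl])
      show "onorm (\<lambda>h. f' z h - f' x0 h) \<le> e" by (rule onorm_bound) (use \<rho>(2)[OF z(1)] \<open>e > 0\<close> in auto)
    qed (use xy in \<open>auto simp: dist_commute\<close>)
    moreover have "(f x - f' x0 x) - (f y - f' x0 y) = f x - f y - f' x0 (x - y)"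
      by (simp add: linear_diff[OF bounded_linear.linear[OF bl]])
    ultimately show "norm (f x - f y - f' x0 (x - y)) \<le> e * norm (x - y)" by simp
  qed
qed

lemma strictly_differentiable_linear_compose:
  assumes f: "strictly_differentiable f f' (T x0)" and T: "bounded_linear T" and T1: "\<And>x. norm (T x) \<le> norm x"
  shows "strictly_differentiable (\<lambda>x. f (T x)) (\<lambda>h. f' (T h)) x0"
  unfolding strictly_differentiable_def
proof (intro conjI allI impI)
  interpret T: bounded_linear T by fact
  show "bounded_linear (\<lambda>h. f' (T h))"
    using f T unfolding strictly_differentiable_def by (blast intro: bounded_linear_compose)
  fix e :: real assume e: "e > 0"
  then obtain \<rho> where \<rho>: "\<rho> > 0" "\<And>x y. dist x (T x0) < \<rho> \<Longrightarrow> dist y (T x0) < \<rho> \<Longrightarrow> norm (f x - f y - f' (x - y)) \<le> e * norm (x - y)"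
    using f unfolding strictly_differentiable_def by blast
  have d: "dist (T x) (T y) \<le> dist x y" for x y using T1[of "x - y"] by (simp add: dist_norm T.diff)
  show "\<exists>\<rho>>0. \<forall>x y. dist x x0 < \<rho> \<longrightarrow> dist y x0 < \<rho> \<longrightarrow> norm (f (T x) - f (T y) - f' (T (x - y))) \<le> e * norm (x - y)"
  proof (intro exI[of _ \<rho>] conjI allI impI \<rho>(1))
    fix x y assume "dist x x0 < \<rho>" "dist y x0 < \<rho>"
    then have "norm (f (T x) - f (T y) - f' (T x - T y)) \<le> e * norm (T x - T y)"
      using d[of x x0] d[of y x0] by (intro \<rho>(2)) linarith+
    also have "\<dots> \<le> e * norm (x - y)" using e T1[of "x - y"] by (simp add: T.diff)
    finally show "norm (f (T x) - f (T y) - f' (T (x - y))) \<le> e * norm (x - y)" by (simp add: T.diff)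
  qed
qed

lemma strictly_differentiable_add:
  assumes f: "strictly_differentiable f f' x0" and g: "strictly_differentiable g g' x0"
  shows "strictly_differentiable (\<lambda>x. f x + g x) (\<lambda>h. f' h + g' h) x0"
  unfolding strictly_differentiable_def
proof (intro conjI allI impI)
  show "bounded_linear (\<lambda>h. f' h + g' h)"
    using f g unfolding strictly_differentiable_def by (blast intro: bounded_linear_add)
  fix e :: real assume "e > 0"
  then have e: "e / 2 > 0" by simp
  obtain r1 where r1: "r1 > 0" "\<And>x y. dist x x0 < r1 \<Longrightarrow> dist y x0 < r1 \<Longrightarrow> norm (f x - f y - f' (x - y)) \<le> e / 2 * norm (x - y)"
    using f e unfolding strictly_differentiable_def by blast
  obtain r2 where r2: "r2 > 0" "\<And>x y. dist x x0 < r2 \<Longrightarrow> dist y x0 < r2 \<Longrightarrow> norm (g x - g y - g' (x - y)) \<le> e / 2 * norm (x - y)"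
    using g e unfolding strictly_differentiable_def by blast
  show "\<exists>\<rho>>0. \<forall>x y. dist x x0 < \<rho> \<longrightarrow> dist y x0 < \<rho> \<longrightarrow>
      norm (f x + g x - (f y + g y) - (f' (x - y) + g' (x - y))) \<le> e * norm (x - y)"
  proof (intro exI[of _ "min r1 r2"] conjI allI impI)
    show "min r1 r2 > 0" using r1 r2 by simp
    fix x y assume "dist x x0 < min r1 r2" "dist y x0 < min r1 r2"
    then have "norm ((f x - f y - f' (x - y)) + (g x - g y - g' (x - y))) \<le> e / 2 * norm (x - y) + e / 2 * norm (x - y)"
      by (intro norm_triangle_mono r1 r2) auto
    then show "norm (f x + g x - (f y + g y) - (f' (x - y) + g' (x - y))) \<le> e * norm (x - y)"
      by (simp add: algebra_simps)
  qed
qed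

lemma strictly_differentiable_local_bound:
  assumes f: "strictly_differentiable f f' x0" and e: "e > 0"
  obtains \<rho> where "\<rho> > 0" "\<And>x. dist x x0 < \<rho> \<Longrightarrow> norm (f x - f x0) \<le> e"
proof -
  have "isCont f x0" using strictly_differentiable_imp_has_derivative[OF f] has_derivative_continuous by blast
  then obtain \<rho> where "\<rho> > 0" "\<And>x. dist x x0 < \<rho> \<Longrightarrow> dist (f x) (f x0) < e"
    using e unfolding continuous_at_eps_delta by blast
  then show thesis using that by (metis dist_norm less_imp_le)
qed

lemma strictly_differentiable_scaleR:
  fixes f :: "'a::real_normed_vector \<Rightarrow> real" and g :: "'a \<Rightarrow> 'b::real_normed_vector"
  assumes f: "strictly_differentiable f f' x0" and g: "strictly_differentiable g g' x0"
  shows "strictly_differentiable (\<lambda>x. f x *\<^sub>R g x) (\<lambda>h. f' h *\<^sub>R g x0 + f x0 *\<^sub>R g' h) x0"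
  unfolding strictly_differentiable_def
proof (intro conjI allI impI)
  have bl: "bounded_linear f'" "bounded_linear g'" using f g by (auto simp: strictly_differentiable_def)
  show "bounded_linear (\<lambda>h. f' h *\<^sub>R g x0 + f x0 *\<^sub>R g' h)"
    by (intro bounded_linear_add bounded_linear_scaleR_const bounded_linear_const_scaleR bl)
  obtain F where F: "F > 0" "\<And>h. norm (f' h) \<le> norm h * F" using bounded_linear.pos_bounded[OF bl(1)] by blast
  obtain G where G: "G > 0" "\<And>h. norm (g' h) \<le> norm h * G" using bounded_linear.pos_bounded[OF bl(2)] by blast
  fix e :: real assume e0: "e > 0"
  define K where "K = F + G + norm (g x0) + \<bar>f x0\<bar> + 2"
  have K: "K > 0" "F \<le> K" "G \<le> K" "norm (g x0) + 1 \<le> K" "\<bar>f x0\<bar> + 1 \<le> K"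
    unfolding K_def using F(1) G(1) norm_ge_zero[of "g x0"] abs_ge_zero[of "f x0"] by linarith+
  \<comment> \<open>Each of the four terms of the product decomposition below is at most
    \<open>d * K * norm (x - y)\<close>, so \<open>d * K \<le> e / 4\<close> is the target.\<close>
  define d where "d = min 1 (e / (4 * K))"
  have d: "d > 0" "d \<le> 1" using e0 K by (auto simp: d_def)
  have dK: "d * K \<le> e / 4"
  proof -
    have "d * K \<le> e / (4 * K) * K" using K by (intro mult_right_mono) (auto simp: d_def)
    then show ?thesis using K by simp
  qed
  obtain r1 where r1: "r1 > 0" "\<And>x y. dist x x0 < r1 \<Longrightarrow> dist y x0 < r1 \<Longrightarrow> norm (f x - f y - f' (x - y)) \<le> d * norm (x - y)"
    using f d unfolding strictly_differentiable_def by blast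
  obtain r2 where r2: "r2 > 0" "\<And>x y. dist x x0 < r2 \<Longrightarrow> dist y x0 < r2 \<Longrightarrow> norm (g x - g y - g' (x - y)) \<le> d * norm (x - y)"
    using g d unfolding strictly_differentiable_def by blast
  obtain r3 where r3: "r3 > 0" "\<And>x. dist x x0 < r3 \<Longrightarrow> norm (f x - f x0) \<le> d"
    using strictly_differentiable_local_bound[OF f d(1)] by blast
  obtain r4 where r4: "r4 > 0" "\<And>x. dist x x0 < r4 \<Longrightarrow> norm (g x - g x0) \<le> d"
    using strictly_differentiable_local_bound[OF g d(1)] by blast
  show "\<exists>\<rho>>0. \<forall>x y. dist x x0 < \<rho> \<longrightarrow> dist y x0 < \<rho> \<longrightarrow>
      norm (f x *\<^sub>R g x - f y *\<^sub>R g y - (f' (x - y) *\<^sub>R g x0 + f x0 *\<^sub>R g' (x - y))) \<le> e * norm (x - y)"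
  proof (intro exI[of _ "min (min r1 r2) (min r3 r4)"] conjI allI impI)
    show "min (min r1 r2) (min r3 r4) > 0" using r1 r2 r3 r4 by simp
    fix x y assume "dist x x0 < min (min r1 r2) (min r3 r4)" "dist y x0 < min (min r1 r2) (min r3 r4)"
    then have xy: "dist x x0 < r1" "dist y x0 < r1" "dist x x0 < r2" "dist y x0 < r2" "dist y x0 < r3" "dist x x0 < r4"
      by auto
    let ?n = "norm (x - y)"
    have gx: "norm (g x) \<le> K" using r4(2)[OF xy(6)] d K norm_triangle_sub[of "g x" "g x0"] by linarith
    have fy: "\<bar>f y\<bar> \<le> K" using r3(2)[OF xy(5)] d K by (auto simp: abs_le_iff)
    have 1: "norm ((f x - f y - f' (x - y)) *\<^sub>R g x) \<le> d * ?n * K"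
      unfolding norm_scaleR using r1(2)[OF xy(1,2)] gx d by (intro mult_mono) auto
    have 2: "norm (f' (x - y) *\<^sub>R (g x - g x0)) \<le> ?n * K * d"
    proof -
      have "\<bar>f' (x - y)\<bar> \<le> ?n * K"
        using F(2)[of "x - y"] mult_left_mono[OF K(2), of ?n] by auto
      then show ?thesis unfolding norm_scaleR using r4(2)[OF xy(6)] K by (intro mult_mono) auto
    qed
    have 3: "norm (f y *\<^sub>R (g x - g y - g' (x - y))) \<le> K * (d * ?n)"
      unfolding norm_scaleR using r2(2)[OF xy(3,4)] fy K by (intro mult_mono) auto
    have 4: "norm ((f y - f x0) *\<^sub>R g' (x - y)) \<le> d * (?n * K)"
    proof -
      have "norm (g' (x - y)) \<le> ?n * K"
        using G(2)[of "x - y"] mult_left_mono[OF K(3), of ?n] by auto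
      then show ?thesis unfolding norm_scaleR using r3(2)[OF xy(5)] d by (intro mult_mono) auto
    qed
    have "f x *\<^sub>R g x - f y *\<^sub>R g y - (f' (x - y) *\<^sub>R g x0 + f x0 *\<^sub>R g' (x - y)) =
        ((f x - f y - f' (x - y)) *\<^sub>R g x + f' (x - y) *\<^sub>R (g x - g x0)) +
        (f y *\<^sub>R (g x - g y - g' (x - y)) + (f y - f x0) *\<^sub>R g' (x - y))"
      by (simp add: algebra_simps)
    also have "norm \<dots> \<le> (d * ?n * K + ?n * K * d) + (K * (d * ?n) + d * (?n * K))"
      by (rule norm_triangle_mono[OF norm_triangle_mono[OF 1 2] norm_triangle_mono[OF 3 4]])
    also have "\<dots> = 4 * (d * K) * ?n" by simp
    also have "\<dots> \<le> e * ?n" using dK by (intro mult_right_mono) auto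
    finally show "norm (f x *\<^sub>R g x - f y *\<^sub>R g y - (f' (x - y) *\<^sub>R g x0 + f x0 *\<^sub>R g' (x - y))) \<le> e * norm (x - y)" .
  qed
qed

lemma Ck_1_strictly_differentiable:
  fixes f :: "'a::euclidean_space \<Rightarrow> real"
  assumes f: "Ck 1 S f" and S: "open S" "x0 \<in> S"
  shows "strictly_differentiable f (\<lambda>h. gradient f x0 \<bullet> h) x0"
proof -
  obtain r where r: "r > 0" "ball x0 r \<subseteq> S" using S openE by blast
  show ?thesis
  proof (rule strictly_differentiableI[OF r(1), where f' = "\<lambda>x h. gradient f x \<bullet> h"])
    show "(f has_derivative (\<lambda>h. gradient f x \<bullet> h)) (at x)" if "dist x x0 < r" for x
      using Ck_1_gradient(1)[OF f, of x] r that by (auto simp: dist_commute)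
    fix e :: real assume e: "e > 0"
    have "isCont (gradient f) x0"
      using Ck_1_gradient(2)[OF f] S continuous_on_eq_continuous_at by blast
    then obtain d where d: "d > 0" "\<And>x. dist x x0 < d \<Longrightarrow> dist (gradient f x) (gradient f x0) < e"
      using e unfolding continuous_at_eps_delta by blast
    show "\<exists>\<rho>>0. \<forall>x h. dist x x0 < \<rho> \<longrightarrow> norm (gradient f x \<bullet> h - gradient f x0 \<bullet> h) \<le> e * norm h"
    proof (intro exI[of _ d] conjI allI impI d(1))
      fix x h :: 'a assume "dist x x0 < d"
      then have "norm (gradient f x - gradient f x0) * norm h \<le> e * norm h"
        using d(2) by (intro mult_right_mono) (auto simp: dist_norm intro: less_imp_le)
      then show "norm (gradient f x \<bullet> h - gradient f x0 \<bullet> h) \<le> e * norm h"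
        using Cauchy_Schwarz_ineq2[of "gradient f x - gradient f x0" h] by (simp add: inner_diff_left)
    qed
  qed
qed

text \<open>By symmetry of \<open>B\<close> the remainder has gradient
  \<open>g z - g x0 - B (z - x0)\<close>, which is at most \<open>e * norm (z - x0)\<close> near
  \<open>x0\<close>. The mean value inequality on the ball of radius \<open>dist x x0\<close>
  supplies the second factor.\<close>

lemma second_order_taylor:
  fixes f :: "'a::euclidean_space \<Rightarrow> real"
  assumes S: "open S" "x0 \<in> S" and f: "\<And>x. x \<in> S \<Longrightarrow> (f has_derivative (\<lambda>h. g x \<bullet> h)) (at x)"
    and g: "(g has_derivative B) (at x0)" and e: "e > 0"
  shows "\<exists>\<rho>>0. \<forall>x. dist x x0 < \<rho> \<longrightarrow>
    \<bar>f x - (f x0 + g x0 \<bullet> (x - x0) + B (x - x0) \<bullet> (x - x0) / 2)\<bar> \<le> e * (dist x x0)\<^sup>2"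
proof -
  have sym: "B x \<bullet> y = B y \<bullet> x" for x y by (rule symmetric_second_derivative[OF S f g])
  have blB: "bounded_linear B" using g has_derivative_bounded_linear by blast
  obtain r where r: "r > 0" "ball x0 r \<subseteq> S" using S openE by blast
  obtain d where d: "d > 0" "\<And>y. norm (y - x0) < d \<Longrightarrow> norm (g y - g x0 - B (y - x0)) \<le> e * norm (y - x0)"
    using g e unfolding has_derivative_at_alt by blast
  let ?q = "\<lambda>x. f x - (f x0 + g x0 \<bullet> (x - x0) + B (x - x0) \<bullet> (x - x0) / 2)"
  show ?thesis
  proof (intro exI[of _ "min r d"] conjI allI impI)
    show "min r d > 0" using r d by simp
    fix x assume x: "dist x x0 < min r d"
    have "norm (?q x - ?q x0) \<le> (e * dist x x0) * norm (x - x0)"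
    proof (rule differentiable_bound[OF convex_cball[of x0 "dist x x0"], where f' = "\<lambda>z h. (g z - g x0 - B (z - x0)) \<bullet> h"])
      fix z assume "z \<in> cball x0 (dist x x0)"
      then have z: "dist z x0 \<le> dist x x0" by (simp add: dist_commute)
      then have "z \<in> S" using r x by (auto simp: dist_commute)
      have dB: "((\<lambda>x. B (x - x0)) has_derivative B) (at z)"
        by (rule bounded_linear.has_derivative[OF blB]) (auto intro!: derivative_eq_intros)
      have "(?q has_derivative (\<lambda>h. g z \<bullet> h - (g x0 \<bullet> h + (B (z - x0) \<bullet> h + B h \<bullet> (z - x0)) / 2))) (at z)"
        by (auto intro!: derivative_eq_intros f[OF \<open>z \<in> S\<close>] dB)
      moreover have "g z \<bullet> h - (g x0 \<bullet> h + (B (z - x0) \<bullet> h + B h \<bullet> (z - x0)) / 2) = (g z - g x0 - B (z - x0)) \<bullet> h" for h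
        using sym[of h "z - x0"] by (simp add: inner_diff_left)
      ultimately show "(?q has_derivative (\<lambda>h. (g z - g x0 - B (z - x0)) \<bullet> h)) (at z within cball x0 (dist x x0))"
        by (simp add: has_derivative_at_withinI)
      have "norm (g z - g x0 - B (z - x0)) \<le> e * norm (z - x0)"
        using z x by (intro d(2)) (simp add: dist_norm)
      also have "\<dots> \<le> e * dist x x0" using z e by (simp add: dist_norm)
      finally have n: "norm (g z - g x0 - B (z - x0)) \<le> e * dist x x0" .
      show "onorm (\<lambda>h. (g z - g x0 - B (z - x0)) \<bullet> h) \<le> e * dist x x0"
      proof (rule onorm_bound)
        fix h :: 'a
        have "norm (g z - g x0 - B (z - x0)) * norm h \<le> e * dist x x0 * norm h" using n by (intro mult_right_mono) auto
        then show "norm ((g z - g x0 - B (z - x0)) \<bullet> h) \<le> e * dist x x0 * norm h"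
          using Cauchy_Schwarz_ineq2[of "g z - g x0 - B (z - x0)" h] by simp
      qed (use e in simp)
    qed (auto simp: dist_commute)
    moreover have "?q x0 = 0" using linear_0[OF bounded_linear.linear[OF blB]] by simp
    ultimately show "\<bar>?q x\<bar> \<le> e * (dist x x0)\<^sup>2" by (simp add: dist_norm power2_eq_square)
  qed
qed

section \<open>The field |z|^(s-2) z away from the origin\<close>

definition power_field :: "real \<Rightarrow> 'a::euclidean_space \<Rightarrow> 'a" where
  "power_field s z = ((z \<bullet> z) powr ((s - 2) / 2)) *\<^sub>R z"

definition power_field_deriv :: "real \<Rightarrow> 'a::euclidean_space \<Rightarrow> 'a \<Rightarrow> 'a" where
  "power_field_deriv s z h = ((z \<bullet> z) powr ((s - 2) / 2)) *\<^sub>R h +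
     ((s - 2) * (z \<bullet> z) powr ((s - 2) / 2 - 1) * (z \<bullet> h)) *\<^sub>R z"

text \<open>Powers of \<open>z \<bullet> z\<close> avoid differentiating the norm. At
  \<open>z = 0\<close> the two powers agree by the convention that \<open>0 powr e\<close> is
  \<open>0\<close>.\<close>

lemma A_dp_power_field: "A_dp p q a x z = power_field p z + a x *\<^sub>R power_field q z"
proof -
  have "norm z powr (s - 2) = (z \<bullet> z) powr ((s - 2) / 2)" for s
  proof (cases "z = 0")
    case False
    then have "z \<bullet> z = norm z powr 2" by (simp add: dot_square_norm powr_numeral)
    moreover have "2 * ((s - 2) / 2) = s - 2" by simp
    ultimately show ?thesis by (simp only: powr_powr)
  qed simp
  then show ?thesis by (simp add: A_dp_def power_field_def)
qed

lemma has_derivative_power_field: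
  assumes "z \<noteq> 0"
  shows "(power_field s has_derivative power_field_deriv s z) (at z)"
proof -
  have pos: "z \<bullet> z > 0" using assms by simp
  have r: "((\<lambda>t. t powr ((s - 2) / 2)) has_derivative (\<lambda>h. ((s - 2) / 2 * (z \<bullet> z) powr ((s - 2) / 2 - 1)) * h)) (at (z \<bullet> z))"
    using has_real_derivative_powr[OF pos, of "(s - 2) / 2"] unfolding has_field_derivative_def .
  have i: "((\<lambda>z. z \<bullet> z) has_derivative (\<lambda>h. 2 * (z \<bullet> h))) (at z)"
    by (auto intro!: derivative_eq_intros simp: inner_commute)
  have d: "((\<lambda>z. (z \<bullet> z) powr ((s - 2) / 2)) has_derivative (\<lambda>h. ((s - 2) / 2 * (z \<bullet> z) powr ((s - 2) / 2 - 1)) * (2 * (z \<bullet> h)))) (at z)"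
    by (rule has_derivative_compose[OF i r])
  have "(power_field s has_derivative (\<lambda>h. ((z \<bullet> z) powr ((s - 2) / 2)) *\<^sub>R h +
      (((s - 2) / 2 * (z \<bullet> z) powr ((s - 2) / 2 - 1)) * (2 * (z \<bullet> h))) *\<^sub>R z)) (at z)"
    unfolding power_field_def[abs_def] by (rule has_derivative_scaleR[OF d has_derivative_ident])
  moreover have "((z \<bullet> z) powr ((s - 2) / 2)) *\<^sub>R h + (((s - 2) / 2 * (z \<bullet> z) powr ((s - 2) / 2 - 1)) * (2 * (z \<bullet> h))) *\<^sub>R z
      = power_field_deriv s z h" for h by (simp add: power_field_deriv_def)
  ultimately show ?thesis by simp
qed

lemma linear_power_field_deriv: "linear (power_field_deriv s z)"
  by (rule linearI) (simp_all add: power_field_deriv_def inner_add_right algebra_simps)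

lemma powr_lipschitz:
  fixes e :: real
  assumes "0 < c"
  obtains K where "\<And>s t. s \<in> {c..d} \<Longrightarrow> t \<in> {c..d} \<Longrightarrow> norm (s powr e - t powr e) \<le> K * norm (s - t)"
proof -
  have "bounded ((\<lambda>z. e * z powr (e - 1)) ` {c..d})"
    using assms by (intro compact_imp_bounded compact_continuous_image continuous_intros) auto
  then obtain K where "\<forall>y\<in>(\<lambda>z. e * z powr (e - 1)) ` {c..d}. norm y \<le> K"
    unfolding bounded_iff ..
  then have K: "norm (e * z powr (e - 1)) \<le> K" if "z \<in> {c..d}" for z
    by (rule bspec) (rule imageI[OF that])
  have "norm (s powr e - t powr e) \<le> K * norm (s - t)" if st: "s \<in> {c..d}" "t \<in> {c..d}" for s t
  proof (rule field_differentiable_bound[where S = "{c..d}" and f' = "\<lambda>z. e * z powr (e - 1)"])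
    fix z assume z: "z \<in> {c..d}"
    then have "z > 0" using assms by simp
    then show "((\<lambda>s. s powr e) has_field_derivative e * z powr (e - 1)) (at z within {c..d})"
      by (rule has_field_derivative_at_within[OF has_real_derivative_powr])
    show "norm (e * z powr (e - 1)) \<le> K" by (rule K[OF z])
  qed (use st in auto)
  then show thesis by (rule that)
qed

text \<open>On this ball \<open>z \<bullet> z\<close> stays in a compact interval of positive
  numbers, where all real powers are Lipschitz. This is where a nonvanishing gradient of the
  touching function enters.\<close>

lemma power_field_deriv_bounded_lipschitz:
  fixes z0 :: "'a::euclidean_space"
  assumes "z0 \<noteq> 0"
  shows "bounded_lipschitz_on (cball z0 (norm z0 / 2)) (\<lambda>z. power_field_deriv s z h)"
    and "0 \<notin> cball z0 (norm z0 / 2)"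
proof -
  let ?S = "cball z0 (norm z0 / 2)"
  have n: "norm z0 / 2 \<le> norm z" "norm z \<le> 2 * norm z0" if "z \<in> ?S" for z
    using that norm_triangle_sub[of z0 z] norm_triangle_sub[of z z0] norm_ge_zero[of z0]
    by (auto simp: dist_norm norm_minus_commute simp del: norm_ge_zero)
  show "0 \<notin> ?S" using assms by auto
  have r: "z \<bullet> z \<in> {(norm z0 / 2)\<^sup>2..(2 * norm z0)\<^sup>2}" if "z \<in> ?S" for z
    using power_mono[OF n(1)[OF that], of 2] power_mono[OF n(2)[OF that], of 2] by (simp add: dot_square_norm)
  have pos: "0 < (norm z0 / 2)\<^sup>2" using assms by simp
  have blid: "bounded_lipschitz_on ?S (\<lambda>z. z)"
    by (rule bounded_lipschitz_on_linear[OF bounded_linear_ident bounded_cball])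
  have bls: "bounded_lipschitz_on ?S (\<lambda>z. z \<bullet> z)" by (rule bounded_lipschitz_on_inner[OF blid blid])
  have blp: "bounded_lipschitz_on ?S (\<lambda>z. (z \<bullet> z) powr e)" for e
  proof -
    obtain K where K: "\<And>s t. s \<in> {(norm z0 / 2)\<^sup>2..(2 * norm z0)\<^sup>2} \<Longrightarrow> t \<in> {(norm z0 / 2)\<^sup>2..(2 * norm z0)\<^sup>2} \<Longrightarrow>
        norm (s powr e - t powr e) \<le> K * norm (s - t)"
      using powr_lipschitz[OF pos] by blast
    show ?thesis
      by (rule bounded_lipschitz_on_compose[OF bls, of "\<lambda>t. t powr e" K]) (use K r in blast)
  qed
  show "bounded_lipschitz_on ?S (\<lambda>z. power_field_deriv s z h)"
    unfolding power_field_deriv_def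
    by (intro bounded_lipschitz_on_add bounded_lipschitz_on_scaleR bounded_lipschitz_on_mult
        bounded_lipschitz_on_inner bounded_lipschitz_on_const blp blid)
qed

lemma power_field_strictly_differentiable:
  fixes z0 :: "'a::euclidean_space"
  assumes "z0 \<noteq> 0"
  shows "strictly_differentiable (power_field s) (power_field_deriv s z0) z0"
proof -
  let ?S = "cball z0 (norm z0 / 2)"
  obtain C where C: "C \<ge> 0" "\<And>x y f. x \<in> ?S \<Longrightarrow> y \<in> ?S \<Longrightarrow>
      norm (power_field_deriv s x f - power_field_deriv s y f) \<le> C * dist x y * norm f"
    by (rule linear_family_bounded_lipschitz[where T = "power_field_deriv s" and S = ?S,
          OF linear_power_field_deriv power_field_deriv_bounded_lipschitz(1)[OF assms]]) blast
  have pos: "norm z0 / 2 > 0" using assms by simp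
  show ?thesis
  proof (rule strictly_differentiableI[OF pos])
    show "(power_field s has_derivative power_field_deriv s x) (at x)" if "dist x z0 < norm z0 / 2" for x
      using that power_field_deriv_bounded_lipschitz(2)[OF assms] by (intro has_derivative_power_field) auto
    fix e :: real assume e: "e > 0"
    show "\<exists>\<rho>>0. \<forall>x h. dist x z0 < \<rho> \<longrightarrow> norm (power_field_deriv s x h - power_field_deriv s z0 h) \<le> e * norm h"
    proof (intro exI[of _ "min (norm z0 / 2) (e / (C + 1))"] conjI allI impI)
      show "min (norm z0 / 2) (e / (C + 1)) > 0" using pos e C by simp
      fix x h :: 'a assume x: "dist x z0 < min (norm z0 / 2) (e / (C + 1))"
      then have "C * dist x z0 \<le> (C + 1) * (e / (C + 1))" using C by (intro mult_mono) auto
      then have "C * dist x z0 \<le> e" using C by simp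
      then have "C * dist x z0 * norm h \<le> e * norm h" by (rule mult_right_mono) simp
      moreover have "norm (power_field_deriv s x h - power_field_deriv s z0 h) \<le> C * dist x z0 * norm h"
        using x pos by (intro C(2)) (auto simp: dist_commute)
      ultimately show "norm (power_field_deriv s x h - power_field_deriv s z0 h) \<le> e * norm h" by linarith
    qed
  qed
qed

section \<open>Uniqueness of weak gradients\<close>

text \<open>The family \<open>t\<^sup>-\<^sup>m exp (- 1 / t)\<close> is closed under differentiation up to linear combinations.\<close>

definition flat_exp :: "nat \<Rightarrow> real \<Rightarrow> real" where
  "flat_exp m t = (if t > 0 then exp (- (1 / t)) / t ^ m else 0)"

lemma flat_exp_tendsto_0: "(flat_exp m \<longlongrightarrow> 0) (at 0)"
proof -
  have "((\<lambda>t::real. inverse t ^ m / exp (inverse t)) \<longlongrightarrow> 0) (at_right 0)"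
    by (rule filterlim_compose[OF tendsto_power_div_exp_0 filterlim_inverse_at_top_right])
  moreover have "\<forall>\<^sub>F t in at_right 0. inverse t ^ m / exp (inverse t) = flat_exp m t"
    unfolding eventually_at_right_field
    by (intro exI[of _ 1]) (auto simp: flat_exp_def exp_minus field_simps power_inverse)
  ultimately have r: "(flat_exp m \<longlongrightarrow> 0) (at_right 0)" by (rule Lim_transform_eventually)
  have "\<forall>\<^sub>F t in at_left 0. 0 = flat_exp m t"
    unfolding eventually_at_left_field by (intro exI[of _ "-1"]) (auto simp: flat_exp_def)
  then have l: "(flat_exp m \<longlongrightarrow> 0) (at_left 0)" by (rule Lim_transform_eventually[OF tendsto_const])
  show ?thesis using l r by (simp add: filterlim_split_at)
qed

lemma has_real_derivative_flat_exp:
  "(flat_exp m has_real_derivative (flat_exp (m + 2) t - real m * flat_exp (m + 1) t)) (at t)"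
proof -
  consider "t > 0" | "t < 0" | "t = 0" by linarith
  then show ?thesis
  proof cases
    case 1
    have "((\<lambda>t. exp (- (1 / t)) / t ^ m) has_real_derivative
        (exp (- (1 / t)) / t ^ (m + 2) - real m * (exp (- (1 / t)) / t ^ (m + 1)))) (at t)"
    proof -
      have e: "((\<lambda>t. exp (- (1 / t))) has_real_derivative exp (- (1 / t)) / t\<^sup>2) (at t)"
        using 1 by (auto intro!: derivative_eq_intros simp: power2_eq_square)
      have "((\<lambda>t. exp (- (1 / t)) / t ^ m) has_real_derivative
          (exp (- (1 / t)) / t\<^sup>2 * t ^ m - exp (- (1 / t)) * (real m * t ^ (m - Suc 0))) / (t ^ m * t ^ m)) (at t)"
        by (rule DERIV_divide[OF e DERIV_pow]) (use 1 in simp)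
      moreover have "(exp (- (1 / t)) / t\<^sup>2 * t ^ m - exp (- (1 / t)) * (real m * t ^ (m - Suc 0))) / (t ^ m * t ^ m)
          = exp (- (1 / t)) / t ^ (m + 2) - real m * (exp (- (1 / t)) / t ^ (m + 1))"
      proof (cases m)
        case 0
        then show ?thesis by (simp add: power2_eq_square)
      next
        case (Suc k)
        then show ?thesis using 1 by (simp add: field_simps power2_eq_square)
      qed
      ultimately show ?thesis by (simp only:)
    qed
    then have "(flat_exp m has_real_derivative
        (exp (- (1 / t)) / t ^ (m + 2) - real m * (exp (- (1 / t)) / t ^ (m + 1)))) (at t)"
      by (rule has_field_derivative_transform_within_open[of _ _ _ "{0<..}"]) (use 1 in \<open>auto simp: flat_exp_def\<close>)
    then show ?thesis using 1 by (simp add: flat_exp_def)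
  next
    case 2
    have "(flat_exp m has_real_derivative 0) (at t)"
      by (rule has_field_derivative_transform_within_open[of "\<lambda>_. 0" _ _ "{..<0}"]) (use 2 in \<open>auto simp: flat_exp_def\<close>)
    then show ?thesis using 2 by (simp add: flat_exp_def)
  next
    case 3
    \<comment> \<open>The difference quotient at the origin is the next member of the family, which
      tends to 0.\<close>
    have "(\<lambda>t. (flat_exp m t - flat_exp m 0) / (t - 0)) = flat_exp (m + 1)"
      by (rule ext) (auto simp: flat_exp_def)
    then have "(flat_exp m has_real_derivative 0) (at 0)"
      unfolding has_field_derivative_iff using flat_exp_tendsto_0 by simp
    then show ?thesis using 3 by (simp add: flat_exp_def)
  qed
qed

lemma flat_exp_0_range: "0 \<le> flat_exp 0 t" "flat_exp 0 t \<le> 1"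
  by (auto simp: flat_exp_def)

section \<open>Smooth bumps supported in boxes\<close>

lemma Ck_SucI:
  fixes f :: "'a::euclidean_space \<Rightarrow> real"
  assumes "\<And>x. (f has_derivative f' x) (at x)" and "\<And>b. b \<in> Basis \<Longrightarrow> Ck k UNIV (\<lambda>x. f' x b)"
  shows "Ck (Suc k) UNIV f"
proof -
  have "frechet_derivative f (at x) = f' x" for x using frechet_derivative_at[OF assms(1)] by metis
  then show ?thesis using assms differentiableI by (auto simp: differentiable_def)
qed

lemma Ck_SucD:
  fixes f :: "'a::euclidean_space \<Rightarrow> real"
  assumes "Ck (Suc k) UNIV f"
  shows "(f has_derivative frechet_derivative f (at x)) (at x)"
    and "b \<in> Basis \<Longrightarrow> Ck k UNIV (\<lambda>x. frechet_derivative f (at x) b)"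
  using assms frechet_derivative_works by auto

lemma Ck_Suc_imp_Ck: "Ck (Suc k) UNIV f \<Longrightarrow> Ck k UNIV (f :: 'a::euclidean_space \<Rightarrow> real)"
proof (induction k arbitrary: f)
  case 0
  then show ?case using differentiable_imp_continuous_within[of f _ UNIV]
    by (auto simp: continuous_on_eq_continuous_within)
next
  case (Suc k)
  then show ?case by (auto simp del: Ck.simps(2) intro!: Ck_SucI[where f' = "\<lambda>x. frechet_derivative f (at x)"] dest: Ck_SucD)
qed

lemma Ck_const: "Ck k UNIV (\<lambda>x :: 'a::euclidean_space. c)"
proof (induction k arbitrary: c)
  case (Suc k)
  show ?case by (rule Ck_SucI[of _ "\<lambda>x h. 0"]) (auto simp: Suc)
qed simp

lemma Ck_add:
  fixes f g :: "'a::euclidean_space \<Rightarrow> real"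
  shows "Ck k UNIV f \<Longrightarrow> Ck k UNIV g \<Longrightarrow> Ck k UNIV (\<lambda>x. f x + g x)"
proof (induction k arbitrary: f g)
  case 0
  then show ?case by (auto intro: continuous_intros)
next
  case (Suc k)
  show ?case
    by (rule Ck_SucI[where f' = "\<lambda>x h. frechet_derivative f (at x) h + frechet_derivative g (at x) h"])
       (intro has_derivative_add Ck_SucD(1)[OF Suc.prems(1)] Ck_SucD(1)[OF Suc.prems(2)],
        intro Suc.IH Ck_SucD(2)[OF Suc.prems(1)] Ck_SucD(2)[OF Suc.prems(2)])
qed

lemma Ck_mult:
  fixes f g :: "'a::euclidean_space \<Rightarrow> real"
  shows "Ck k UNIV f \<Longrightarrow> Ck k UNIV g \<Longrightarrow> Ck k UNIV (\<lambda>x. f x * g x)"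
proof (induction k arbitrary: f g)
  case 0
  then show ?case by (auto intro: continuous_intros)
next
  case (Suc k)
  show ?case
  proof (rule Ck_SucI[where f' = "\<lambda>x h. f x * frechet_derivative g (at x) h + frechet_derivative f (at x) h * g x"])
    show "((\<lambda>x. f x * g x) has_derivative
        (\<lambda>h. f x * frechet_derivative g (at x) h + frechet_derivative f (at x) h * g x)) (at x)" for x
      by (rule has_derivative_mult[OF Ck_SucD(1)[OF Suc.prems(1)] Ck_SucD(1)[OF Suc.prems(2)]])
    show "Ck k UNIV (\<lambda>x. f x * frechet_derivative g (at x) b + frechet_derivative f (at x) b * g x)" if "b \<in> Basis" for b
      using that by (intro Ck_add Suc.IH Ck_SucD(2)[OF Suc.prems(1)] Ck_SucD(2)[OF Suc.prems(2)]
        Ck_Suc_imp_Ck[OF Suc.prems(1)] Ck_Suc_imp_Ck[OF Suc.prems(2)])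
  qed
qed

lemma Ck_prod:
  fixes f :: "'i \<Rightarrow> 'a::euclidean_space \<Rightarrow> real"
  assumes "finite I" "\<And>i. i \<in> I \<Longrightarrow> Ck k UNIV (f i)"
  shows "Ck k UNIV (\<lambda>x. \<Prod>i\<in>I. f i x)"
  using assms by (induction I rule: finite_induct) (auto intro: Ck_const Ck_mult simp del: Ck.simps)

lemma Ck_flat_exp: "Ck k UNIV (\<lambda>x. flat_exp m (w \<bullet> x + c))"
proof (induction k arbitrary: m)
  case 0
  have "continuous_on UNIV (flat_exp m)"
    using has_real_derivative_flat_exp DERIV_isCont continuous_at_imp_continuous_on by blast
  then show ?case by (auto intro!: continuous_on_compose2[of UNIV "flat_exp m"] continuous_intros)
next
  case (Suc k)
  show ?case
  proof (rule Ck_SucI[where f' = "\<lambda>x h. (flat_exp (m + 2) (w \<bullet> x + c) + (- real m) * flat_exp (m + 1) (w \<bullet> x + c)) * (w \<bullet> h)"])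
    show "((\<lambda>x. flat_exp m (w \<bullet> x + c)) has_derivative
      (\<lambda>h. (flat_exp (m + 2) (w \<bullet> x + c) + (- real m) * flat_exp (m + 1) (w \<bullet> x + c)) * (w \<bullet> h))) (at x)" for x
    proof -
      have i: "((\<lambda>x. w \<bullet> x + c) has_derivative (\<lambda>h. w \<bullet> h)) (at x)" by (auto intro!: derivative_eq_intros)
      have "((\<lambda>x. flat_exp m (w \<bullet> x + c)) has_derivative
          (\<lambda>h. (flat_exp (m + 2) (w \<bullet> x + c) - real m * flat_exp (m + 1) (w \<bullet> x + c)) * (w \<bullet> h))) (at x)"
        by (rule has_derivative_compose[OF i has_real_derivative_flat_exp[unfolded has_field_derivative_def]])
      then show ?thesis by simp
    qed
    show "Ck k UNIV (\<lambda>x. (flat_exp (m + 2) (w \<bullet> x + c) + (- real m) * flat_exp (m + 1) (w \<bullet> x + c)) * (w \<bullet> b))" for b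
      by (intro Ck_mult Ck_add Ck_const Suc.IH)
  qed
qed

text \<open>Each factor \<open>flat_exp 0 (k * t)\<close> increases to 1 for \<open>t > 0\<close> as
  \<open>k\<close> grows, so these bumps approximate the indicator of the open box from
  below.\<close>

definition box_bump :: "real \<Rightarrow> 'a::euclidean_space \<Rightarrow> 'a \<Rightarrow> 'a \<Rightarrow> real" where
  "box_bump k a b x = (\<Prod>i\<in>Basis. flat_exp 0 (k * ((x - a) \<bullet> i)) * flat_exp 0 (k * ((b - x) \<bullet> i)))"

lemma box_bump_range: "0 \<le> box_bump k a b x" "box_bump k a b x \<le> 1"
  unfolding box_bump_def
  by (intro prod_nonneg mult_nonneg_nonneg flat_exp_0_range ballI)
     (intro prod_le_1 conjI mult_nonneg_nonneg mult_le_one flat_exp_0_range)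

lemma box_bump_zero:
  assumes k: "k > 0" and x: "x \<notin> box a b"
  shows "box_bump k a b x = 0"
proof -
  obtain i where i: "i \<in> Basis" "x \<bullet> i \<le> a \<bullet> i \<or> b \<bullet> i \<le> x \<bullet> i" using x by (auto simp: mem_box not_less)
  then have "k * ((x - a) \<bullet> i) \<le> 0 \<or> k * ((b - x) \<bullet> i) \<le> 0"
    using k by (auto simp: inner_diff_left mult_le_0_iff)
  then have "flat_exp 0 (k * ((x - a) \<bullet> i)) * flat_exp 0 (k * ((b - x) \<bullet> i)) = 0"
    by (auto simp: flat_exp_def)
  then show ?thesis unfolding box_bump_def using i(1) by (intro prod_zero) auto
qed

lemma Ck_box_bump: "Ck n UNIV (box_bump k a b)"
proof -
  have "(\<lambda>x. flat_exp 0 (k * ((x - a) \<bullet> i))) = (\<lambda>x. flat_exp 0 ((k *\<^sub>R i) \<bullet> x + (- k * (a \<bullet> i))))"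
    "(\<lambda>x. flat_exp 0 (k * ((b - x) \<bullet> i))) = (\<lambda>x. flat_exp 0 ((- k *\<^sub>R i) \<bullet> x + k * (b \<bullet> i)))" for i
    by (simp_all add: inner_diff_left inner_commute algebra_simps)
  then have "Ck n UNIV (\<lambda>x. flat_exp 0 (k * ((x - a) \<bullet> i)))" "Ck n UNIV (\<lambda>x. flat_exp 0 (k * ((b - x) \<bullet> i)))" for i
    using Ck_flat_exp[of n 0 "k *\<^sub>R i" "- k * (a \<bullet> i)"] Ck_flat_exp[of n 0 "- k *\<^sub>R i" "k * (b \<bullet> i)"]
    by (simp_all del: Ck.simps)
  then show ?thesis unfolding box_bump_def[abs_def] by (intro Ck_prod Ck_mult) auto
qed

lemma box_bump_test_function:
  assumes "k > 0" "cbox a b \<subseteq> D"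
  shows "box_bump k a b \<in> test_functions D"
proof -
  have "{x. box_bump k a b x \<noteq> 0} \<subseteq> cbox a b"
    using box_bump_zero[OF assms(1)] box_subset_cbox by blast
  then have c: "closure {x. box_bump k a b x \<noteq> 0} \<subseteq> cbox a b" by (rule closure_minimal) (rule closed_cbox)
  have "bounded (closure {x. box_bump k a b x \<noteq> 0})" by (rule bounded_subset[OF bounded_cbox c])
  then show ?thesis using c assms(2) Ck_box_bump by (auto simp: test_functions_def compact_eq_bounded_closed)
qed

lemma box_bump_tendsto:
  "(\<lambda>k. box_bump (real (Suc k)) a b x) \<longlonglongrightarrow> indicator (box a b) x"
proof (cases "x \<in> box a b")
  case True
  have 1: "(\<lambda>k. flat_exp 0 (real (Suc k) * t)) \<longlonglongrightarrow> 1" if "t > 0" for t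
  proof -
    have "(\<lambda>k. exp (- (1 / t * inverse (real (Suc k))))) \<longlonglongrightarrow> exp (- (1 / t * 0))"
      by (intro tendsto_exp tendsto_minus tendsto_mult tendsto_const LIMSEQ_inverse_real_of_nat)
    moreover have "exp (- (1 / t * inverse (real (Suc k)))) = flat_exp 0 (real (Suc k) * t)" for k
    proof -
      have "real (Suc k) * t > 0" using that by (intro mult_pos_pos) auto
      then show ?thesis by (simp add: flat_exp_def divide_inverse mult.commute del: of_nat_Suc)
    qed
    ultimately show ?thesis by simp
  qed
  have "(\<lambda>k. box_bump (real (Suc k)) a b x) \<longlonglongrightarrow> (\<Prod>i\<in>(Basis :: 'a set). 1 * 1)"
    unfolding box_bump_def
    by (intro tendsto_prod tendsto_mult 1) (use True in \<open>auto simp: mem_box inner_diff_left\<close>)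
  then show ?thesis using True by simp
qed (simp add: box_bump_zero)

text \<open>Open boxes form an intersection-stable generator of the Borel sets, so the integrals
  vanish over all Borel sets, then over Lebesgue sets, which differ from these by null sets. The
  support condition gives a vanishing total integral, used for complements.\<close>

lemma AE_zero_if_box_integrals_zero:
  fixes f :: "'a::euclidean_space \<Rightarrow> 'b::euclidean_space"
  assumes f: "integrable lebesgue f" and supp: "\<And>x. x \<notin> box c d \<Longrightarrow> f x = 0"
    and z: "\<And>a b. set_lebesgue_integral lebesgue (box a b) f = 0"
  shows "AE x in lebesgue. f x = 0"
proof -
  have total: "integral\<^sup>L lebesgue f = 0"
  proof -
    have "(\<lambda>x. indicator (box c d) x *\<^sub>R f x) = f" using supp by (auto simp: indicator_def fun_eq_iff)
    then show ?thesis using z[of c d] by (simp add: set_lebesgue_integral_def)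
  qed
  have si: "set_integrable lebesgue A f" if "A \<in> sets lebesgue" for A
    unfolding set_integrable_def by (rule integrable_mult_indicator[OF that f])
  have b: "set_lebesgue_integral lebesgue A f = 0" if A: "A \<in> sets borel" for A
  proof -
    have "Int_stable (range (\<lambda>(a, b). box a b :: 'a set))" by (auto simp: Int_stable_def box_Int_box)
    moreover have "range (\<lambda>(a, b). box a b :: 'a set) \<subseteq> Pow UNIV" by auto
    moreover have "A \<in> sigma_sets UNIV (range (\<lambda>(a, b). box a b))" using A unfolding borel_eq_box by simp
    ultimately show ?thesis
    proof (induction rule: sigma_sets_induct_disjoint)
      case (basic A) then show ?case using z by auto
    next
      case empty then show ?case by (simp add: set_lebesgue_integral_def)
    next
      case (compl A)
      then have "A \<in> sets borel" by (simp add: borel_eq_box)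
      then have A: "A \<in> sets lebesgue" by simp
      have "(\<lambda>x. indicator (UNIV - A) x *\<^sub>R f x) = (\<lambda>x. f x - indicator A x *\<^sub>R f x)"
        by (auto simp: indicator_def fun_eq_iff)
      then have "set_lebesgue_integral lebesgue (UNIV - A) f = integral\<^sup>L lebesgue f - set_lebesgue_integral lebesgue A f"
        unfolding set_lebesgue_integral_def
        by (simp only: Bochner_Integration.integral_diff[OF f integrable_mult_indicator[OF A f]])
      then show ?case using total compl by simp
    next
      case (union F)
      then have "F i \<in> sets borel" for i by (auto simp: borel_eq_box)
      then have F: "F i \<in> sets lebesgue" for i by simp
      have "set_lebesgue_integral lebesgue (\<Union>i. F i) f = (\<Sum>i. set_lebesgue_integral lebesgue (F i) f)"
        using F union(1) by (intro lebesgue_integral_countable_add si) (auto simp: disjoint_family_on_def)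
      then show ?case using union by simp
    qed
  qed
  have l: "set_lebesgue_integral lebesgue A f = 0" if A: "A \<in> sets lebesgue" for A
  proof -
    obtain S N N' where S: "S \<in> sets lborel" "A = S \<union> N" "N \<subseteq> N'" "N' \<in> null_sets lborel"
      using A by (rule sets_completionE)
    have N: "N \<in> null_sets lebesgue" by (rule null_sets_completion_subset[OF S(3) null_sets_completionI[OF S(4)]])
    have "AE x in lebesgue. indicator A x *\<^sub>R f x = indicator S x *\<^sub>R f x"
      using AE_not_in[OF N] by eventually_elim (auto simp: S(2) indicator_def)
    then have "set_lebesgue_integral lebesgue A f = set_lebesgue_integral lebesgue S f"
      unfolding set_lebesgue_integral_def
      by (rule integral_cong_AE[rotated 2, OF _ borel_measurable_integrable borel_measurable_integrable])
         (use S(1) A f in \<open>auto intro!: integrable_mult_indicator\<close>)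
    then show ?thesis using b S(1) by simp
  qed
  have "AE x in lebesgue. \<forall>e\<in>Basis. f x \<bullet> e = 0"
    unfolding AE_ball_countable[OF countable_finite[OF finite_Basis]]
  proof
    fix e :: 'b assume "e \<in> Basis"
    show "AE x in lebesgue. f x \<bullet> e = 0"
    proof (rule density_unique_real)
      show "integrable lebesgue (\<lambda>x. f x \<bullet> e)" by (rule integrable_inner_left) (use f in simp)
      show "integrable lebesgue (\<lambda>x. 0 :: real)" by simp
      fix A :: "'a set" assume A: "A \<in> sets lebesgue"
      have "(LINT x|lebesgue. (indicator A x *\<^sub>R f x) \<bullet> e) = set_lebesgue_integral lebesgue A f \<bullet> e"
        unfolding set_lebesgue_integral_def
        by (rule integral_inner_left) (use integrable_mult_indicator[OF A f] in simp)
      then show "set_lebesgue_integral lebesgue A (\<lambda>x. f x \<bullet> e) = set_lebesgue_integral lebesgue A (\<lambda>x. 0)"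
        by (simp add: set_lebesgue_integral_def l[OF A, unfolded set_lebesgue_integral_def])
    qed
  qed
  then show ?thesis by eventually_elim (rule euclidean_eqI, simp)
qed

text \<open>Fundamental lemma of the calculus of variations: smooth bumps converge to box
  indicators, dominated by the integrable function restricted to the closed box, and
  \<open>D\<close> is covered by countably many such boxes.\<close>

lemma AE_eq_if_test_integrals_eq:
  fixes G1 G2 :: "'a::euclidean_space \<Rightarrow> 'b::euclidean_space"
  assumes D: "open D" and G: "locally_integrable D G1" "locally_integrable D G2"
    and eq: "\<And>\<eta>. \<eta> \<in> test_functions D \<Longrightarrow>
      (LINT x|lebesgue_on D. \<eta> x *\<^sub>R G1 x) = (LINT x|lebesgue_on D. \<eta> x *\<^sub>R G2 x)"
  shows "AE x in lebesgue_on D. G1 x = G2 x"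
proof -
  have Dm: "D \<in> sets lebesgue" using D by (simp add: lborelD)
  have int: "integrable lebesgue (\<lambda>x. indicator (cbox a b) x *\<^sub>R G x)"
    if "locally_integrable D G" "cbox a b \<subseteq> D" for G :: "'a \<Rightarrow> 'b" and a b
    using that by (simp add: locally_integrable_def flip: integrable_restrict_space)
  have lim: "(\<lambda>k. LINT x|lebesgue_on D. box_bump (real (Suc k)) a b x *\<^sub>R G x) \<longlonglongrightarrow> set_lebesgue_integral lebesgue (box a b) G"
    if G: "locally_integrable D G" and ab: "cbox a b \<subseteq> D" for G :: "'a \<Rightarrow> 'b" and a b
  proof -
    let ?g = "\<lambda>x. indicator (cbox a b) x *\<^sub>R G x"
    note i = int[OF G ab]
    have cb: "continuous_on UNIV (box_bump k a b)" for k using Ck_box_bump[of 0 k a b] by simp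
    have mb: "box_bump k a b \<in> borel_measurable lebesgue" for k
    proof -
      have "box_bump k a b \<in> borel_measurable (lebesgue_on UNIV)"
        by (rule continuous_imp_measurable_on_sets_lebesgue[OF cb]) simp
      then show ?thesis by (simp only: lebesgue_on_UNIV_eq)
    qed
    have "(\<lambda>k. LINT x|lebesgue. box_bump (real (Suc k)) a b x *\<^sub>R ?g x) \<longlonglongrightarrow> (LINT x|lebesgue. indicator (box a b) x *\<^sub>R ?g x)"
    proof (rule integral_dominated_convergence[where w = "\<lambda>x. norm (?g x)"])
      show "(\<lambda>x. indicator (box a b) x *\<^sub>R ?g x) \<in> borel_measurable lebesgue"
        by (rule borel_measurable_integrable[OF integrable_mult_indicator[OF _ i]]) simp
      show "(\<lambda>x. box_bump (real (Suc k)) a b x *\<^sub>R ?g x) \<in> borel_measurable lebesgue" for k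
        by (intro borel_measurable_scaleR mb borel_measurable_integrable[OF i])
      show "integrable lebesgue (\<lambda>x. norm (?g x))" by (rule integrable_norm[OF i])
      show "AE x in lebesgue. (\<lambda>k. box_bump (real (Suc k)) a b x *\<^sub>R ?g x) \<longlonglongrightarrow> indicator (box a b) x *\<^sub>R ?g x"
        by (intro AE_I2 tendsto_scaleR box_bump_tendsto tendsto_const)
      show "AE x in lebesgue. norm (box_bump (real (Suc k)) a b x *\<^sub>R ?g x) \<le> norm (?g x)" for k
        unfolding norm_scaleR using box_bump_range[of "real (Suc k)" a b] by (intro AE_I2 mult_left_le_one_le) auto
    qed
    moreover have "(LINT x|lebesgue. box_bump (real (Suc k)) a b x *\<^sub>R ?g x) = (LINT x|lebesgue_on D. box_bump (real (Suc k)) a b x *\<^sub>R G x)" for k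
    proof -
      have "box_bump (real (Suc k)) a b x *\<^sub>R ?g x = indicator D x *\<^sub>R (box_bump (real (Suc k)) a b x *\<^sub>R G x)" for x
        using box_bump_zero[of "real (Suc k)" x a b] box_subset_cbox[of a b] ab by (auto simp: indicator_def)
      then have "(LINT x|lebesgue. box_bump (real (Suc k)) a b x *\<^sub>R ?g x) =
          (LINT x|lebesgue. indicator D x *\<^sub>R (box_bump (real (Suc k)) a b x *\<^sub>R G x))" by (simp only:)
      also have "\<dots> = (LINT x|lebesgue_on D. box_bump (real (Suc k)) a b x *\<^sub>R G x)"
        by (rule integral_restrict_space[symmetric]) (use Dm in simp)
      finally show ?thesis .
    qed
    moreover have "indicator (box a b) x *\<^sub>R ?g x = indicator (box a b) x *\<^sub>R G x" for x
      using box_subset_cbox[of a b] by (auto simp: indicator_def)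
    ultimately show ?thesis unfolding set_lebesgue_integral_def by (simp only:)
  qed
  have box_eq: "set_lebesgue_integral lebesgue (box a b) G1 = set_lebesgue_integral lebesgue (box a b) G2"
    if "cbox a b \<subseteq> D" for a b
  proof (rule LIMSEQ_unique[OF lim[OF G(1) that]])
    have "(\<lambda>k. LINT x|lebesgue_on D. box_bump (real (Suc k)) a b x *\<^sub>R G1 x) =
        (\<lambda>k. LINT x|lebesgue_on D. box_bump (real (Suc k)) a b x *\<^sub>R G2 x)"
      by (rule ext) (rule eq[OF box_bump_test_function[OF _ that]], simp)
    then show "(\<lambda>k. LINT x|lebesgue_on D. box_bump (real (Suc k)) a b x *\<^sub>R G1 x) \<longlonglongrightarrow> set_lebesgue_integral lebesgue (box a b) G2"
      using lim[OF G(2) that] by simp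
  qed
  have loc: "AE x in lebesgue. x \<in> box c d \<longrightarrow> G1 x = G2 x" if cd: "cbox c d \<subseteq> D" for c d
  proof -
    let ?f = "\<lambda>x. indicator (box c d) x *\<^sub>R (G1 x - G2 x)"
    have fi: "integrable lebesgue (\<lambda>x. indicator (box a b) x *\<^sub>R Gi x)" if "locally_integrable D Gi" "cbox a b \<subseteq> D" for Gi :: "'a \<Rightarrow> 'b" and a b
    proof -
      have "integrable lebesgue (\<lambda>x. indicator (box a b) x *\<^sub>R (indicator (cbox a b) x *\<^sub>R Gi x))"
        by (rule integrable_mult_indicator[OF _ int[OF that]]) simp
      moreover have "indicator (box a b) x *\<^sub>R (indicator (cbox a b) x *\<^sub>R Gi x) = indicator (box a b) x *\<^sub>R Gi x" for x
        using box_subset_cbox[of a b] by (auto simp: indicator_def)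
      ultimately show ?thesis by (simp only:)
    qed
    have "AE x in lebesgue. ?f x = 0"
    proof (rule AE_zero_if_box_integrals_zero[of _ c d])
      have "integrable lebesgue (\<lambda>x. indicator (box c d) x *\<^sub>R G1 x - indicator (box c d) x *\<^sub>R G2 x)"
        by (intro Bochner_Integration.integrable_diff fi G cd)
      then show "integrable lebesgue ?f" by (simp add: scaleR_diff_right)
      show "?f x = 0" if "x \<notin> box c d" for x using that by simp
      fix a b :: 'a
      \<comment> \<open>Intersecting with the fixed box gives again a box, whose closure lies in
        \<open>D\<close> unless it is empty, so \<open>box_eq\<close> applies.\<close>
      obtain a' b' where i: "box a b \<inter> box c d = box a' b'" by (rule that[OF box_Int_box])
      have eqf: "indicator (box a b) x *\<^sub>R ?f x = indicator (box a' b') x *\<^sub>R G1 x - indicator (box a' b') x *\<^sub>R G2 x" for x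
        unfolding i[symmetric] by (auto simp: indicator_def)
      show "set_lebesgue_integral lebesgue (box a b) ?f = 0"
      proof (cases "box a' b' = {}")
        case True
        then show ?thesis unfolding set_lebesgue_integral_def eqf by simp
      next
        case False
        have "closure (box a' b') \<subseteq> closure (box c d)" using i by (intro closure_mono) blast
        moreover have "box c d \<noteq> {}" using i False by blast
        ultimately have ab': "cbox a' b' \<subseteq> D" using False cd by (simp add: closure_box)
        have "set_lebesgue_integral lebesgue (box a b) ?f = set_lebesgue_integral lebesgue (box a' b') G1 - set_lebesgue_integral lebesgue (box a' b') G2"
          unfolding set_lebesgue_integral_def eqf by (rule Bochner_Integration.integral_diff[OF fi[OF G(1) ab'] fi[OF G(2) ab']])
        then show ?thesis using box_eq[OF ab'] by simp
      qed
    qed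
    then show ?thesis by eventually_elim (auto simp: indicator_def)
  qed
  define \<F> where "\<F> = {X. \<exists>a b. X = box a b \<and> cbox a b \<subseteq> D}"
  obtain \<F>' where F': "\<F>' \<subseteq> \<F>" "countable \<F>'" "\<Union>\<F>' = \<Union>\<F>"
    by (rule Lindelof[of \<F>]) (auto simp: \<F>_def)
  have cover: "D \<subseteq> \<Union>\<F>"
  proof
    fix x assume "x \<in> D"
    then obtain e where e: "e > 0" "cball x e \<subseteq> D" using D open_contains_cball by blast
    obtain a b where ab: "x \<in> box a b" "box a b \<subseteq> ball x e" using rational_boxes[OF e(1), of x] by blast
    have "closure (box a b) \<subseteq> cball x e"
      using ab(2) ball_subset_cball[of x e] by (intro closure_minimal) auto
    moreover have "closure (box a b) = cbox a b" using ab(1) by (intro closure_box) blast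
    ultimately have "cbox a b \<subseteq> D" using e(2) by (simp only: subset_trans)
    then show "x \<in> \<Union>\<F>" using ab(1) by (auto simp: \<F>_def)
  qed
  have "AE x in lebesgue. \<forall>X\<in>\<F>'. x \<in> X \<longrightarrow> G1 x = G2 x"
    unfolding AE_ball_countable[OF F'(2)]
  proof
    fix X assume "X \<in> \<F>'"
    then obtain a b where "X = box a b" "cbox a b \<subseteq> D" using F'(1) by (auto simp: \<F>_def)
    then show "AE x in lebesgue. x \<in> X \<longrightarrow> G1 x = G2 x" using loc by simp
  qed
  then have "AE x in lebesgue. x \<in> D \<longrightarrow> G1 x = G2 x"
    by eventually_elim (use cover F'(3) in blast)
  then show ?thesis using Dm by (simp add: AE_restrict_space_iff)
qed

text \<open>Completeness of Lebesgue measure. It transfers measurability to expressions containing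
  the chosen representative \<open>weak_gradient\<close>.\<close>

lemma borel_measurable_lebesgue_on_AE:
  fixes f g :: "'a::euclidean_space \<Rightarrow> 'b::euclidean_space"
  assumes D: "D \<in> sets lebesgue" and f: "f \<in> borel_measurable (lebesgue_on D)"
    and ae: "AE x in lebesgue_on D. f x = g x"
  shows "g \<in> borel_measurable (lebesgue_on D)"
proof -
  have D': "D \<inter> space lebesgue \<in> sets lebesgue" using D by simp
  have "AE x in lebesgue. x \<in> D \<longrightarrow> f x = g x" using ae D by (simp add: AE_restrict_space_iff)
  then have ae': "AE x in lebesgue. indicator D x *\<^sub>R f x = indicator D x *\<^sub>R g x"
    by eventually_elim (auto simp: indicator_def)
  have "(\<lambda>x. indicator D x *\<^sub>R f x) \<in> borel_measurable lebesgue"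
    using f by (simp only: borel_measurable_restrict_space_iff[OF D'])
  then have "(\<lambda>x. indicator D x *\<^sub>R g x) \<in> borel_measurable lebesgue"
    by (rule borel_measurable_AE[of _ "\<lambda>x. indicator D x *\<^sub>R g x", OF _ ae'])
  then show ?thesis by (simp only: borel_measurable_restrict_space_iff[OF D'])
qed

section \<open>Compactly supported integrands and weak gradients of C^1 functions\<close>

lemma continuous_locally_integrable:
  fixes f :: "'a::euclidean_space \<Rightarrow> 'b::euclidean_space"
  assumes f: "continuous_on UNIV f"
  shows "locally_integrable D f"
  unfolding locally_integrable_def
proof (intro allI impI)
  fix K :: "'a set" assume K: "compact K"
  obtain a b where ab: "K \<subseteq> cbox a b"
    using bounded_subset_cbox_symmetric[OF compact_imp_bounded[OF K]] by metis
  have Km: "K \<in> sets lebesgue" using K by (simp add: compact_imp_closed lborelD)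
  have "integrable (lebesgue_on (cbox a b)) f"
    by (rule continuous_imp_integrable[OF continuous_on_subset[OF f subset_UNIV]])
  then have "integrable lebesgue (\<lambda>x. indicator (cbox a b) x *\<^sub>R f x)" by (simp add: integrable_restrict_space)
  from integrable_mult_indicator[OF Km this]
  have "integrable lebesgue (\<lambda>x. indicator K x *\<^sub>R (indicator (cbox a b) x *\<^sub>R f x))" .
  moreover have "indicator K x *\<^sub>R (indicator (cbox a b) x *\<^sub>R f x) = indicator K x *\<^sub>R f x" for x
    using ab by (auto simp: indicator_def)
  ultimately have "integrable lebesgue (\<lambda>x. indicator K x *\<^sub>R f x)" by (simp only:)
  moreover have "K \<inter> space lebesgue \<in> sets lebesgue" using Km by simp
  ultimately show "integrable (lebesgue_on K) f" by (simp only: integrable_restrict_space)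
qed

text \<open>Passage from the Bochner integral over \<open>D\<close>, in which the notions of
  solution are phrased, to the gauge integral over the whole space, in which the integrations by
  parts are done.\<close>

lemma lebesgue_integral_compact_support:
  fixes f :: "'a::euclidean_space \<Rightarrow> 'b::euclidean_space"
  assumes D: "D \<in> sets lebesgue" and K: "compact K" "K \<subseteq> D"
    and f: "f \<in> borel_measurable (lebesgue_on D)" "\<And>x. x \<notin> K \<Longrightarrow> f x = 0" "\<And>x. norm (f x) \<le> B"
  shows "integrable (lebesgue_on D) f" "integral\<^sup>L (lebesgue_on D) f = integral UNIV f"
proof -
  have D': "D \<inter> space lebesgue \<in> sets lebesgue" using D by simp
  have fD: "(\<lambda>x. indicator D x *\<^sub>R f x) = f" using f(2) K(2) by (auto simp: indicator_def fun_eq_iff)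
  have m: "f \<in> borel_measurable lebesgue"
    using borel_measurable_restrict_space_iff[OF D', THEN iffD1, OF f(1)] unfolding fD .
  have Km: "K \<in> sets lebesgue" using K by (simp add: compact_imp_closed lborelD)
  have fin: "emeasure lebesgue K < \<infinity>"
    using emeasure_compact_finite[OF K(1)] K(1) by (simp add: compact_imp_closed)
  have i: "integrable lebesgue f"
    by (rule integrableI_bounded_set[OF Km m fin, of B]) (use f in auto)
  then show "integrable (lebesgue_on D) f" by (intro integrable_restrict_space[OF D', THEN iffD2]) (simp only: fD)
  have "integral\<^sup>L (lebesgue_on D) f = integral\<^sup>L lebesgue f" unfolding integral_restrict_space[OF D'] fD ..
  also have "\<dots> = integral UNIV f" by (rule integral_lebesgue[OF i, symmetric])
  finally show "integral\<^sup>L (lebesgue_on D) f = integral UNIV f" .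
qed

lemma test_functionD:
  fixes \<eta> :: "'a::euclidean_space \<Rightarrow> real"
  assumes "\<eta> \<in> test_functions D"
  shows "(\<eta> has_derivative (\<lambda>h. gradient \<eta> x \<bullet> h)) (at x)" "continuous_on UNIV (gradient \<eta>)" "continuous_on UNIV \<eta>"
    and "compact (closure {x. \<eta> x \<noteq> 0})" "closure {x. \<eta> x \<noteq> 0} \<subseteq> D"
    and "x \<notin> closure {x. \<eta> x \<noteq> 0} \<Longrightarrow> \<eta> x = 0" "x \<notin> closure {x. \<eta> x \<noteq> 0} \<Longrightarrow> gradient \<eta> x = 0"
proof -
  have C: "Ck k UNIV \<eta>" for k using assms unfolding test_functions_def by blast
  note g = Ck_1_gradient[OF C[of 1]]
  show d: "(\<eta> has_derivative (\<lambda>h. gradient \<eta> x \<bullet> h)) (at x)" for x by (rule g(1)) simp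
  show "continuous_on UNIV (gradient \<eta>)" by (rule g(2))
  show "continuous_on UNIV \<eta>" using C[of 0] by simp
  show "compact (closure {x. \<eta> x \<noteq> 0})" "closure {x. \<eta> x \<noteq> 0} \<subseteq> D"
    using assms unfolding test_functions_def by blast+
  show z: "\<eta> x = 0" if "x \<notin> closure {x. \<eta> x \<noteq> 0}" for x
    using that subsetD[OF closure_subset, of x "{x. \<eta> x \<noteq> 0}"] by auto
  show "gradient \<eta> x = 0" if x: "x \<notin> closure {x. \<eta> x \<noteq> 0}"
  proof -
    have "open (- closure {x. \<eta> x \<noteq> 0})" by (intro open_Compl closed_closure)
    have "(\<eta> has_derivative (\<lambda>h. 0)) (at x)"
    proof (rule has_derivative_transform_within_open[OF has_derivative_const[of 0] \<open>open _\<close>])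
      show "x \<in> - closure {x. \<eta> x \<noteq> 0}" using x by (simp only: Compl_iff not_False_eq_True)
      show "0 = \<eta> y" if "y \<in> - closure {x. \<eta> x \<noteq> 0}" for y by (rule z[OF ComplD[OF that], symmetric])
    qed
    then have "(\<eta> has_derivative (\<lambda>h. 0 \<bullet> h)) (at x)" by (simp only: inner_zero_left)
    then show ?thesis by (rule gradient_unique)
  qed
qed

lemma bounded_of_compact_support:
  fixes f :: "'a::euclidean_space \<Rightarrow> 'b::real_normed_vector"
  assumes "compact K" "continuous_on K f" "\<And>x. x \<notin> K \<Longrightarrow> f x = 0"
  obtains B where "\<And>x. norm (f x) \<le> B" "0 \<le> B"
proof -
  have "bounded (f ` K)" by (rule compact_imp_bounded[OF compact_continuous_image[OF assms(2,1)]])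
  then obtain B where B: "\<forall>y\<in>f ` K. norm y \<le> B" unfolding bounded_iff by blast
  show thesis
  proof (rule that)
    show "norm (f x) \<le> \<bar>B\<bar>" for x using B assms(3)[of x] by (cases "x \<in> K") force+
  qed simp
qed

text \<open>Componentwise the two integrands add up to a partial derivative of
  \<open>h x * \<eta> x\<close>, which has compact support.\<close>

lemma has_weak_gradient_C1:
  fixes h :: "'a::euclidean_space \<Rightarrow> real"
  assumes D: "open D" and h: "\<And>x. (h has_derivative (\<lambda>k. G x \<bullet> k)) (at x)" and G: "continuous_on UNIV G"
  shows "has_weak_gradient D h G"
proof -
  have Dm: "D \<in> sets lebesgue" using D by (simp add: lborelD)
  have ch: "continuous_on UNIV h"
    using h by (meson continuous_on_eq_continuous_within has_derivative_continuous continuous_at_imp_continuous_at_within)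
  have "(LINT x|lebesgue_on D. h x *\<^sub>R gradient \<eta> x) = - (LINT x|lebesgue_on D. \<eta> x *\<^sub>R G x)"
    if \<eta>: "\<eta> \<in> test_functions D" for \<eta>
  proof -
    define K where "K = closure {x. \<eta> x \<noteq> 0}"
    note t = test_functionD[OF \<eta>, folded K_def]
    obtain R where R: "\<And>x. x \<in> K \<Longrightarrow> norm x \<le> R"
      using compact_imp_bounded[OF t(4)] unfolding bounded_iff by blast
    have cs: "f integrable_on UNIV" "integral\<^sup>L (lebesgue_on D) f = integral UNIV f"
      if f: "continuous_on UNIV f" "\<And>x. x \<notin> K \<Longrightarrow> f x = 0" for f :: "'a \<Rightarrow> 'a"
    proof -
      obtain B where B: "\<And>x. norm (f x) \<le> B"
        using bounded_of_compact_support[OF t(4) continuous_on_subset[OF f(1) subset_UNIV] f(2)] by blast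
      have "f \<in> borel_measurable (lebesgue_on D)"
        by (rule continuous_imp_measurable_on_sets_lebesgue[OF continuous_on_subset[OF f(1) subset_UNIV] Dm])
      from lebesgue_integral_compact_support(2)[OF Dm t(4,5) this f(2) B]
      show "integral\<^sup>L (lebesgue_on D) f = integral UNIV f" .
      have "f x = 0" if "x \<notin> cbox (0 - R *\<^sub>R One) (0 + R *\<^sub>R One)" for x
      proof (rule f(2))
        show "x \<notin> K" using outside_centered_cbox[OF that] R[of x] by auto
      qed
      then show "f integrable_on UNIV"
        by (rule integrable_compact_support(2)[OF continuous_on_subset[OF f(1) subset_UNIV]])
    qed
    have c1: "continuous_on UNIV (\<lambda>x. h x *\<^sub>R gradient \<eta> x)" and c2: "continuous_on UNIV (\<lambda>x. \<eta> x *\<^sub>R G x)"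
      by (intro continuous_intros ch G t)+
    have i1: "(\<lambda>x. h x *\<^sub>R gradient \<eta> x) integrable_on UNIV"
      "(LINT x|lebesgue_on D. h x *\<^sub>R gradient \<eta> x) = integral UNIV (\<lambda>x. h x *\<^sub>R gradient \<eta> x)"
      using cs[OF c1] t(7) by simp_all
    have i2: "(\<lambda>x. \<eta> x *\<^sub>R G x) integrable_on UNIV"
      "(LINT x|lebesgue_on D. \<eta> x *\<^sub>R G x) = integral UNIV (\<lambda>x. \<eta> x *\<^sub>R G x)"
      using cs[OF c2] t(6) by simp_all
    have "integral UNIV (\<lambda>x. h x *\<^sub>R gradient \<eta> x + \<eta> x *\<^sub>R G x) = 0"
    proof (rule euclidean_eqI)
      fix b :: 'a assume "b \<in> Basis"
      have "integral UNIV (\<lambda>x. h x * (gradient \<eta> x \<bullet> b) + (G x \<bullet> b) * \<eta> x) = 0"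
      proof (rule integral_derivative_compact_support[of "\<lambda>x. h x * \<eta> x" "\<lambda>x k. h x * (gradient \<eta> x \<bullet> k) + (G x \<bullet> k) * \<eta> x" b R])
        show "((\<lambda>x. h x * \<eta> x) has_derivative (\<lambda>k. h x * (gradient \<eta> x \<bullet> k) + (G x \<bullet> k) * \<eta> x)) (at x)" for x
          by (rule has_derivative_mult[OF h t(1)])
        show "continuous_on UNIV (\<lambda>x. h x * (gradient \<eta> x \<bullet> b) + (G x \<bullet> b) * \<eta> x)"
          by (intro continuous_intros ch G t)
        show "h x * \<eta> x = 0" if "R < norm x" for x
        proof -
          have "x \<notin> K" using R[of x] that by auto
          then show ?thesis by (simp add: t(6))
        qed
      qed
      then show "integral UNIV (\<lambda>x. h x *\<^sub>R gradient \<eta> x + \<eta> x *\<^sub>R G x) \<bullet> b = 0 \<bullet> b"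
        using integral_component_eq[OF Henstock_Kurzweil_Integration.integrable_add[OF i1(1) i2(1)], of b]
        by (simp add: inner_add_left mult.commute)
    qed
    then have "integral UNIV (\<lambda>x. h x *\<^sub>R gradient \<eta> x) + integral UNIV (\<lambda>x. \<eta> x *\<^sub>R G x) = 0"
      by (simp add: Henstock_Kurzweil_Integration.integral_add[OF i1(1) i2(1)])
    then show ?thesis unfolding i1(2) i2(2) by (rule add_eq_0_iff2[THEN iffD1])
  qed
  then show ?thesis unfolding has_weak_gradient_def using continuous_locally_integrable[OF ch] continuous_locally_integrable[OF G] by blast
qed

lemma weak_gradient_unique:
  assumes D: "open D" and G: "has_weak_gradient D u G1" "has_weak_gradient D u G2"
  shows "AE x in lebesgue_on D. G1 x = G2 x"
proof (rule AE_eq_if_test_integrals_eq[OF D])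
  show "locally_integrable D G1" "locally_integrable D G2" using G by (auto simp: has_weak_gradient_def)
  fix \<eta> assume "\<eta> \<in> test_functions D"
  then have "- (LINT x|lebesgue_on D. \<eta> x *\<^sub>R G1 x) = - (LINT x|lebesgue_on D. \<eta> x *\<^sub>R G2 x)"
    using G unfolding has_weak_gradient_def by metis
  then show "(LINT x|lebesgue_on D. \<eta> x *\<^sub>R G1 x) = (LINT x|lebesgue_on D. \<eta> x *\<^sub>R G2 x)" by simp
qed

lemma weak_gradient_AE:
  assumes "open D" "has_weak_gradient D u G"
  shows "AE x in lebesgue_on D. weak_gradient D u x = G x"
proof -
  have "has_weak_gradient D u (weak_gradient D u)"
    unfolding weak_gradient_def by (rule someI[of "has_weak_gradient D u", OF assms(2)])
  from weak_gradient_unique[OF assms(1) this assms(2)] show ?thesis .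
qed

lemma locally_integrable_diff:
  "locally_integrable D f \<Longrightarrow> locally_integrable D g \<Longrightarrow> locally_integrable D (\<lambda>x. f x - g x)"
  by (simp add: locally_integrable_def)

text \<open>The product is a general bilinear map so as to cover both
  \<open>f x *\<^sub>R gradient \<eta> x\<close> and \<open>\<eta> x *\<^sub>R f x\<close>.\<close>

lemma integrable_product_compact_support:
  fixes \<zeta> :: "'a::euclidean_space \<Rightarrow> 'b::euclidean_space" and f :: "'a \<Rightarrow> 'c::euclidean_space"
    and prod :: "'b \<Rightarrow> 'c \<Rightarrow> 'd::euclidean_space"
  assumes D: "D \<in> sets lebesgue" and K: "compact K" "K \<subseteq> D" and z: "continuous_on UNIV \<zeta>" "\<And>x. x \<notin> K \<Longrightarrow> \<zeta> x = 0"
    and f: "locally_integrable D f" and bb: "bounded_bilinear prod"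
  shows "integrable (lebesgue_on D) (\<lambda>x. prod (\<zeta> x) (f x))"
proof -
  interpret bounded_bilinear prod by fact
  have D': "D \<inter> space lebesgue \<in> sets lebesgue" using D by simp
  have Km: "K \<in> sets lebesgue" using K by (simp add: compact_imp_closed lborelD)
  have fi: "integrable lebesgue (\<lambda>x. indicator K x *\<^sub>R f x)"
    using f K Km by (simp add: locally_integrable_def flip: integrable_restrict_space)
  obtain B where B: "\<And>x. norm (\<zeta> x) \<le> B" "0 \<le> B"
    using bounded_of_compact_support[OF K(1) continuous_on_subset[OF z(1) subset_UNIV] z(2)] by blast
  obtain C where C: "\<And>a b. norm (prod a b) \<le> norm a * norm b * C" "0 \<le> C" using nonneg_bounded by blast
  have zm: "\<zeta> \<in> borel_measurable lebesgue"
  proof -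
    have "\<zeta> \<in> borel_measurable (lebesgue_on UNIV)" by (rule continuous_imp_measurable_on_sets_lebesgue[OF z(1)]) simp
    then show ?thesis by (simp only: lebesgue_on_UNIV_eq)
  qed
  have cp: "continuous_on UNIV (\<lambda>y. prod (fst y) (snd y))"
    by (intro continuous_on continuous_on_fst continuous_on_snd continuous_on_id)
  have "(\<lambda>x. prod (\<zeta> x) (indicator K x *\<^sub>R f x)) \<in> borel_measurable lebesgue"
    using borel_measurable_continuous_Pair[OF zm borel_measurable_integrable[OF fi], of prod] cp by simp
  then have "integrable lebesgue (\<lambda>x. prod (\<zeta> x) (indicator K x *\<^sub>R f x))"
  proof (rule Bochner_Integration.integrable_bound[OF integrable_mult_right[OF integrable_norm[OF fi], of "B * C"]])
    show "AE x in lebesgue. norm (prod (\<zeta> x) (indicator K x *\<^sub>R f x)) \<le> norm (B * C * norm (indicator K x *\<^sub>R f x))"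
    proof (rule AE_I2)
      fix x
      have "norm (\<zeta> x) * norm (indicator K x *\<^sub>R f x) * C \<le> B * norm (indicator K x *\<^sub>R f x) * C"
        using B C by (intro mult_right_mono) auto
      then have "norm (prod (\<zeta> x) (indicator K x *\<^sub>R f x)) \<le> B * norm (indicator K x *\<^sub>R f x) * C"
        using C(1) order_trans by blast
      then show "norm (prod (\<zeta> x) (indicator K x *\<^sub>R f x)) \<le> norm (B * C * norm (indicator K x *\<^sub>R f x))"
        using B C by (simp add: abs_mult mult_ac)
    qed
  qed
  moreover have "prod (\<zeta> x) (indicator K x *\<^sub>R f x) = indicator D x *\<^sub>R prod (\<zeta> x) (f x)" for x
    using K(2) z(2)[of x] zero_left zero_right by (cases "x \<in> K") auto
  ultimately show ?thesis unfolding integrable_restrict_space[OF D'] by (simp only:)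
qed

lemma has_weak_gradient_diff:
  fixes u v :: "'a::euclidean_space \<Rightarrow> real"
  assumes D: "open D" and u: "has_weak_gradient D u F" and v: "has_weak_gradient D v G"
  shows "has_weak_gradient D (\<lambda>x. u x - v x) (\<lambda>x. F x - G x)"
  unfolding has_weak_gradient_def
proof (intro conjI ballI)
  have Dm: "D \<in> sets lebesgue" using D by (simp add: lborelD)
  have l: "locally_integrable D u" "locally_integrable D v" "locally_integrable D F" "locally_integrable D G"
    using u v by (auto simp: has_weak_gradient_def)
  show "locally_integrable D (\<lambda>x. u x - v x)" "locally_integrable D (\<lambda>x. F x - G x)"
    by (intro locally_integrable_diff l)+
  fix \<eta> assume \<eta>: "\<eta> \<in> test_functions D"
  note t = test_functionD[OF \<eta>]
  have i1: "integrable (lebesgue_on D) (\<lambda>x. f x *\<^sub>R gradient \<eta> x)" if "locally_integrable D f" for f :: "'a \<Rightarrow> real"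
    by (rule integrable_product_compact_support[OF Dm t(4,5) t(2) t(7) that, of "\<lambda>g y. y *\<^sub>R g"])
       (auto intro: bounded_bilinear.flip[OF bounded_bilinear_scaleR])
  have i2: "integrable (lebesgue_on D) (\<lambda>x. \<eta> x *\<^sub>R f x)" if "locally_integrable D f" for f :: "'a \<Rightarrow> 'a"
    by (rule integrable_product_compact_support[OF Dm t(4,5) t(3) t(6) that bounded_bilinear_scaleR])
  show "(LINT x|lebesgue_on D. (u x - v x) *\<^sub>R gradient \<eta> x) = - (LINT x|lebesgue_on D. \<eta> x *\<^sub>R (F x - G x))"
    unfolding scaleR_diff_left scaleR_diff_right Bochner_Integration.integral_diff[OF i1[OF l(1)] i1[OF l(2)]]
      Bochner_Integration.integral_diff[OF i2[OF l(3)] i2[OF l(4)]]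
    using u v \<eta> unfolding has_weak_gradient_def by simp
qed

section \<open>Classical solutions are distributional solutions\<close>

lemma H_dp_nonneg: "0 \<le> a x \<Longrightarrow> 0 \<le> H_dp p q a x z"
  by (simp add: H_dp_def)

lemma LH_bounded_continuous:
  fixes f :: "'a::euclidean_space \<Rightarrow> 'b::euclidean_space"
  assumes D: "open D" "bounded D" and a: "\<And>x. x \<in> D \<Longrightarrow> 0 \<le> a x" "\<And>x. x \<in> D \<Longrightarrow> a x \<le> m"
    and p: "0 \<le> p" "0 \<le> q" and f: "continuous_on UNIV f"
  shows "f \<in> LH p q a D"
proof -
  have Dm: "D \<in> sets lebesgue" using D by (simp add: lborelD)
  have "compact (closure D)" using D(2) by simp
  then have "bounded (f ` closure D)"
    by (intro compact_imp_bounded compact_continuous_image continuous_on_subset[OF f subset_UNIV])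
  then obtain B where "\<forall>y\<in>f ` closure D. norm y \<le> B" unfolding bounded_iff by blast
  then have B: "norm (f x) \<le> B" if "x \<in> D" for x using that closure_subset by blast
  have "(\<integral>\<^sup>+x. ennreal (H_dp p q a x (f x)) \<partial>lebesgue_on D) \<le> (\<integral>\<^sup>+x. ennreal (B powr p + m * B powr q) \<partial>lebesgue_on D)"
  proof (rule nn_integral_mono)
    fix x assume "x \<in> space (lebesgue_on D)"
    then have x: "x \<in> D" by simp
    have "norm (f x) powr s \<le> B powr s" if "0 \<le> s" for s using B[OF x] that by (intro powr_mono2) auto
    then have "H_dp p q a x (f x) \<le> B powr p + m * B powr q"
      unfolding H_dp_def using p a(1)[OF x] a(2)[OF x] by (intro add_mono mult_mono) auto
    then show "ennreal (H_dp p q a x (f x)) \<le> ennreal (B powr p + m * B powr q)" by (rule ennreal_leI)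
  qed
  also have "\<dots> = ennreal (B powr p + m * B powr q) * emeasure (lebesgue_on D) D" by (simp add: nn_integral_const)
  also have "emeasure (lebesgue_on D) D = emeasure lborel D" using D Dm by (simp add: emeasure_restrict_space)
  also have "ennreal (B powr p + m * B powr q) * emeasure lborel D < \<infinity>"
    using emeasure_bounded_finite[OF D(2)] by (simp add: ennreal_mult_less_top)
  finally show ?thesis
    using continuous_imp_measurable_on_sets_lebesgue[OF continuous_on_subset[OF f subset_UNIV] Dm] by (simp add: LH_def)
qed

lemma H_dp_measurable:
  assumes "D \<in> sets lebesgue" "continuous_on D a" "f \<in> borel_measurable (lebesgue_on D)"
  shows "(\<lambda>x. H_dp p q a x (f x)) \<in> borel_measurable (lebesgue_on D)"
  unfolding H_dp_def using assms(3) continuous_imp_measurable_on_sets_lebesgue[OF assms(2,1)]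
  by (intro borel_measurable_add borel_measurable_times powr_real_measurable measurable_compose[OF _ borel_measurable_norm] borel_measurable_const)

lemma LH_diff:
  fixes u v :: "'a::euclidean_space \<Rightarrow> 'b::euclidean_space"
  assumes D: "D \<in> sets lebesgue" and a: "continuous_on D a" "\<And>x. x \<in> D \<Longrightarrow> 0 \<le> a x" and p: "0 \<le> p" "p \<le> q"
    and u: "u \<in> LH p q a D" and v: "v \<in> LH p q a D"
  shows "(\<lambda>x. u x - v x) \<in> LH p q a D"
proof -
  have m: "u \<in> borel_measurable (lebesgue_on D)" "v \<in> borel_measurable (lebesgue_on D)" using u v by (auto simp: LH_def)
  \<comment> \<open>The difference is at most twice the larger norm, and \<open>2 powr q\<close>
    serves both exponents because \<open>s \<le> q\<close>.\<close>
  have pw: "norm (y - z) powr s \<le> 2 powr q * (norm y powr s + norm z powr s)" if s: "0 \<le> s" "s \<le> q" for y z :: 'b and s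
  proof -
    have "norm (y - z) \<le> 2 * max (norm y) (norm z)" using norm_triangle_ineq4[of y z] by linarith
    then have "norm (y - z) powr s \<le> (2 * max (norm y) (norm z)) powr s" using s by (intro powr_mono2) auto
    also have "\<dots> = 2 powr s * max (norm y) (norm z) powr s" by (simp add: powr_mult)
    also have "\<dots> \<le> 2 powr q * (norm y powr s + norm z powr s)"
      using s by (intro mult_mono powr_mono) (auto simp: max_def)
    finally show ?thesis .
  qed
  have "(\<integral>\<^sup>+x. ennreal (H_dp p q a x (u x - v x)) \<partial>lebesgue_on D) \<le>
      (\<integral>\<^sup>+x. ennreal (2 powr q) * (ennreal (H_dp p q a x (u x)) + ennreal (H_dp p q a x (v x))) \<partial>lebesgue_on D)"
  proof (rule nn_integral_mono)
    fix x assume "x \<in> space (lebesgue_on D)"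
    then have ax: "0 \<le> a x" using a by simp
    have "H_dp p q a x (u x - v x) \<le> 2 powr q * (norm (u x) powr p + norm (v x) powr p) + a x * (2 powr q * (norm (u x) powr q + norm (v x) powr q))"
      unfolding H_dp_def using p ax by (intro add_mono mult_left_mono pw) auto
    also have "\<dots> = 2 powr q * (H_dp p q a x (u x) + H_dp p q a x (v x))" by (simp add: H_dp_def algebra_simps)
    finally have "ennreal (H_dp p q a x (u x - v x)) \<le> ennreal (2 powr q * (H_dp p q a x (u x) + H_dp p q a x (v x)))" by (rule ennreal_leI)
    then show "ennreal (H_dp p q a x (u x - v x)) \<le> ennreal (2 powr q) * (ennreal (H_dp p q a x (u x)) + ennreal (H_dp p q a x (v x)))"
      using ax by (simp add: ennreal_mult ennreal_plus H_dp_nonneg)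
  qed
  also have "\<dots> = ennreal (2 powr q) * ((\<integral>\<^sup>+x. ennreal (H_dp p q a x (u x)) \<partial>lebesgue_on D) + (\<integral>\<^sup>+x. ennreal (H_dp p q a x (v x)) \<partial>lebesgue_on D))"
    using H_dp_measurable[OF D a(1) m(1), of p q] H_dp_measurable[OF D a(1) m(2), of p q]
    by (simp add: nn_integral_cmult nn_integral_add)
  also have "\<dots> < \<infinity>" using u v by (simp add: LH_def ennreal_mult_less_top)
  finally show ?thesis using m by (simp add: LH_def)
qed

text \<open>\<open>LH_norm\<close> is an \<open>Inf\<close> of reals, which is unspecified on the
  empty set; nonemptiness is what allows small admissible \<open>l\<close> to be extracted from a
  small norm.\<close>

lemma LH_norm_set_nonempty:
  fixes u :: "'a::euclidean_space \<Rightarrow> 'b::euclidean_space"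
  assumes D: "D \<in> sets lebesgue" and a: "continuous_on D a" "\<And>x. x \<in> D \<Longrightarrow> 0 \<le> a x" and p: "1 \<le> p" "p \<le> q"
    and u: "u \<in> LH p q a D"
  shows "\<exists>l>0. (\<integral>\<^sup>+x. ennreal (H_dp p q a x (u x /\<^sub>R l)) \<partial>lebesgue_on D) \<le> 1"
proof -
  have m: "u \<in> borel_measurable (lebesgue_on D)" using u by (auto simp: LH_def)
  let ?I = "\<integral>\<^sup>+x. ennreal (H_dp p q a x (u x)) \<partial>lebesgue_on D"
  obtain c where c: "?I = ennreal c" "0 \<le> c" using u by (cases ?I) (auto simp: LH_def)
  \<comment> \<open>For \<open>l \<ge> 1\<close> and exponents at least 1, dividing by
    \<open>l\<close> lowers the modular \<open>c\<close> to at most \<open>c / l\<close>.\<close>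
  define l where "l = max 1 c"
  have l: "l \<ge> 1" "c \<le> l" by (auto simp: l_def)
  have pw: "norm (z /\<^sub>R l) powr s \<le> inverse l * norm z powr s" if "1 \<le> s" for z :: 'b and s
  proof -
    have "norm (z /\<^sub>R l) powr s = inverse l powr s * norm z powr s" using l by (simp add: powr_mult)
    also have "inverse l powr s \<le> inverse l powr 1" using l that by (intro powr_mono') (auto simp: inverse_le_1_iff)
    then have "inverse l powr s * norm z powr s \<le> inverse l * norm z powr s" using l by (intro mult_right_mono) auto
    finally show ?thesis .
  qed
  have "(\<integral>\<^sup>+x. ennreal (H_dp p q a x (u x /\<^sub>R l)) \<partial>lebesgue_on D) \<le> (\<integral>\<^sup>+x. ennreal (inverse l) * ennreal (H_dp p q a x (u x)) \<partial>lebesgue_on D)"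
  proof (rule nn_integral_mono)
    fix x assume "x \<in> space (lebesgue_on D)"
    then have ax: "0 \<le> a x" using a by simp
    have "H_dp p q a x (u x /\<^sub>R l) \<le> inverse l * norm (u x) powr p + a x * (inverse l * norm (u x) powr q)"
      unfolding H_dp_def using p ax by (intro add_mono mult_left_mono pw) auto
    also have "\<dots> = inverse l * H_dp p q a x (u x)" by (simp add: H_dp_def algebra_simps)
    finally show "ennreal (H_dp p q a x (u x /\<^sub>R l)) \<le> ennreal (inverse l) * ennreal (H_dp p q a x (u x))"
      using l ax by (simp add: ennreal_mult[symmetric] H_dp_nonneg ennreal_leI)
  qed
  also have "\<dots> = ennreal (inverse l) * ?I"
    using H_dp_measurable[OF D a(1) m, of p q] by (simp add: nn_integral_cmult)
  also have "\<dots> = ennreal (inverse l * c)" unfolding c(1) using l c(2) by (simp add: ennreal_mult[symmetric])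
  also have "\<dots> \<le> 1" using l c by (simp add: ennreal_le_1 field_simps)
  finally show ?thesis using l by (intro exI[of _ l]) auto
qed

lemma A_dp_bound:
  assumes x: "0 \<le> a x" "a x \<le> m" and z: "norm z \<le> B" and p: "1 \<le> p" "p \<le> q"
  shows "norm (A_dp p q a x z) \<le> B powr (p - 1) + m * B powr (q - 1)"
proof -
  have e: "norm z powr (s - 2) * norm z \<le> B powr (s - 1)" if "1 \<le> s" for s
  proof -
    have "norm z powr (s - 2) * norm z = norm z powr (s - 1)"
      using powr_mult_base[of "norm z" "s - 2"] by (simp add: mult.commute)
    also have "\<dots> \<le> B powr (s - 1)" using z that by (intro powr_mono2) auto
    finally show ?thesis .
  qed
  have "norm (A_dp p q a x z) \<le> norm z powr (p - 2) * norm z + a x * (norm z powr (q - 2) * norm z)"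
    unfolding A_dp_def using x by (intro order_trans[OF norm_triangle_ineq]) (simp add: mult.assoc)
  also have "\<dots> \<le> B powr (p - 1) + m * B powr (q - 1)"
    using e[of p] e[of q] p x by (intro add_mono mult_mono) auto
  finally show ?thesis .
qed

text \<open>Since \<open>G\<close> is bounded on \<open>D\<close>, so is
  \<open>A_dp p q a x (G x)\<close>, and the pairing is continuous in the test gradient with respect
  to L^1. On a bounded set closeness in \<open>W1H_norm\<close> controls L^1, so the identity
  extends from smooth test functions to \<open>W1H_0\<close>.\<close>

lemma classical_weak_solution_distributional:
  fixes h :: "'a::euclidean_space \<Rightarrow> real"
  assumes D: "open D" "bounded D" and p: "1 < p" "p \<le> q"
    and a: "continuous_on D a" "\<And>x. x \<in> D \<Longrightarrow> 0 \<le> a x" "\<And>x. x \<in> D \<Longrightarrow> a x \<le> m"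
    and h: "\<And>x. (h has_derivative (\<lambda>k. G x \<bullet> k)) (at x)" and G: "continuous_on UNIV G"
    and weak: "\<And>\<psi>. \<psi> \<in> test_functions D \<Longrightarrow> (LINT x|lebesgue_on D. A_dp p q a x (G x) \<bullet> gradient \<psi> x) = 0"
  shows "distributional_solution p q a D h"
  unfolding distributional_solution_def
proof (intro conjI ballI impI)
  have Dm: "D \<in> sets lebesgue" using D by (simp add: lborelD)
  have ch: "continuous_on UNIV h"
    using h by (meson continuous_on_eq_continuous_within has_derivative_continuous continuous_at_imp_continuous_at_within)
  show "h \<in> W1H_loc p q a D"
    unfolding W1H_loc_def
  proof (intro CollectI allI impI)
    fix D' assume "compactly_inside D' D"
    then have o: "open D'" and c: "closure D' \<subseteq> D" unfolding compactly_inside_def by simp_all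
    have sub: "D' \<subseteq> D" by (rule subset_trans[OF closure_subset c])
    have b: "bounded D'" by (rule bounded_subset[OF D(2) sub])
    have hL: "h \<in> LH p q a D'"
      by (rule LH_bounded_continuous[OF o b, of a m]) (use a sub p ch in auto)
    have GL: "G \<in> LH p q a D'"
      by (rule LH_bounded_continuous[OF o b, of a m]) (use a sub p G in auto)
    show "h \<in> W1H p q a D'"
      unfolding W1H_def by (intro CollectI conjI bexI[of _ G] hL GL has_weak_gradient_C1[OF o h G])
  qed
  fix \<eta> assume \<eta>: "\<eta> \<in> W1H_0 p q a D"
  then obtain F where \<eta>L: "\<eta> \<in> LH p q a D" and F: "F \<in> LH p q a D" and \<eta>F: "has_weak_gradient D \<eta> F"
    unfolding W1H_0_def W1H_def by blast
  have mF: "F \<in> borel_measurable (lebesgue_on D)" using F by (simp add: LH_def)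
  have mG: "G \<in> borel_measurable (lebesgue_on D)"
    by (rule continuous_imp_measurable_on_sets_lebesgue[OF continuous_on_subset[OF G subset_UNIV] Dm])
  have ma: "a \<in> borel_measurable (lebesgue_on D)"
    by (rule continuous_imp_measurable_on_sets_lebesgue[OF a(1) Dm])
  let ?A = "\<lambda>x. A_dp p q a x (G x)"
  have mA: "?A \<in> borel_measurable (lebesgue_on D)"
    unfolding A_dp_def
    by (intro borel_measurable_add borel_measurable_scaleR borel_measurable_times powr_real_measurable
        measurable_compose[OF _ borel_measurable_norm] borel_measurable_const mG ma)
  have "bounded (G ` closure D)"
    using D(2) by (intro compact_imp_bounded compact_continuous_image continuous_on_subset[OF G subset_UNIV]) simp
  then obtain B where "\<forall>y\<in>G ` closure D. norm y \<le> B" unfolding bounded_iff by blast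
  then have B: "norm (G x) \<le> B" if "x \<in> D" for x using that closure_subset by blast
  define KA where "KA = \<bar>B powr (p - 1) + m * B powr (q - 1)\<bar>"
  have KA: "norm (?A x) \<le> KA" if "x \<in> D" for x
    using A_dp_bound[of a x m "G x" B p q] a(2,3)[OF that] B[OF that] p unfolding KA_def by linarith
  have KA0: "0 \<le> KA" by (simp add: KA_def)
  have ae: "AE x in lebesgue_on D. ?A x \<bullet> F x = A_dp p q a x (weak_gradient D h x) \<bullet> weak_gradient D \<eta> x"
    using weak_gradient_AE[OF D(1) has_weak_gradient_C1[OF D(1) h G]] weak_gradient_AE[OF D(1) \<eta>F]
    by eventually_elim simp
  have mAF: "(\<lambda>x. ?A x \<bullet> F x) \<in> borel_measurable (lebesgue_on D)" by (intro borel_measurable_inner mA mF)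
  \<comment> \<open>The chosen representatives are replaced by the continuous gradient
    \<open>G\<close> and the fixed weak gradient \<open>F\<close>; measurability of the original
    integrand comes from completeness.\<close>
  have eqI: "(LINT x|lebesgue_on D. A_dp p q a x (weak_gradient D h x) \<bullet> weak_gradient D \<eta> x) = (LINT x|lebesgue_on D. ?A x \<bullet> F x)"
    by (rule integral_cong_AE[OF borel_measurable_lebesgue_on_AE[OF Dm mAF ae] mAF]) (use ae in auto)
  define c where "c = measure lborel D"
  have c: "emeasure (lebesgue_on D) D = ennreal c" "0 \<le> c"
  proof -
    have "emeasure (lebesgue_on D) D = emeasure lborel D" using D Dm by (simp add: emeasure_restrict_space)
    also have "\<dots> = ennreal c" unfolding c_def using emeasure_bounded_finite[OF D(2)] by (intro emeasure_eq_ennreal_measure) auto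
    finally show "emeasure (lebesgue_on D) D = ennreal c" .
  qed (simp add: c_def)
  have small: "\<bar>LINT x|lebesgue_on D. ?A x \<bullet> F x\<bar> \<le> KA * (e * (c + 1))" if e: "e > 0" for e
  proof -
    obtain \<psi> where \<psi>: "\<psi> \<in> test_functions D" and n: "W1H_norm p q a D (\<lambda>x. \<eta> x - \<psi> x) < e"
      using \<eta> e unfolding W1H_0_def by blast
    note t = test_functionD[OF \<psi>]
    let ?g = "\<lambda>x. F x - gradient \<psi> x"
    have \<psi>w: "has_weak_gradient D \<psi> (gradient \<psi>)" by (rule has_weak_gradient_C1[OF D(1) t(1,2)])
    have "gradient \<psi> \<in> LH p q a D"
      by (rule LH_bounded_continuous[OF D, of a m]) (use a p t(2) in auto)
    then have gL: "?g \<in> LH p q a D"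
      by (intro LH_diff[OF Dm a(1,2) _ _ F]) (use p in auto)
    have dL: "(\<lambda>x. \<eta> x - \<psi> x) \<in> LH p q a D"
    proof -
      have "\<psi> \<in> LH p q a D" by (rule LH_bounded_continuous[OF D, of a m]) (use a p t(3) in auto)
      then show ?thesis by (intro LH_diff[OF Dm a(1,2) _ _ \<eta>L]) (use p in auto)
    qed
    have wg: "AE x in lebesgue_on D. weak_gradient D (\<lambda>x. \<eta> x - \<psi> x) x = ?g x"
      by (rule weak_gradient_AE[OF D(1) has_weak_gradient_diff[OF D(1) \<eta>F \<psi>w]])
    have cong: "(\<integral>\<^sup>+x. ennreal (H_dp p q a x (weak_gradient D (\<lambda>x. \<eta> x - \<psi> x) x /\<^sub>R l)) \<partial>lebesgue_on D) =
        (\<integral>\<^sup>+x. ennreal (H_dp p q a x (?g x /\<^sub>R l)) \<partial>lebesgue_on D)" for l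
      by (rule nn_integral_cong_AE) (use wg in eventually_elim, simp)
    let ?S = "{l. l > 0 \<and> (\<integral>\<^sup>+x. ennreal (H_dp p q a x (?g x /\<^sub>R l)) \<partial>lebesgue_on D) \<le> 1}"
    have S: "?S \<noteq> {}" using LH_norm_set_nonempty[OF Dm a(1,2) _ p(2) gL] p by auto
    \<comment> \<open>The first summand of \<open>W1H_norm\<close> is nonnegative, so the gradient
      part alone is below \<open>e\<close>, and some admissible \<open>l < e\<close> exists.\<close>
    have "0 \<le> LH_norm p q a D (\<lambda>x. \<eta> x - \<psi> x)"
      unfolding LH_norm_def
      by (rule cInf_greatest) (use LH_norm_set_nonempty[OF Dm a(1,2) _ p(2) dL] p in auto)
    then have "Inf ?S < e" using n unfolding W1H_norm_def LH_norm_def cong by linarith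
    then obtain l where l: "l > 0" "l < e" and l1: "(\<integral>\<^sup>+x. ennreal (H_dp p q a x (?g x /\<^sub>R l)) \<partial>lebesgue_on D) \<le> 1"
      using cInf_lessD[OF S] by blast
    have mg: "?g \<in> borel_measurable (lebesgue_on D)" using gL by (simp add: LH_def)
    have nn: "(\<integral>\<^sup>+x. ennreal (norm (?g x)) \<partial>lebesgue_on D) \<le> ennreal (e * (c + 1))"
    proof -
      have "(\<integral>\<^sup>+x. ennreal (norm (?g x)) \<partial>lebesgue_on D) \<le> (\<integral>\<^sup>+x. ennreal l * (1 + ennreal (H_dp p q a x (?g x /\<^sub>R l))) \<partial>lebesgue_on D)"
      proof (rule nn_integral_mono)
        fix x assume "x \<in> space (lebesgue_on D)"
        then have ax: "0 \<le> a x" using a by simp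
        let ?t = "norm (?g x /\<^sub>R l)"
        \<comment> \<open>The elementary bound that trades the modular for the L^1 norm: multiplied
          by \<open>l\<close>, it makes the integral of \<open>norm (?g x)\<close> of order
          \<open>l\<close>.\<close>
        have "?t \<le> 1 + ?t powr p"
        proof (cases "?t \<le> 1")
          case True then show ?thesis by (simp add: add_increasing2)
        next
          case False
          then have "?t powr 1 \<le> ?t powr p" using p by (intro powr_mono) auto
          then show ?thesis by simp
        qed
        also have "\<dots> \<le> 1 + H_dp p q a x (?g x /\<^sub>R l)" using ax by (simp add: H_dp_def)
        finally have "l * ?t \<le> l * (1 + H_dp p q a x (?g x /\<^sub>R l))" using l by (intro mult_left_mono) auto
        moreover have "l * ?t = norm (?g x)" using l by simp
        ultimately have "norm (?g x) \<le> l * (1 + H_dp p q a x (?g x /\<^sub>R l))" by (simp only:)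
        then have "ennreal (norm (?g x)) \<le> ennreal (l * (1 + H_dp p q a x (?g x /\<^sub>R l)))" by (rule ennreal_leI)
        then show "ennreal (norm (?g x)) \<le> ennreal l * (1 + ennreal (H_dp p q a x (?g x /\<^sub>R l)))"
          using l ax by (simp add: ennreal_mult ennreal_plus H_dp_nonneg)
      qed
      also have "\<dots> = ennreal l * (ennreal c + (\<integral>\<^sup>+x. ennreal (H_dp p q a x (?g x /\<^sub>R l)) \<partial>lebesgue_on D))"
        using H_dp_measurable[OF Dm a(1) borel_measurable_scaleR[OF borel_measurable_const mg, of "inverse l"], of p q] c(1)
        by (simp add: nn_integral_cmult nn_integral_add)
      also have "\<dots> \<le> ennreal l * (ennreal c + 1)" using l1 by (intro mult_left_mono add_left_mono) auto
      also have "\<dots> = ennreal (l * (c + 1))" using l c(2) by (simp add: ennreal_mult ennreal_plus)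
      also have "\<dots> \<le> ennreal (e * (c + 1))" using l c(2) by (intro ennreal_leI mult_right_mono) auto
      finally show ?thesis .
    qed
    have ig: "integrable (lebesgue_on D) ?g"
      by (rule integrableI_bounded[OF mg le_less_trans[OF nn]]) simp
    have iAg: "integrable (lebesgue_on D) (\<lambda>x. ?A x \<bullet> ?g x)" and bAg: "\<bar>LINT x|lebesgue_on D. ?A x \<bullet> ?g x\<bar> \<le> KA * (LINT x|lebesgue_on D. norm (?g x))"
    proof -
      have pt: "\<bar>?A x \<bullet> ?g x\<bar> \<le> KA * norm (?g x)" if "x \<in> D" for x
        using Cauchy_Schwarz_ineq2[of "?A x" "?g x"] mult_right_mono[OF KA[OF that], of "norm (?g x)"] by simp
      have iK: "integrable (lebesgue_on D) (\<lambda>x. KA * norm (?g x))" by (intro integrable_mult_right integrable_norm ig)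
      show i: "integrable (lebesgue_on D) (\<lambda>x. ?A x \<bullet> ?g x)"
        by (rule Bochner_Integration.integrable_bound[OF iK borel_measurable_inner[OF mA mg]])
           (use pt KA0 in \<open>auto intro!: AE_I2 simp: abs_mult\<close>)
      have "\<bar>LINT x|lebesgue_on D. ?A x \<bullet> ?g x\<bar> \<le> (LINT x|lebesgue_on D. \<bar>?A x \<bullet> ?g x\<bar>)" by (rule integral_abs_bound)
      also have "\<dots> \<le> (LINT x|lebesgue_on D. KA * norm (?g x))"
        by (rule integral_mono[OF integrable_abs[OF i] iK]) (use pt in auto)
      finally show "\<bar>LINT x|lebesgue_on D. ?A x \<bullet> ?g x\<bar> \<le> KA * (LINT x|lebesgue_on D. norm (?g x))" by simp
    qed
    have "(LINT x|lebesgue_on D. norm (?g x)) \<le> e * (c + 1)"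
    proof -
      have "ennreal (LINT x|lebesgue_on D. norm (?g x)) = (\<integral>\<^sup>+x. ennreal (norm (?g x)) \<partial>lebesgue_on D)"
        by (rule nn_integral_eq_integral[symmetric]) (use integrable_norm[OF ig] in auto)
      then have "ennreal (LINT x|lebesgue_on D. norm (?g x)) \<le> ennreal (e * (c + 1))" using nn by simp
      then show ?thesis using e c(2) by (simp add: ennreal_le_iff)
    qed
    then have b: "\<bar>LINT x|lebesgue_on D. ?A x \<bullet> ?g x\<bar> \<le> KA * (e * (c + 1))"
      using bAg mult_left_mono[OF _ KA0] order_trans by blast
    have ig\<psi>: "integrable (lebesgue_on D) (\<lambda>x. ?A x \<bullet> gradient \<psi> x)"
    proof -
      obtain Bg where Bg: "\<And>x. norm (gradient \<psi> x) \<le> Bg" "0 \<le> Bg"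
        using bounded_of_compact_support[OF t(4) continuous_on_subset[OF t(2) subset_UNIV] t(7)] by blast
      have mp: "gradient \<psi> \<in> borel_measurable (lebesgue_on D)"
        by (rule continuous_imp_measurable_on_sets_lebesgue[OF continuous_on_subset[OF t(2) subset_UNIV] Dm])
      have "\<bar>?A x \<bullet> gradient \<psi> x\<bar> \<le> KA * Bg" if "x \<in> D" for x
        using Cauchy_Schwarz_ineq2[of "?A x" "gradient \<psi> x"] mult_mono[OF KA[OF that] Bg(1)[of x] KA0 norm_ge_zero] by linarith
      then show ?thesis
        by (intro integrableI_bounded_set[of D _ _ "KA * Bg"] borel_measurable_inner mA mp)
           (use c Dm in \<open>auto intro!: AE_I2\<close>)
    qed
    have "?A x \<bullet> F x = ?A x \<bullet> ?g x + ?A x \<bullet> gradient \<psi> x" for x by (simp add: inner_diff_right)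
    then have "(LINT x|lebesgue_on D. ?A x \<bullet> F x) = (LINT x|lebesgue_on D. ?A x \<bullet> ?g x) + (LINT x|lebesgue_on D. ?A x \<bullet> gradient \<psi> x)"
      by (simp only: Bochner_Integration.integral_add[OF iAg ig\<psi>])
    then show ?thesis using b weak[OF \<psi>] by simp
  qed
  have "\<bar>LINT x|lebesgue_on D. ?A x \<bullet> F x\<bar> \<le> 0"
  proof (rule field_le_epsilon)
    fix d :: real assume d: "d > 0"
    define k where "k = KA * (c + 1) + 1"
    have k: "k > 0" using KA0 c(2) by (simp add: k_def add_nonneg_pos)
    have "KA * (d / k * (c + 1)) = d / k * (KA * (c + 1))" by simp
    also have "\<dots> \<le> d / k * k" using d k by (intro mult_left_mono) (auto simp: k_def)
    also have "\<dots> = d" using k by simp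
    finally show "\<bar>LINT x|lebesgue_on D. ?A x \<bullet> F x\<bar> \<le> 0 + d" using small[of "d / k"] d k by simp
  qed
  then show "(LINT x|lebesgue_on D. A_dp p q a x (weak_gradient D h x) \<bullet> weak_gradient D \<eta> x) = 0"
    unfolding eqI by simp
qed

section \<open>The viscosity inequality\<close>

text \<open>Sherman-Morrison inverse. \<open>M\<close> has the eigenvalue \<open>\<alpha>\<close> on
  the orthogonal complement of \<open>\<xi>\<close> and
  \<open>\<alpha> + \<beta> * (\<xi> \<bullet> \<xi>)\<close> along \<open>\<xi>\<close>; the
  smaller reciprocal is the coercivity constant \<open>l\<close> of \<open>N\<close>.\<close>

lemma rank_one_perturbation_inverse:
  fixes \<xi> :: "'a::euclidean_space"
  assumes al: "\<alpha> > 0" and ga: "\<alpha> + \<beta> * (\<xi> \<bullet> \<xi>) > 0" and M: "\<And>h. M h = \<alpha> *\<^sub>R h + (\<beta> * (\<xi> \<bullet> h)) *\<^sub>R \<xi>"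
  obtains N l where "kernel N l" "\<And>h. M (N h) = h" "linear M" "(\<Sum>b\<in>Basis. M b \<bullet> b) > 0"
proof -
  define \<gamma> where "\<gamma> = \<alpha> + \<beta> * (\<xi> \<bullet> \<xi>)"
  have \<gamma>: "\<gamma> > 0" using ga by (simp add: \<gamma>_def)
  define N where "N h = (1 / \<alpha>) *\<^sub>R (h - (\<beta> / \<gamma> * (\<xi> \<bullet> h)) *\<^sub>R \<xi>)" for h
  define l where "l = min (1 / \<alpha>) (1 / \<gamma>)"
  have "kernel N l"
  proof (rule kernel.intro)
    show "linear N" by (rule linearI) (simp_all add: N_def inner_add_right algebra_simps)
    show "N x \<bullet> y = N y \<bullet> x" for x y
      by (simp add: N_def inner_diff_left inner_commute[of \<xi>] inner_commute[of x y])
    show "0 < l" using al \<gamma> by (simp add: l_def)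
    fix x
    have NN: "N x \<bullet> x = (1 / \<alpha>) * ((norm x)\<^sup>2 - \<beta> / \<gamma> * (\<xi> \<bullet> x)\<^sup>2)"
      by (simp add: N_def inner_diff_left dot_square_norm power2_eq_square)
    show "l * (norm x)\<^sup>2 \<le> N x \<bullet> x"
    proof (cases "\<beta> \<le> 0")
      case True
      then have "\<beta> / \<gamma> * (\<xi> \<bullet> x)\<^sup>2 \<le> 0" using \<gamma> by (intro mult_nonpos_nonneg) (auto simp: divide_nonpos_pos)
      then have "(1 / \<alpha>) * (norm x)\<^sup>2 \<le> N x \<bullet> x" unfolding NN using al by (intro mult_left_mono) auto
      moreover have "l * (norm x)\<^sup>2 \<le> (1 / \<alpha>) * (norm x)\<^sup>2" by (intro mult_right_mono) (auto simp: l_def)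
      ultimately show ?thesis by linarith
    next
      case False
      have "(\<xi> \<bullet> x)\<^sup>2 \<le> (\<xi> \<bullet> \<xi>) * (norm x)\<^sup>2"
        using Cauchy_Schwarz_ineq[of \<xi> x] by (simp add: dot_square_norm)
      then have "\<beta> / \<gamma> * (\<xi> \<bullet> x)\<^sup>2 \<le> \<beta> / \<gamma> * ((\<xi> \<bullet> \<xi>) * (norm x)\<^sup>2)"
        using False \<gamma> by (intro mult_left_mono) auto
      then have "(1 / \<alpha>) * ((norm x)\<^sup>2 - \<beta> / \<gamma> * ((\<xi> \<bullet> \<xi>) * (norm x)\<^sup>2)) \<le> N x \<bullet> x"
        unfolding NN using al by (intro mult_left_mono) auto
      moreover have "(1 / \<alpha>) * ((norm x)\<^sup>2 - \<beta> / \<gamma> * ((\<xi> \<bullet> \<xi>) * (norm x)\<^sup>2)) = (1 / \<gamma>) * (norm x)\<^sup>2"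
      proof -
        have "(norm x)\<^sup>2 - \<beta> / \<gamma> * ((\<xi> \<bullet> \<xi>) * (norm x)\<^sup>2) = (\<gamma> - \<beta> * (\<xi> \<bullet> \<xi>)) / \<gamma> * (norm x)\<^sup>2"
          using \<gamma> by (simp add: field_simps)
        also have "\<gamma> - \<beta> * (\<xi> \<bullet> \<xi>) = \<alpha>" by (simp add: \<gamma>_def)
        finally show ?thesis using al by simp
      qed
      moreover have "l * (norm x)\<^sup>2 \<le> (1 / \<gamma>) * (norm x)\<^sup>2" by (intro mult_right_mono) (auto simp: l_def)
      ultimately show ?thesis by linarith
    qed
  qed
  moreover have "M (N h) = h" for h
  proof -
    define t where "t = \<xi> \<bullet> h"
    have iN: "\<xi> \<bullet> N h = t / \<gamma>"
    proof -
      have "\<xi> \<bullet> N h = (1 / \<alpha>) * (t * ((\<gamma> - \<beta> * (\<xi> \<bullet> \<xi>)) / \<gamma>))"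
      proof -
        have "(\<gamma> - \<beta> * (\<xi> \<bullet> \<xi>)) / \<gamma> = 1 - \<beta> * (\<xi> \<bullet> \<xi>) / \<gamma>" using \<gamma> by (simp add: diff_divide_distrib)
        moreover have "\<xi> \<bullet> N h = (1 / \<alpha>) * (t * (1 - \<beta> * (\<xi> \<bullet> \<xi>) / \<gamma>))"
          by (simp add: N_def inner_diff_right t_def right_diff_distrib mult_ac)
        ultimately show ?thesis by (simp only:)
      qed
      also have "\<gamma> - \<beta> * (\<xi> \<bullet> \<xi>) = \<alpha>" by (simp add: \<gamma>_def)
      finally show ?thesis using al by simp
    qed
    have "\<alpha> *\<^sub>R N h = h - (\<beta> / \<gamma> * t) *\<^sub>R \<xi>" using al by (simp add: N_def t_def)
    then show ?thesis unfolding M iN by simp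
  qed
  moreover have "linear M" by (rule linearI) (simp_all add: M inner_add_right algebra_simps)
  moreover have "(\<Sum>b\<in>Basis. M b \<bullet> b) > 0"
  proof -
    have "(\<Sum>b\<in>Basis. M b \<bullet> b) = (\<Sum>b\<in>(Basis::'a set). \<alpha> + \<beta> * ((\<xi> \<bullet> b) * (\<xi> \<bullet> b)))"
      by (intro sum.cong) (auto simp: M inner_add_left)
    also have "\<dots> = real DIM('a) * \<alpha> + \<beta> * (\<xi> \<bullet> \<xi>)"
      unfolding euclidean_inner[of \<xi> \<xi>] sum.distrib sum_distrib_left[symmetric] by simp
    also have "real DIM('a) * \<alpha> \<ge> 1 * \<alpha>"
      using al DIM_positive[where 'a = 'a] by (intro mult_right_mono) (auto simp: Suc_le_eq)
    then have "real DIM('a) * \<alpha> + \<beta> * (\<xi> \<bullet> \<xi>) > 0" using ga by linarith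
    finally show ?thesis .
  qed
  ultimately show thesis by (rule that)
qed

text \<open>Connects smooth test functions near \<open>x0\<close> with test pairs at unit scale; the
  radius \<open>r / 2\<close> corresponds to the half ball in which the rescaled equation
  holds.\<close>

lemma test_function_rescaled:
  fixes \<psi> :: "'a::euclidean_space \<Rightarrow> real"
  assumes \<psi>: "\<psi> \<in> test_functions (ball x0 (r / 2))" and r: "r > 0"
  shows "test_pair (\<lambda>y. \<psi> (x0 + r *\<^sub>R y)) (\<lambda>y. r *\<^sub>R gradient \<psi> (x0 + r *\<^sub>R y)) (1/2)"
  unfolding test_pair_def
proof (intro conjI allI impI)
  note t = test_functionD[OF \<psi>]
  have C: "Ck 2 UNIV \<psi>" using \<psi> unfolding test_functions_def by blast
  note c2 = Ck_2_gradient[OF C open_UNIV]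
  let ?H = "\<lambda>x. frechet_derivative (gradient \<psi>) (at x)"
  have X: "((\<lambda>y. x0 + r *\<^sub>R y) has_derivative (\<lambda>h. r *\<^sub>R h)) (at y)" for y
    by (auto intro!: derivative_eq_intros)
  show "((\<lambda>y. \<psi> (x0 + r *\<^sub>R y)) has_derivative (\<lambda>h. (r *\<^sub>R gradient \<psi> (x0 + r *\<^sub>R y)) \<bullet> h)) (at y)" for y
    using has_derivative_compose[OF X t(1)] by simp
  show "\<exists>H. (\<forall>y. ((\<lambda>y. r *\<^sub>R gradient \<psi> (x0 + r *\<^sub>R y)) has_derivative H y) (at y)) \<and>
      (\<forall>h. continuous_on UNIV (\<lambda>y. H y h))"
  proof (intro exI[of _ "\<lambda>y h. r *\<^sub>R ?H (x0 + r *\<^sub>R y) (r *\<^sub>R h)"] conjI allI)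
    show "((\<lambda>y. r *\<^sub>R gradient \<psi> (x0 + r *\<^sub>R y)) has_derivative (\<lambda>h. r *\<^sub>R ?H (x0 + r *\<^sub>R y) (r *\<^sub>R h))) (at y)" for y
      by (rule has_derivative_scaleR_right[OF has_derivative_compose[OF X c2(2)[OF UNIV_I]]])
    show "continuous_on UNIV (\<lambda>y. r *\<^sub>R ?H (x0 + r *\<^sub>R y) (r *\<^sub>R h))" for h
      by (intro continuous_on_scaleR continuous_on_const continuous_on_compose2[OF c2(3)] continuous_on_add continuous_on_id) auto
  qed
  fix y :: 'a assume "1 / 2 < norm y"
  then have "r * (1 / 2) < r * norm y" using r by (intro mult_strict_left_mono) auto
  then have "x0 + r *\<^sub>R y \<notin> ball x0 (r / 2)" using r by (simp add: dist_norm)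
  then show "\<psi> (x0 + r *\<^sub>R y) = 0" by (intro t(6)) (use t(5) in blast)
qed

section \<open>Regularity and ellipticity of the double phase field\<close>

lemma A_dp_measurable:
  assumes "D \<in> sets lebesgue" "continuous_on D a" "G \<in> borel_measurable (lebesgue_on D)"
  shows "(\<lambda>x. A_dp p q a x (G x)) \<in> borel_measurable (lebesgue_on D)"
  unfolding A_dp_def using assms(3) continuous_imp_measurable_on_sets_lebesgue[OF assms(2,1)]
  by (intro borel_measurable_add borel_measurable_scaleR borel_measurable_times powr_real_measurable
      measurable_compose[OF _ borel_measurable_norm] borel_measurable_const)

definition A_dp_deriv :: "real \<Rightarrow> real \<Rightarrow> real \<Rightarrow> 'a::euclidean_space \<Rightarrow> 'a \<Rightarrow> 'a" where
  "A_dp_deriv p q s z h = power_field_deriv p z h + s *\<^sub>R power_field_deriv q z h"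

lemma linear_A_dp_deriv: "linear (A_dp_deriv p q s z)"
  unfolding A_dp_deriv_def[abs_def] by (intro linear_compose_add linear_compose_scale_right linear_power_field_deriv)

text \<open>Strict differentiability is stable under sums, products and composition with the two
  projections, and both \<open>a\<close> and \<open>power_field\<close> have it at the respective
  points.\<close>

lemma A_dp_strictly_differentiable:
  fixes a :: "'a::euclidean_space \<Rightarrow> real" and x0 z0 :: 'a
  assumes \<Omega>: "open \<Omega>" "x0 \<in> \<Omega>" and a: "Ck 1 \<Omega> a" and z0: "z0 \<noteq> 0"
  shows "strictly_differentiable (\<lambda>w. A_dp p q a (fst w) (snd w))
    (\<lambda>k. (gradient a x0 \<bullet> fst k) *\<^sub>R power_field q z0 + A_dp_deriv p q (a x0) z0 (snd k)) (x0, z0)"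
proof -
  have n1: "norm (fst w) \<le> norm w" for w :: "'a \<times> 'a" by (cases w) (simp add: norm_fst_le)
  have n2: "norm (snd w) \<le> norm w" for w :: "'a \<times> 'a" by (cases w) (simp add: norm_snd_le)
  have sa: "strictly_differentiable (\<lambda>w. a (fst w)) (\<lambda>k. gradient a x0 \<bullet> fst k) (x0, z0)"
    by (rule strictly_differentiable_linear_compose[where T = fst and f = a and f' = "\<lambda>h. gradient a x0 \<bullet> h", OF _ bounded_linear_fst n1])
       (use Ck_1_strictly_differentiable[OF a \<Omega>] in simp)
  have sp: "strictly_differentiable (\<lambda>w. power_field s (snd w)) (\<lambda>k. power_field_deriv s z0 (snd k)) (x0, z0)" for s
    by (rule strictly_differentiable_linear_compose[where T = snd and f = "power_field s" and f' = "power_field_deriv s z0", OF _ bounded_linear_snd n2])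
       (use power_field_strictly_differentiable[OF z0] in simp)
  from strictly_differentiable_add[OF sp[of p] strictly_differentiable_scaleR[OF sa sp[of q]]]
  show ?thesis by (simp add: A_dp_power_field A_dp_deriv_def[abs_def] add_ac)
qed

lemma A_dp_deriv_lipschitz:
  fixes a :: "'a::euclidean_space \<Rightarrow> real" and x0 z0 :: 'a
  assumes \<Omega>: "open \<Omega>" "x0 \<in> \<Omega>" and a: "Ck 1 \<Omega> a" and z0: "z0 \<noteq> 0"
  obtains \<rho> C where "\<rho> > 0" "\<And>x z. dist z z0 < \<rho> \<Longrightarrow> (A_dp p q a x has_derivative A_dp_deriv p q (a x) z) (at z)"
    "\<And>x z x' z' h. dist x x0 < \<rho> \<Longrightarrow> dist z z0 < \<rho> \<Longrightarrow> dist x' x0 < \<rho> \<Longrightarrow> dist z' z0 < \<rho> \<Longrightarrow>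
      norm (A_dp_deriv p q (a x) z h - A_dp_deriv p q (a x') z' h) \<le> C * (dist x x' + dist z z') * norm h"
proof -
  \<comment> \<open>Strict differentiability with error 1 makes \<open>a\<close> Lipschitz near
    \<open>x0\<close>.\<close>
  obtain r where r: "r > 0" "\<And>x y. dist x x0 < r \<Longrightarrow> dist y x0 < r \<Longrightarrow>
      norm (a x - a y - gradient a x0 \<bullet> (x - y)) \<le> 1 * norm (x - y)"
    using Ck_1_strictly_differentiable[OF a \<Omega>] unfolding strictly_differentiable_def using zero_less_one by blast
  define \<rho> where "\<rho> = min r (norm z0 / 2)"
  have \<rho>: "\<rho> > 0" "\<rho> \<le> r" "\<rho> \<le> norm z0 / 2" using r z0 by (auto simp: \<rho>_def)
  have a_lip: "norm (a x - a y) \<le> (norm (gradient a x0) + 1) * norm (x - y)" if "dist x x0 < r" "dist y x0 < r" for x y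
  proof -
    have "\<bar>a x - a y\<bar> \<le> \<bar>a x - a y - gradient a x0 \<bullet> (x - y)\<bar> + \<bar>gradient a x0 \<bullet> (x - y)\<bar>" by linarith
    also have "\<dots> \<le> 1 * norm (x - y) + norm (gradient a x0) * norm (x - y)"
      using r(2)[OF that] Cauchy_Schwarz_ineq2[of "gradient a x0" "x - y"] by (intro add_mono) auto
    finally show ?thesis by (simp add: algebra_simps)
  qed
  define S where "S = ball x0 \<rho> \<times> ball z0 \<rho>"
  have bS: "bounded S" by (simp add: S_def bounded_Times)
  have S: "dist (fst w) x0 < r" "snd w \<in> cball z0 (norm z0 / 2)" if "w \<in> S" for w
    using that \<rho> by (auto simp: S_def dist_commute)
  have blf: "bounded_lipschitz_on S (\<lambda>w. a (fst w))"
    by (rule bounded_lipschitz_on_compose[OF bounded_lipschitz_on_linear[OF bounded_linear_fst bS]])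
       (use S a_lip in blast)
  have blp: "bounded_lipschitz_on S (\<lambda>w. power_field_deriv s (snd w) h)" for s h
  proof -
    obtain K where K: "\<And>y z. y \<in> cball z0 (norm z0 / 2) \<Longrightarrow> z \<in> cball z0 (norm z0 / 2) \<Longrightarrow>
        norm (power_field_deriv s y h - power_field_deriv s z h) \<le> K * dist y z"
      using power_field_deriv_bounded_lipschitz(1)[OF z0, of s h] unfolding bounded_lipschitz_on_def by blast
    show ?thesis
      by (rule bounded_lipschitz_on_compose[OF bounded_lipschitz_on_linear[OF bounded_linear_snd bS], where K = K])
         (use S(2) K in \<open>auto simp: dist_norm[symmetric]\<close>)
  qed
  have bl: "bounded_lipschitz_on S (\<lambda>w. A_dp_deriv p q (a (fst w)) (snd w) h)" for h
    unfolding A_dp_deriv_def by (intro bounded_lipschitz_on_add bounded_lipschitz_on_scaleR blf blp)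
  obtain C where C: "C \<ge> 0" "\<And>w w' h. w \<in> S \<Longrightarrow> w' \<in> S \<Longrightarrow>
      norm (A_dp_deriv p q (a (fst w)) (snd w) h - A_dp_deriv p q (a (fst w')) (snd w') h) \<le> C * dist w w' * norm h"
    by (rule linear_family_bounded_lipschitz[where T = "\<lambda>w. A_dp_deriv p q (a (fst w)) (snd w)" and S = S,
          OF linear_A_dp_deriv bl]) blast
  show thesis
  proof (rule that[OF \<rho>(1)])
    fix x z assume z: "dist z z0 < \<rho>"
    then have "z \<in> cball z0 (norm z0 / 2)" using \<rho> by (simp add: dist_commute)
    then have nz: "z \<noteq> 0" using power_field_deriv_bounded_lipschitz(2)[OF z0] by blast
    have "A_dp p q a x = (\<lambda>z :: 'a. power_field p z + a x *\<^sub>R power_field q z)"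
      by (rule ext) (rule A_dp_power_field)
    moreover have "((\<lambda>z. power_field p z + a x *\<^sub>R power_field q z) has_derivative
        (\<lambda>h. power_field_deriv p z h + a x *\<^sub>R power_field_deriv q z h)) (at z)"
      by (intro has_derivative_add has_derivative_scaleR_right has_derivative_power_field nz)
    ultimately show "(A_dp p q a x has_derivative A_dp_deriv p q (a x) z) (at z)"
      by (simp only: A_dp_deriv_def[abs_def])
  next
    fix x z x' z' h assume "dist x x0 < \<rho>" "dist z z0 < \<rho>" "dist x' x0 < \<rho>" "dist z' z0 < \<rho>"
    then have "(x, z) \<in> S" "(x', z') \<in> S" by (auto simp: S_def dist_commute)
    from C(2)[OF this, of h]
    have "norm (A_dp_deriv p q (a x) z h - A_dp_deriv p q (a x') z' h) \<le> C * dist (x, z) (x', z') * norm h" by simp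
    also have "\<dots> \<le> C * (dist x x' + dist z z') * norm h"
      using C(1) by (intro mult_right_mono mult_left_mono) (auto simp: dist_Pair_Pair intro!: sqrt_sum_squares_le_sum)
    finally show "norm (A_dp_deriv p q (a x) z h - A_dp_deriv p q (a x') z' h) \<le> C * (dist x x' + dist z z') * norm h" .
  qed
qed

text \<open>With \<open>P e\<close> equal to |z0|^(e-2), the eigenvalues are
  \<open>P p + s * P q\<close> across \<open>z0\<close> and
  \<open>(p - 1) * P p + s * ((q - 1) * P q)\<close> along it. Both are positive since
  \<open>p > 1\<close>.\<close>

lemma A_dp_deriv_elliptic:
  fixes z0 :: "'a::euclidean_space"
  assumes z0: "z0 \<noteq> 0" and p: "1 < p" "p \<le> q" and s: "0 \<le> s"
  obtains N l where "kernel N l" "\<And>h. A_dp_deriv p q s z0 (N h) = h" "(\<Sum>b\<in>Basis. A_dp_deriv p q s z0 b \<bullet> b) > 0"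
proof -
  define t where "t = z0 \<bullet> z0"
  have t: "t > 0" using z0 by (simp add: t_def)
  define P where "P e = t powr ((e - 2) / 2)" for e
  define Q where "Q e = (e - 2) * t powr ((e - 2) / 2 - 1)" for e
  have P: "P e > 0" for e using t by (simp add: P_def)
  have Q: "Q e * t = (e - 2) * P e" for e
  proof -
    have "t * t powr ((e - 2) / 2 - 1) = t powr ((e - 2) / 2)" using t by (simp add: powr_mult_base)
    then show ?thesis by (simp add: P_def Q_def mult_ac)
  qed
  have M: "A_dp_deriv p q s z0 h = (P p + s * P q) *\<^sub>R h + ((Q p + s * Q q) * (z0 \<bullet> h)) *\<^sub>R z0" for h
    by (simp add: A_dp_deriv_def power_field_deriv_def P_def Q_def t_def algebra_simps)
  have al: "P p + s * P q > 0" using P[of p] P[of q] s by (simp add: add_pos_nonneg)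
  have "(P p + s * P q) + (Q p + s * Q q) * t = (p - 1) * P p + s * ((q - 1) * P q)"
  proof -
    have "(P p + s * P q) + (Q p + s * Q q) * t = (P p + Q p * t) + s * (P q + Q q * t)"
      by (simp add: algebra_simps)
    then show ?thesis unfolding Q by (simp add: algebra_simps)
  qed
  also have "\<dots> > 0" using P[of p] P[of q] s p by (intro add_pos_nonneg) auto
  finally have ga: "(P p + s * P q) + (Q p + s * Q q) * (z0 \<bullet> z0) > 0" by (simp add: t_def)
  from rank_one_perturbation_inverse[OF al ga M] show thesis using that by blast
qed

lemma superharmonic_touching_test:
  fixes a \<phi> :: "'a::euclidean_space \<Rightarrow> real"
  assumes \<Omega>: "open \<Omega>" and p: "1 < p" "p \<le> q" and a0: "\<And>x. x \<in> \<Omega> \<Longrightarrow> 0 \<le> a x" and a: "Ck 1 \<Omega> a"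
    and u: "superharmonic p q a \<Omega> u" and x0: "x0 \<in> \<Omega>" and \<phi>: "Ck 2 \<Omega> \<phi>"
    and touch: "ereal (\<phi> x0) = u x0" and below: "\<And>x. x \<in> \<Omega> \<Longrightarrow> x \<noteq> x0 \<Longrightarrow> ereal (\<phi> x) < u x"
    and nz: "gradient \<phi> x0 \<noteq> 0"
  shows "divergence (\<lambda>x. A_dp p q a x (gradient \<phi> x)) x0 \<le> 0"
proof (rule ccontr)
  assume contra: "\<not> divergence (\<lambda>x. A_dp p q a x (gradient \<phi> x)) x0 \<le> 0"
  define \<xi> where "\<xi> = gradient \<phi> x0"
  have \<xi>: "\<xi> \<noteq> 0" using nz by (simp add: \<xi>_def)
  define B0 where "B0 = frechet_derivative (gradient \<phi>) (at x0)"
  note c2 = Ck_2_gradient[OF \<phi> \<Omega>]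
  have gB: "(gradient \<phi> has_derivative B0) (at x0)" unfolding B0_def by (rule c2(2)[OF x0])
  have linB0: "linear B0" using gB has_derivative_linear by blast
  have symB0: "B0 x \<bullet> y = B0 y \<bullet> x" for x y
    by (rule symmetric_second_derivative[OF \<Omega> x0 c2(1) gB])
  define Ax where "Ax k = (gradient a x0 \<bullet> k) *\<^sub>R power_field q \<xi>" for k
  define M where "M = A_dp_deriv p q (a x0) \<xi>"
  have linAx: "linear Ax" by (rule linearI) (simp_all add: Ax_def inner_add_right algebra_simps)
  have linM: "linear M" unfolding M_def by (rule linear_A_dp_deriv)
  obtain N l where ker: "kernel N l" and MN: "\<And>h. M (N h) = h" and trM: "(\<Sum>b\<in>Basis. M b \<bullet> b) > 0"
    unfolding M_def using A_dp_deriv_elliptic[OF \<xi> p a0[OF x0]] by blast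
  interpret kernel N l by (rule ker)
  have sd: "strictly_differentiable (\<lambda>w. A_dp p q a (fst w) (snd w)) (\<lambda>k. Ax (fst k) + M (snd k)) (x0, \<xi>)"
    unfolding Ax_def M_def by (rule A_dp_strictly_differentiable[OF \<Omega> x0 a \<xi>])
  define d where "d = (\<Sum>b\<in>Basis. (Ax b + M (B0 b)) \<bullet> b)"
  have "divergence (\<lambda>x. A_dp p q a x (gradient \<phi> x)) x0 = d"
  proof -
    have "((\<lambda>x. (x, gradient \<phi> x)) has_derivative (\<lambda>k. (k, B0 k))) (at x0)"
      by (intro has_derivative_Pair has_derivative_ident gB)
    from has_derivative_compose[OF this strictly_differentiable_imp_has_derivative[OF sd[unfolded \<xi>_def]]]
    have "((\<lambda>x. A_dp p q a x (gradient \<phi> x)) has_derivative (\<lambda>k. Ax k + M (B0 k))) (at x0)" by simp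
    from frechet_derivative_at[OF this, symmetric] show ?thesis by (simp add: divergence_def d_def)
  qed
  then have d: "d > 0" using contra by simp
  \<comment> \<open>Subtracting \<open>\<tau>\<close> times the identity from the Hessian lowers the
    trace by exactly \<open>d\<close>, so the corrected Hessian \<open>B\<close> satisfies the
    linearised equation at \<open>x0\<close>.\<close>
  define \<tau> where "\<tau> = d / (\<Sum>b\<in>Basis. M b \<bullet> b)"
  have \<tau>: "\<tau> > 0" "\<tau> * (\<Sum>b\<in>Basis. M b \<bullet> b) = d" using d trM by (auto simp: \<tau>_def)
  define B where "B k = B0 k - \<tau> *\<^sub>R k" for k
  have linB: "linear B"
    unfolding B_def[abs_def] by (intro linear_compose_sub linB0 linear_compose_scale_right linear_id[unfolded id_def])
  have symB: "B x \<bullet> y = B y \<bullet> x" for x y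
    unfolding B_def inner_diff_left inner_scaleR_left using symB0[of x y] inner_commute[of x y] by simp
  have trace: "(\<Sum>b\<in>Basis. (Ax b + M (B b)) \<bullet> b) = 0"
  proof -
    have "(\<Sum>b\<in>Basis. (Ax b + M (B b)) \<bullet> b) = (\<Sum>b\<in>Basis. (Ax b + M (B0 b)) \<bullet> b - \<tau> * (M b \<bullet> b))"
      by (intro sum.cong) (simp_all add: B_def linear_diff[OF linM] linear_scale[OF linM] inner_diff_left inner_add_left)
    also have "\<dots> = d - \<tau> * (\<Sum>b\<in>Basis. M b \<bullet> b)" by (simp add: sum_subtractf d_def sum_distrib_left)
    finally show ?thesis using \<tau> by simp
  qed
  obtain \<rho> C where \<rho>: "\<rho> > 0" and der: "\<And>x z. dist z \<xi> < \<rho> \<Longrightarrow> (A_dp p q a x has_derivative A_dp_deriv p q (a x) z) (at z)"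
    and lip: "\<And>x z x' z' h. dist x x0 < \<rho> \<Longrightarrow> dist z \<xi> < \<rho> \<Longrightarrow> dist x' x0 < \<rho> \<Longrightarrow> dist z' \<xi> < \<rho> \<Longrightarrow>
      norm (A_dp_deriv p q (a x) z h - A_dp_deriv p q (a x') z' h) \<le> C * (dist x x' + dist z z') * norm h"
    by (rule A_dp_deriv_lipschitz[OF \<Omega> x0 a \<xi>]) blast
  have strict: "\<exists>\<rho>>0. \<forall>x x' z z'. dist x x0 < \<rho> \<longrightarrow> dist x' x0 < \<rho> \<longrightarrow> dist z \<xi> < \<rho> \<longrightarrow> dist z' \<xi> < \<rho> \<longrightarrow>
      norm (A_dp p q a x z - A_dp p q a x' z' - Ax (x - x') - M (z - z')) \<le> e * (dist x x' + dist z z')" if e: "e > 0" for e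
  proof -
    obtain \<rho>' where r: "\<rho>' > 0" "\<And>w w'. dist w (x0, \<xi>) < \<rho>' \<Longrightarrow> dist w' (x0, \<xi>) < \<rho>' \<Longrightarrow>
        norm (A_dp p q a (fst w) (snd w) - A_dp p q a (fst w') (snd w') - (Ax (fst (w - w')) + M (snd (w - w')))) \<le> e * norm (w - w')"
      using sd e unfolding strictly_differentiable_def by blast
    have pd: "dist (x, z) (x', z') \<le> dist x x' + dist z z'" for x x' z z' :: 'a
      by (simp add: dist_Pair_Pair sqrt_sum_squares_le_sum)
    show ?thesis
    proof (intro exI[of _ "\<rho>' / 2"] conjI allI impI)
      fix x x' z z' assume "dist x x0 < \<rho>' / 2" "dist x' x0 < \<rho>' / 2" "dist z \<xi> < \<rho>' / 2" "dist z' \<xi> < \<rho>' / 2"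
      then have "dist (x, z) (x0, \<xi>) < \<rho>'" "dist (x', z') (x0, \<xi>) < \<rho>'"
        using pd[of x z x0 \<xi>] pd[of x' z' x0 \<xi>] by linarith+
      from r(2)[OF this]
      have "norm (A_dp p q a x z - A_dp p q a x' z' - Ax (x - x') - M (z - z')) \<le> e * dist (x, z) (x', z')"
        by (simp add: dist_norm diff_diff_eq add.assoc)
      also have "\<dots> \<le> e * (dist x x' + dist z z')" using pd e by (intro mult_left_mono) auto
      finally show "norm (A_dp p q a x z - A_dp p q a x' z' - Ax (x - x') - M (z - z')) \<le> e * (dist x x' + dist z z')" .
    qed (use r in simp)
  qed
  have "\<exists>r0>0. \<forall>r. 0 < r \<longrightarrow> r < r0 \<longrightarrow> (\<exists>h G. continuous_on UNIV G \<and>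
      (\<forall>x. (h has_derivative (\<lambda>k. G x \<bullet> k)) (at x)) \<and>
      (\<forall>x\<in>cball x0 r. dist (G x) \<xi> < 1 \<and>
         \<bar>h x - (\<phi> x0 + \<xi> \<bullet> (x - x0) + B (x - x0) \<bullet> (x - x0) / 2)\<bar> \<le> \<tau> / 32 * r\<^sup>2) \<and>
      (\<forall>\<psi> g. test_pair (\<lambda>y. \<psi> (x0 + r *\<^sub>R y)) (\<lambda>y. r *\<^sub>R g (x0 + r *\<^sub>R y)) (1/2) \<longrightarrow>
         ((\<lambda>x. A_dp p q a x (G x) \<bullet> g x) has_integral 0) UNIV))"
    by (rule quadratic_approximate_solution[where D = "\<lambda>x. A_dp_deriv p q (a x)" and C = C and \<rho> = \<rho> and M = M,
          OF strict \<rho> der lip _ MN linAx linM linB symB trace])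
       (use \<tau> in \<open>auto simp: M_def\<close>)
  then obtain r0 where r0: "r0 > 0" and sol: "\<And>r. 0 < r \<Longrightarrow> r < r0 \<Longrightarrow> \<exists>h G. continuous_on UNIV G \<and>
      (\<forall>x. (h has_derivative (\<lambda>k. G x \<bullet> k)) (at x)) \<and>
      (\<forall>x\<in>cball x0 r. dist (G x) \<xi> < 1 \<and>
         \<bar>h x - (\<phi> x0 + \<xi> \<bullet> (x - x0) + B (x - x0) \<bullet> (x - x0) / 2)\<bar> \<le> \<tau> / 32 * r\<^sup>2) \<and>
      (\<forall>\<psi> g. test_pair (\<lambda>y. \<psi> (x0 + r *\<^sub>R y)) (\<lambda>y. r *\<^sub>R g (x0 + r *\<^sub>R y)) (1/2) \<longrightarrow>
         ((\<lambda>x. A_dp p q a x (G x) \<bullet> g x) has_integral 0) UNIV)"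
    by blast
  obtain r1 where r1: "r1 > 0" "cball x0 r1 \<subseteq> \<Omega>" using \<Omega> x0 open_contains_cball by blast
  have "\<tau> / 16 > 0" using \<tau> by simp
  from second_order_taylor[OF \<Omega> x0 c2(1) gB this]
  obtain r2 where r2: "r2 > 0" "\<And>x. dist x x0 < r2 \<Longrightarrow>
      \<bar>\<phi> x - (\<phi> x0 + \<xi> \<bullet> (x - x0) + B0 (x - x0) \<bullet> (x - x0) / 2)\<bar> \<le> \<tau> / 16 * (dist x x0)\<^sup>2"
    unfolding \<xi>_def by blast
  define r where "r = min r0 (min r1 r2) / 2"
  have r: "0 < r" "r < r0" "r < r1" "r < r2" using r0 r1 r2 by (auto simp: r_def min_def)
  obtain h G where G: "continuous_on UNIV G" and h: "\<And>x. (h has_derivative (\<lambda>k. G x \<bullet> k)) (at x)"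
    and hP: "\<And>x. x \<in> cball x0 r \<Longrightarrow> \<bar>h x - (\<phi> x0 + \<xi> \<bullet> (x - x0) + B (x - x0) \<bullet> (x - x0) / 2)\<bar> \<le> \<tau> / 32 * r\<^sup>2"
    and hw: "\<And>\<psi> g. test_pair (\<lambda>y. \<psi> (x0 + r *\<^sub>R y)) (\<lambda>y. r *\<^sub>R g (x0 + r *\<^sub>R y)) (1/2) \<Longrightarrow>
         ((\<lambda>x. A_dp p q a x (G x) \<bullet> g x) has_integral 0) UNIV"
    using sol[OF r(1,2)] by blast
  \<comment> \<open>Half the radius, because the weak equation for \<open>h\<close> is available for
    test functions supported in the half ball.\<close>
  define D where "D = ball x0 (r / 2)"
  have clD: "closure D = cball x0 (r / 2)" and frD: "frontier D = sphere x0 (r / 2)" using r by (simp_all add: D_def)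
  have sub: "cball x0 (r / 2) \<subseteq> \<Omega>" using r1 r by (auto simp: subset_iff)
  have D\<Omega>: "D \<subseteq> \<Omega>" using sub ball_subset_cball[of x0 "r / 2"] unfolding D_def by blast
  have oD: "open D" and bD: "bounded D" by (simp_all add: D_def)
  have Dm: "D \<in> sets lebesgue" using oD by (simp add: lborelD)
  have x0D: "x0 \<in> D" using r by (simp add: D_def)
  have ca: "continuous_on \<Omega> a"
    using Ck_1_gradient(1)[OF a] has_derivative_continuous continuous_at_imp_continuous_on by blast
  have "bounded (a ` cball x0 (r / 2))"
    by (rule compact_imp_bounded[OF compact_continuous_image[OF continuous_on_subset[OF ca sub] compact_cball]])
  then obtain m where "\<forall>y\<in>a ` cball x0 (r / 2). norm y \<le> m" unfolding bounded_iff ..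
  then have m: "a x \<le> m" if "x \<in> D" for x
    using that ball_subset_cball[of x0 "r / 2"] unfolding D_def by (force simp: abs_le_iff)
  have caD: "continuous_on D a" by (rule continuous_on_subset[OF ca D\<Omega>])
  have aD: "0 \<le> a x" if "x \<in> D" for x using a0 D\<Omega> that by blast
  \<comment> \<open>In units of \<open>\<tau> * r\<^sup>2 / 64\<close>: at distance
    \<open>r / 2\<close> the difference \<open>h - \<phi>\<close> is at most
    \<open>2 - 8 + 1 = - 5\<close>, from the error of \<open>h\<close>, the quadratic shift and the
    Taylor error; at \<open>x0\<close> it is at least \<open>- 2\<close>. Lifting by
    \<open>4\<close> leaves \<open>h + k\<close> below \<open>\<phi>\<close> on the sphere and puts
    it above \<open>\<phi>\<close> at the centre.\<close>
  define k where "k = \<tau> / 16 * r\<^sup>2"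
  have "distributional_solution p q a D (\<lambda>x. h x + k)"
  proof (rule classical_weak_solution_distributional[OF oD bD p caD aD m _ G])
    show "((\<lambda>x. h x + k) has_derivative (\<lambda>k. G x \<bullet> k)) (at x)" for x
      using has_derivative_add[OF h has_derivative_const[of k]] by simp
    fix \<psi> assume \<psi>: "\<psi> \<in> test_functions D"
    define K where "K = closure {x. \<psi> x \<noteq> 0}"
    note t = test_functionD[OF \<psi>, folded K_def]
    let ?f = "\<lambda>x. A_dp p q a x (G x) \<bullet> gradient \<psi> x"
    have mG: "G \<in> borel_measurable (lebesgue_on D)"
      by (rule continuous_imp_measurable_on_sets_lebesgue[OF continuous_on_subset[OF G subset_UNIV] Dm])
    have mp: "gradient \<psi> \<in> borel_measurable (lebesgue_on D)"
      by (rule continuous_imp_measurable_on_sets_lebesgue[OF continuous_on_subset[OF t(2) subset_UNIV] Dm])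
    have mf: "?f \<in> borel_measurable (lebesgue_on D)"
      by (rule borel_measurable_inner[OF A_dp_measurable[OF Dm caD mG] mp])
    have f0: "?f x = 0" if "x \<notin> K" for x using t(7)[OF that] by simp
    obtain Bg where Bg: "\<And>x. norm (gradient \<psi> x) \<le> Bg" "0 \<le> Bg"
      using bounded_of_compact_support[OF t(4) continuous_on_subset[OF t(2) subset_UNIV] t(7)] by blast
    have "bounded (G ` K)"
      by (rule compact_imp_bounded[OF compact_continuous_image[OF continuous_on_subset[OF G subset_UNIV] t(4)]])
    then obtain BG where BG: "\<forall>y\<in>G ` K. norm y \<le> BG" unfolding bounded_iff ..
    define KA where "KA = \<bar>BG powr (p - 1) + m * BG powr (q - 1)\<bar>"
    have fb: "norm (?f x) \<le> KA * Bg" for x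
    proof (cases "x \<in> K")
      case True
      then have "x \<in> D" using t(5) by blast
      have "norm (A_dp p q a x (G x)) \<le> KA"
        using A_dp_bound[of a x m "G x" BG p q] aD[OF \<open>x \<in> D\<close>] m[OF \<open>x \<in> D\<close>] BG True p unfolding KA_def by force
      then have "norm (A_dp p q a x (G x)) * norm (gradient \<psi> x) \<le> KA * Bg"
        using Bg(1)[of x] by (intro mult_mono) (auto simp: KA_def)
      then show ?thesis using Cauchy_Schwarz_ineq2[of "A_dp p q a x (G x)" "gradient \<psi> x"] by simp
    next
      case False
      show ?thesis unfolding f0[OF False] using Bg(2) by (simp add: KA_def)
    qed
    have "(LINT x|lebesgue_on D. ?f x) = integral UNIV ?f"
      by (rule lebesgue_integral_compact_support(2)[OF Dm t(4,5) mf f0 fb])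
    also have "\<dots> = 0"
      by (rule integral_unique[OF hw[OF test_function_rescaled[OF \<psi>[unfolded D_def] r(1)]]])
    finally show "(LINT x|lebesgue_on D. ?f x) = 0" .
  qed
  moreover have "domain D" using r by (auto simp: domain_def D_def)
  moreover have "compactly_inside D \<Omega>" using oD sub by (simp add: compactly_inside_def clD)
  moreover have "continuous_on (closure D) (\<lambda>x. h x + k)"
  proof -
    have "continuous_on UNIV h" using h has_derivative_continuous continuous_at_imp_continuous_on by blast
    then show ?thesis by (intro continuous_on_add continuous_on_const) (rule continuous_on_subset[OF _ subset_UNIV])
  qed
  moreover have "ereal (h x + k) \<le> u x" if x: "x \<in> frontier D" for x
  proof -
    have dx: "dist x x0 = r / 2" using x by (simp add: frD dist_commute)
    then have x\<Omega>: "x \<in> \<Omega>" "x \<noteq> x0" using sub r by (auto simp: dist_commute)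
    have xr: "x \<in> cball x0 r" "dist x x0 < r2" using dx r by (auto simp: dist_commute)
    have B: "B (x - x0) \<bullet> (x - x0) = B0 (x - x0) \<bullet> (x - x0) - \<tau> * (dist x x0)\<^sup>2"
      by (simp add: B_def inner_diff_left dot_square_norm dist_norm)
    have dd: "(dist x x0)\<^sup>2 = r\<^sup>2 / 4" unfolding dx by (simp add: power_divide)
    have 1: "h x \<le> \<phi> x0 + \<xi> \<bullet> (x - x0) + (B0 (x - x0) \<bullet> (x - x0) - \<tau> * (r\<^sup>2 / 4)) / 2 + \<tau> / 32 * r\<^sup>2"
      using abs_le_D1[OF hP[OF xr(1)]] unfolding B dd by linarith
    have 2: "\<phi> x0 + \<xi> \<bullet> (x - x0) + B0 (x - x0) \<bullet> (x - x0) / 2 \<le> \<phi> x + \<tau> / 16 * (r\<^sup>2 / 4)"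
      using abs_le_D2[OF r2(2)[OF xr(2)]] unfolding dd by linarith
    have "0 \<le> \<tau> * r\<^sup>2" using \<tau> by simp
    then have "h x + k \<le> \<phi> x" using 1 2 unfolding k_def by (simp add: diff_divide_distrib)
    then have "ereal (h x + k) \<le> ereal (\<phi> x)" by simp
    also have "\<dots> \<le> u x" using below[OF x\<Omega>] by (rule less_imp_le)
    finally show ?thesis .
  qed
  ultimately have "ereal (h x0 + k) \<le> u x0" using u x0D unfolding superharmonic_def by blast
  then have "h x0 + k \<le> \<phi> x0" unfolding touch[symmetric] by simp
  moreover have "h x0 \<ge> \<phi> x0 - \<tau> / 32 * r\<^sup>2"
    using abs_le_D2[OF hP[of x0]] r linear_0[OF linB] by simp
  moreover have "0 < \<tau> * r\<^sup>2" using \<tau> r by simp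
  ultimately show False unfolding k_def by simp
qed

theorem theorem4p1:
  fixes \<Omega> :: "(real ^ 'n) set"
    and a :: "real ^ 'n \<Rightarrow> real"
    and p q \<alpha> :: real
    and u :: "real ^ 'n \<Rightarrow> ereal"
  assumes "CARD('n) \<ge> 2"
    and "domain \<Omega>" and "bounded \<Omega>"
    and "1 < p" and "p \<le> q"
    and "0 < \<alpha>" and "\<alpha> \<le> 1"
    and "\<forall>x\<in>\<Omega>. 0 \<le> a x"
    and "hoelder_on \<alpha> \<Omega> a"
    and "q / p \<le> 1 + \<alpha> / real CARD('n)"
    and "Ck 1 \<Omega> a"
    and "superharmonic p q a \<Omega> u"
  shows "viscosity_supersolution p q a \<Omega> u"
  unfolding viscosity_supersolution_def
proof (intro conjI ballI allI impI)
  have \<Omega>: "open \<Omega>" using assms(2) by (simp add: domain_def)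
  show "\<And>x. x \<in> \<Omega> \<Longrightarrow> u x \<noteq> - \<infinity>" "lsc_on \<Omega> u" "AE x in lebesgue_on \<Omega>. \<bar>u x\<bar> \<noteq> \<infinity>"
    using assms(12) unfolding superharmonic_def by blast+
  fix x0 \<phi>
  assume "x0 \<in> \<Omega>" "Ck 2 \<Omega> \<phi>" "ereal (\<phi> x0) = u x0" "\<forall>x\<in>\<Omega>. x \<noteq> x0 \<longrightarrow> ereal (\<phi> x) < u x" "gradient \<phi> x0 \<noteq> 0"
  then have "divergence (\<lambda>x. A_dp p q a x (gradient \<phi> x)) x0 \<le> 0"
    using assms(8) by (intro superharmonic_touching_test[OF \<Omega> assms(4,5) _ assms(11,12)]) auto
  then show "0 \<le> - divergence (\<lambda>x. A_dp p q a x (gradient \<phi> x)) x0" by simp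
qed

end
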